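(* Let $\mathcal{X}=[X_1,\dots,X_p]\in\mathbb{R}^{m\times ps}$ with blocks $X_j\in\mathbb{R}^{m\times s}$, and let $\mathcal{X}_k=[X_1,\dots,X_k]$ (so $\mathcal{X}_1=X_1$). Let $\widehat{\mathcal{Q}}_k$ and $\widehat{\mathcal{R}}_k$ be the quantities computed in floating-point arithmetic by the algorithm BCGSI+P-2S (given in the context) applied to $\mathcal{X}$, and assume $O(u)\,\kappa(\mathcal{X}_k)\le 1/2$ (for all $k\in\{1,\dots,p\}$). Assume also that for $\mathcal{X}_1$, with $\kappa(\mathcal{X}_1)\le\kappa(\mathcal{X})$, the computed output $[\widehat Q,\widehat R]=\mathrm{IO}_A(\mathcal{X}_1)$ satisfies $$\mathcal{X}_1+\Delta\mathcal{X}_1=\widehat Q\widehat R,\quad \|\Delta\mathcal{X}_1\|\le O(u)\|\mathcal{X}_1\|,\qquad \|I-\widehat Q^T\widehat Q\|\le O(u),$$ and that for all $X\in\mathbb{R}^{m\times s}$ with $\kappa(X)\le\kappa(\mathcal{X})$, the computed output $[\widehat Q,\widehat R]=\mathrm{IO}_1(X)$ satisfies $$X+\Delta X=\widehat Q\widehat R,\quad \|\Delta X\|\le O(u)\|X\|,\qquad \|I-\widehat Q^T\widehat Q\|\le O(u)\,\kappa^{\alpha_1}(X)$$ with $\alpha_1\le1$. Then for all $k\in\{1,\dots,p\}$ there is a matrix $\Delta\mathcal{X}_k$ such that $$\mathcal{X}_k+\Delta\mathcal{X}_k=\widehat{\mathcal{Q}}_k\widehat{\mathcal{R}}_k,\quad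 \|\Delta\mathcal{X}_k\|\le O(u)\|\mathcal{X}_k\|,$$ $$\|I-\widehat{\mathcal{Q}}_k^{T}\widehat{\mathcal{Q}}_k\|\le O(u).$$
   Context: Conventions. $\|\cdot\|$ is the 2-norm; $\kappa(M)=\sigma_{\max}(M)/\sigma_{\min}(M)$ for $\sigma_{\min}(M)>0$. $u$ is the unit roundoff, computations follow the standard model of floating-point arithmetic, and hats denote computed quantities. $O(u)$ denotes a quantity bounded by $c\,u$, where $c$ depends only on the dimensions (a modest polynomial in $m,s,p$), not on condition numbers, and may differ at each occurrence. A hypothesis such as "$O(u)\kappa\le 1/2$" means this inequality for a suitable such $c$. $\mathrm{chol}(M)$ returns the upper triangular Cholesky factor $C$ with $C^TC=M$. $\mathrm{IO}_A$ and $\mathrm{IO}_1$ are routines ("intraorthogonalizations") that compute a thin QR factorization $X=QR$ of an $m\times s$ block. Algorithm BCGSI+P-2S (input $\mathcal{X}=[X_1,\dots,X_p]$ and the routines $\mathrm{IO}_A$, $\mathrm{IO}_1$). $S_{1:k,k+1}$, $Y_{1:k,k+1}$, $R_{1:k,k+1}$ denote block columns with $k$ blocks of size $s\times s$; $\mathcal{Q}_k=[Q_1,\dots,Q_k]$; $\mathcal{R}_k=(R_{ij})_{1\le i,j\le k}$ is block upper triangular. 1. $[Q_1,R_{11}]=\mathrm{IO}_A(X_1)$; $S_{12}=Q_1^TX_2$. 2. For $k=1,\dots,p-1$: (a) if $k\ge2$, set $S_{1:k,k+1}=\begin{bmatrix} Z_{k-1}\\ Y_{kk}^{-T}\,(P_k-Y_{1:k-1,k}^TZ_{k-1})\end{bmatrix}$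 (for $k=1$ use $S_{12}$ from step 1); (b) $[U_{k+1},S_{k+1,k+1}]=\mathrm{IO}_1(X_{k+1}-\mathcal{Q}_kS_{1:k,k+1})$; (c) compute $Y_{1:k,k+1}=\mathcal{Q}_k^TU_{k+1}$ and $\Omega_{k+1}=U_{k+1}^TU_{k+1}$; if $k<p-1$, also compute in the same synchronization $Z_k=\mathcal{Q}_k^TX_{k+2}$ and $P_{k+1}=U_{k+1}^TX_{k+2}$; (d) $Y_{k+1,k+1}=\mathrm{chol}(\Omega_{k+1}-Y_{1:k,k+1}^TY_{1:k,k+1})$; (e) $Q_{k+1}=(U_{k+1}-\mathcal{Q}_kY_{1:k,k+1})Y_{k+1,k+1}^{-1}$; (f) $R_{1:k,k+1}=S_{1:k,k+1}+Y_{1:k,k+1}S_{k+1,k+1}$ and $R_{k+1,k+1}=Y_{k+1,k+1}S_{k+1,k+1}$. 3. Return $\mathcal{Q}=\mathcal{Q}_p$, $\mathcal{R}=\mathcal{R}_p$.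
   Formalization: IO_1 is assumed accurate for all X with κ(X) ≤ (1+O(u)κ(𝒳))κ(𝒳), not only κ(X) ≤ κ(𝒳): the computed block passed to IO_1 may exceed κ(𝒳) by rounding, and the claim then fails (e.g. X_1=[e1,e2], X_2=[e3,e4/2]). *)

theory Defs
  imports
    "Jordan_Normal_Form.Char_Poly"
    "HOL-Library.Multiset"
    Complex_Main
begin

definition vec_norm2 :: "real vec \<Rightarrow> real" where
  "vec_norm2 v = sqrt (v \<bullet> v)"

definition norm2 :: "real mat \<Rightarrow> real" where
  "norm2 M = (SUP v \<in> {v \<in> carrier_vec (dim_col M). vec_norm2 v = 1}. vec_norm2 (M *\<^sub>v v))"

text \<open>A matrix with \<open>n\<close> columns has \<open>n\<close> singular values here, so \<open>sigma_min M > 0\<close> means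
  full column rank, also for matrices with more columns than rows. Since division is total,
  \<open>cond2 M\<close> is meaningful only if \<open>sigma_min M > 0\<close>.\<close>

definition singular_values :: "real mat \<Rightarrow> real set" where
  "singular_values M = {\<sigma>. 0 \<le> \<sigma> \<and> eigenvalue (M\<^sup>T * M) (\<sigma>\<^sup>2)}"

definition sigma_max :: "real mat \<Rightarrow> real" where
  "sigma_max M = Max (singular_values M)"

definition sigma_min :: "real mat \<Rightarrow> real" where
  "sigma_min M = Min (singular_values M)"

definition cond2 :: "real mat \<Rightarrow> real" where
  "cond2 M = sigma_max M / sigma_min M"

definition append_cols :: "real mat \<Rightarrow> real mat \<Rightarrow> real mat" (infixl \<open>@\<^sub>c\<close> 65) where
  "A @\<^sub>c B = four_block_mat A B (0\<^sub>m 0 (dim_col A)) (0\<^sub>m 0 (dim_col B))"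

text \<open>\<open>block_row m B k = [B 1, \<dots>, B k]\<close>, where the blocks have \<open>m\<close> rows.\<close>

primrec block_row :: "nat \<Rightarrow> (nat \<Rightarrow> real mat) \<Rightarrow> nat \<Rightarrow> real mat" where
  "block_row m B 0 = 0\<^sub>m m 0"
| "block_row m B (Suc k) = block_row m B k @\<^sub>c B (Suc k)"

text \<open>The block upper triangular matrix whose \<open>j\<close>-th block column consists of the stacked blocks
  \<open>C j\<close> above the diagonal (with \<open>j - 1\<close> blocks) and of the diagonal block \<open>D j\<close>;
  \<open>C 1\<close> is irrelevant.\<close>

primrec block_upper :: "(nat \<Rightarrow> real mat) \<Rightarrow> (nat \<Rightarrow> real mat) \<Rightarrow> nat \<Rightarrow> real mat" where
  "block_upper C D 0 = 0\<^sub>m 0 0"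
| "block_upper C D (Suc k) =
     four_block_mat (block_upper C D k) (C (Suc k))
       (0\<^sub>m (dim_row (D (Suc k))) (dim_col (block_upper C D k))) (D (Suc k))"

text \<open>\<open>rounded u x y\<close>: \<open>y\<close> is an admissible computed value of a single operation (addition,
  subtraction, multiplication, division, square root) with exact result \<open>x\<close>. All kernels below
  relate their inputs to every result that is admissible in this sense. Negation and
  transposition are exact.\<close>

definition rounded :: "real \<Rightarrow> real \<Rightarrow> real \<Rightarrow> bool" where
  "rounded u x y \<longleftrightarrow> (\<exists>\<delta>. \<bar>\<delta>\<bar> \<le> u \<and> y = x * (1 + \<delta>))"

text \<open>Summation in an arbitrary order. The nonemptiness conditions prevent spurious additions
  of an empty sum.\<close>

inductive fl_sum :: "real \<Rightarrow> real multiset \<Rightarrow> real \<Rightarrow> bool" for u where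
  empty: "fl_sum u {#} 0"
| single: "fl_sum u {#x#} x"
| add: "M \<noteq> {#} \<Longrightarrow> N \<noteq> {#} \<Longrightarrow> fl_sum u M a \<Longrightarrow> fl_sum u N b \<Longrightarrow> rounded u (a + b) s
    \<Longrightarrow> fl_sum u (M + N) s"

text \<open>The sum of the elements of \<open>M\<close> and of the products \<open>a l * b l\<close> for \<open>l < n\<close>.\<close>

definition fl_inner ::
  "real \<Rightarrow> real multiset \<Rightarrow> nat \<Rightarrow> (nat \<Rightarrow> real) \<Rightarrow> (nat \<Rightarrow> real) \<Rightarrow> real \<Rightarrow> bool" where
  "fl_inner u M n a b r \<longleftrightarrow>
     (\<exists>t. (\<forall>l<n. rounded u (a l * b l) (t l)) \<and>
          fl_sum u (M + image_mset t (mset_set {..<n})) r)"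

definition fl_mult :: "real \<Rightarrow> real mat \<Rightarrow> real mat \<Rightarrow> real mat \<Rightarrow> bool" where
  "fl_mult u A B R \<longleftrightarrow>
     R \<in> carrier_mat (dim_row A) (dim_col B) \<and>
     (\<forall>i<dim_row A. \<forall>j<dim_col B.
        fl_inner u {#} (dim_col A) (\<lambda>l. A $$ (i,l)) (\<lambda>l. B $$ (l,j)) (R $$ (i,j)))"

definition fl_add_mult :: "real \<Rightarrow> real mat \<Rightarrow> real mat \<Rightarrow> real mat \<Rightarrow> real mat \<Rightarrow> bool" where
  "fl_add_mult u C A B R \<longleftrightarrow>
     R \<in> carrier_mat (dim_row A) (dim_col B) \<and>
     (\<forall>i<dim_row A. \<forall>j<dim_col B.
        fl_inner u {#C $$ (i,j)#} (dim_col A) (\<lambda>l. A $$ (i,l)) (\<lambda>l. B $$ (l,j)) (R $$ (i,j)))"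

text \<open>\<open>T\<close> is the solution of \<open>L * T = B\<close>, with \<open>L\<close> lower triangular, computed by forward
  substitution.\<close>

definition fl_forward_subst :: "real \<Rightarrow> real mat \<Rightarrow> real mat \<Rightarrow> real mat \<Rightarrow> bool" where
  "fl_forward_subst u L B T \<longleftrightarrow>
     T \<in> carrier_mat (dim_row B) (dim_col B) \<and>
     (\<forall>i<dim_row B. \<forall>j<dim_col B. \<exists>d.
        fl_inner u {#B $$ (i,j)#} i (\<lambda>l. - L $$ (i,l)) (\<lambda>l. T $$ (l,j)) d \<and>
        rounded u (d / L $$ (i,i)) (T $$ (i,j)))"

text \<open>\<open>C\<close> is the computed upper triangular Cholesky factor of \<open>M\<close>, of which only the upper triangle
  is read. There is no breakdown: for a nonpositive pivot, the total functions
  \<^const>\<open>sqrt\<close> and \<open>(/)\<close> yield some (useless) factor, so that statements about all computed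
  factors include this case.\<close>

definition fl_chol :: "real \<Rightarrow> real mat \<Rightarrow> real mat \<Rightarrow> bool" where
  "fl_chol u M C \<longleftrightarrow>
     C \<in> carrier_mat (dim_row M) (dim_row M) \<and> upper_triangular C \<and>
     (\<forall>j<dim_row M. \<forall>i\<le>j. \<exists>d.
        fl_inner u {#M $$ (i,j)#} i (\<lambda>l. - C $$ (l,i)) (\<lambda>l. C $$ (l,j)) d \<and>
        (if i = j then rounded u (sqrt d) (C $$ (i,j))
         else rounded u (d / C $$ (i,i)) (C $$ (i,j))))"

text \<open>An intraorthogonalization maps a block to its computed thin QR factorization.
  Nothing but the format of the output is fixed here.\<close>

definition intraorthogonalization ::
  "nat \<Rightarrow> nat \<Rightarrow> (real mat \<Rightarrow> real mat \<times> real mat) \<Rightarrow> bool" where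
  "intraorthogonalization m s IO \<longleftrightarrow>
     (\<forall>X \<in> carrier_mat m s. \<forall>Q R. IO X = (Q, R) \<longrightarrow>
        Q \<in> carrier_mat m s \<and> R \<in> carrier_mat s s \<and> upper_triangular R)"

text \<open>\<open>Q j\<close>, \<open>Rc j\<close>, \<open>Rd j\<close> are computed values of \<open>Q\<^sub>j\<close>, \<open>R\<^bsub>1:j-1,j\<^esub>\<close>, \<open>R\<^bsub>jj\<^esub>\<close>; likewise for
  \<open>S\<close>, \<open>Sd\<close> and \<open>Y\<close>, \<open>Yd\<close>. The remaining letters are those of the algorithm; \<open>T\<close>, \<open>S'\<close>, \<open>W\<close>, \<open>G\<close>, \<open>V\<close>
  are intermediate results. The right division by \<open>Y\<^bsub>k+1,k+1\<^esub>\<close> is a forward substitution with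
  the transposed matrices.\<close>

definition bcgsi_p_2s ::
  "real \<Rightarrow> (real mat \<Rightarrow> real mat \<times> real mat) \<Rightarrow> (real mat \<Rightarrow> real mat \<times> real mat) \<Rightarrow>
   nat \<Rightarrow> nat \<Rightarrow> (nat \<Rightarrow> real mat) \<Rightarrow>
   (nat \<Rightarrow> real mat) \<Rightarrow> (nat \<Rightarrow> real mat) \<Rightarrow> (nat \<Rightarrow> real mat) \<Rightarrow> bool" where
  "bcgsi_p_2s u IO_A IO_1 m p X Q Rc Rd \<longleftrightarrow>
     (\<exists>S Sd U Y Yd \<Omega> Z P.
        IO_A (X 1) = (Q 1, Rd 1) \<and>
        (2 \<le> p \<longrightarrow> fl_mult u (Q 1)\<^sup>T (X 2) (S 2)) \<and>
        (\<forall>k \<in> {1..<p}. let Qk = block_row m Q k in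
          (2 \<le> k \<longrightarrow> (\<exists>T S'.
             fl_add_mult u (P k) (- (Y k)\<^sup>T) (Z (k - 1)) T \<and>
             fl_forward_subst u (Yd k)\<^sup>T T S' \<and>
             S (k + 1) = Z (k - 1) @\<^sub>r S')) \<and>
          (\<exists>W. fl_add_mult u (X (k + 1)) (- Qk) (S (k + 1)) W \<and>
             IO_1 W = (U (k + 1), Sd (k + 1))) \<and>
          fl_mult u Qk\<^sup>T (U (k + 1)) (Y (k + 1)) \<and>
          fl_mult u (U (k + 1))\<^sup>T (U (k + 1)) (\<Omega> (k + 1)) \<and>
          (k < p - 1 \<longrightarrow>
             fl_mult u Qk\<^sup>T (X (k + 2)) (Z k) \<and>
             fl_mult u (U (k + 1))\<^sup>T (X (k + 2)) (P (k + 1))) \<and>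
          (\<exists>G. fl_add_mult u (\<Omega> (k + 1)) (- (Y (k + 1))\<^sup>T) (Y (k + 1)) G \<and>
             fl_chol u G (Yd (k + 1))) \<and>
          (\<exists>V. fl_add_mult u (U (k + 1)) (- Qk) (Y (k + 1)) V \<and>
             fl_forward_subst u (Yd (k + 1))\<^sup>T V\<^sup>T (Q (k + 1))\<^sup>T) \<and>
          fl_add_mult u (S (k + 1)) (Y (k + 1)) (Sd (k + 1)) (Rc (k + 1)) \<and>
          fl_mult u (Yd (k + 1)) (Sd (k + 1)) (Rd (k + 1))))"

text \<open>The constants hidden in \<open>O(u)\<close>: functions of the dimensions of at most polynomial growth.\<close>

definition dim_const :: "(nat \<Rightarrow> nat \<Rightarrow> nat \<Rightarrow> real) \<Rightarrow> bool" where
  "dim_const c \<longleftrightarrow>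
     (\<exists>C d. \<forall>m s p. 0 \<le> c m s p \<and> c m s p \<le> C * real (1 + m + s + p) ^ d)"

end

theory Submission
  imports Defs "HOL-Analysis.Inner_Product" "HOL-Analysis.L2_Norm"
begin

text \<open>
  The proof is an induction over the block columns. Since \<open>U\<^sub>k \<approx> \<Q>\<^sub>k\<^sub>-\<^sub>1 Y + Q\<^sub>k Y\<^sub>k\<^sub>k\<close> up to
  \<open>O(u)\<close>, the delayed coefficients \<open>S\<close> agree with \<open>\<Q>\<^sub>k\<^sup>T X\<^sub>k\<^sub>+\<^sub>1\<close> up to \<open>O(u) \<parallel>X\<^sub>k\<^sub>+\<^sub>1\<parallel>\<close>. Hence
  \<open>W = X\<^sub>k\<^sub>+\<^sub>1 - \<Q>\<^sub>k S\<close> has, up to relative errors \<open>O(u) \<kappa>\<close>, singular values between the extreme ones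
  of all columns, so that the hypothesis on the second intraorthogonalization applies, and
  \<open>Y \<approx> \<Q>\<^sub>k\<^sup>T U\<close> is \<open>O(u) \<kappa>\<close>. Then the Cholesky argument is close to the identity, \<open>Q\<^sub>k\<^sub>+\<^sub>1\<close> is orthonormal
  and orthogonal to \<open>\<Q>\<^sub>k\<close> up to \<open>O(u)\<close>, and the earlier loss of orthogonality enters only multiplied by
  the tiny \<open>Y\<close>: it accumulates additively, which keeps the constants polynomial.

  Since constants may depend on the dimensions, all errors are measured in the Frobenius norm. All
  matrices are embedded into a single ring, the finitely supported functions on \<open>\<nat> \<times> \<nat>\<close>, with \<open>idm n\<close> in
  the role of the identity matrices and \<open>sel n s\<close> placing a block to the right of \<open>n\<close> columns, so that
  block manipulations become ring identities.
\<close>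

section \<open>Finitely supported matrices\<close>

text \<open>The hypothesis on the second intraorthogonalization can be used only if the computed W
  has condition number at most (1 + O(u) \<kappa>) \<kappa>. Frobenius norms would lose a dimension
  factor here, so singular value bounds are stated in operator form,
  \<open>norm (A * V) \<le> c * norm V\<close> or its reverse, for all V with the right number of
  rows: V may have many columns, but the best c is the one for vectors. Elsewhere dimension factors
  are harmless.

  Two scales of error have to be kept apart. U is orthonormal only up to O(u) \<kappa>, and the
  Cholesky argument is only that close to the identity; this merely has to be small. The residuals
  are O(u) without \<kappa>: that of U against its expansion in old and new columns, that of
  \<open>tr C * C\<close> against \<open>tr U * U - tr Y * Y\<close>, and those of the triangular
  solves. The new columns inherit their orthogonality from the residuals, which is what removes
  \<kappa> from the final bounds.\<close>

typedef fmat = "{f :: nat \<Rightarrow> nat \<Rightarrow> real. \<exists>N. \<forall>i j. N \<le> i \<or> N \<le> j \<longrightarrow> f i j = 0}"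
  morphisms entry Fmat
  by (rule exI[of _ "\<lambda>_ _. 0"]) simp

setup_lifting type_definition_fmat

lemma fmat_eqI: "(\<And>i j. entry A i j = entry B i j) \<Longrightarrow> A = B"
  by (metis entry_inverse ext)

text \<open>Any bound on the support would do; the choice is arbitrary, and only the property
  \<open>entry_beyond_size\<close> matters.\<close>

definition size_fmat :: "fmat \<Rightarrow> nat" where
  "size_fmat A = (SOME N. \<forall>i j. N \<le> i \<or> N \<le> j \<longrightarrow> entry A i j = 0)"

lemma entry_beyond_size: "size_fmat A \<le> i \<or> size_fmat A \<le> j \<Longrightarrow> entry A i j = 0"
proof -
  have "\<exists>N. \<forall>i j. N \<le> i \<or> N \<le> j \<longrightarrow> entry A i j = 0"
    using entry[of A] by simp
  from someI_ex[OF this] show "size_fmat A \<le> i \<or> size_fmat A \<le> j \<Longrightarrow> entry A i j = 0"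
    unfolding size_fmat_def by blast
qed

lemma sum_lessThan_cong_support:
  fixes f :: "nat \<Rightarrow> real"
  assumes "\<And>l. M \<le> l \<Longrightarrow> f l = 0" "\<And>l. N \<le> l \<Longrightarrow> f l = 0"
  shows "sum f {..<M} = sum f {..<N}"
proof -
  have "sum f {..<M} = sum f {..<max M N}"
    by (rule sum.mono_neutral_left) (auto simp: assms)
  also have "\<dots> = sum f {..<N}"
    by (rule sum.mono_neutral_right) (auto simp: assms)
  finally show ?thesis .
qed

instantiation fmat :: ring
begin

lift_definition zero_fmat :: fmat is "\<lambda>_ _. 0" by simp
lift_definition plus_fmat :: "fmat \<Rightarrow> fmat \<Rightarrow> fmat" is "\<lambda>f g i j. f i j + g i j"
  by (metis add_0 le_cases order_trans)
lift_definition uminus_fmat :: "fmat \<Rightarrow> fmat" is "\<lambda>f i j. - f i j" by simp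
lift_definition minus_fmat :: "fmat \<Rightarrow> fmat \<Rightarrow> fmat" is "\<lambda>f g i j. f i j - g i j"
  by (metis diff_0_right le_cases order_trans)

definition times_fmat :: "fmat \<Rightarrow> fmat \<Rightarrow> fmat" where
  "A * B = Fmat (\<lambda>i j. \<Sum>l<size_fmat A. entry A i l * entry B l j)"

lemma entry_times: "entry (A * B) i j = (\<Sum>l<size_fmat A. entry A i l * entry B l j)"
proof -
  have "(\<lambda>i j. \<Sum>l<size_fmat A. entry A i l * entry B l j)
     \<in> {f. \<exists>N. \<forall>i j. N \<le> i \<or> N \<le> j \<longrightarrow> f i j = 0}"
    by (auto intro!: exI[of _ "max (size_fmat A) (size_fmat B)"] sum.neutral simp: entry_beyond_size)
  then show ?thesis by (simp add: times_fmat_def Fmat_inverse)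
qed

text \<open>The cut-off in the definition depends on the left factor alone; this replaces it by any
  other valid one, so that several products can be summed over a common range.\<close>

lemma entry_times_bound:
  assumes "\<And>l. N \<le> l \<Longrightarrow> entry A i l * entry B l j = 0"
  shows "entry (A * B) i j = (\<Sum>l<N. entry A i l * entry B l j)"
  unfolding entry_times
  by (rule sum_lessThan_cong_support) (auto simp: assms[simplified] entry_beyond_size)

lemmas entry_arith [simp] = zero_fmat.rep_eq plus_fmat.rep_eq uminus_fmat.rep_eq minus_fmat.rep_eq

instance
proof
  fix A B C :: fmat
  show "A + B + C = A + (B + C)" "A + B = B + A" "0 + A = A" "- A + A = 0" "A - B = A + - B"
    by (auto intro!: fmat_eqI)
  show "(A * B) * C = A * (B * C)"
  proof (rule fmat_eqI)
    fix i j
    let ?N = "max (size_fmat A) (size_fmat B)"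
    have 1: "entry (A * B) i l = (\<Sum>h<?N. entry A i h * entry B h l)" for i l
      by (rule entry_times_bound) (auto simp: entry_beyond_size)
    have 2: "entry (B * C) l j = (\<Sum>h<?N. entry B l h * entry C h j)" for l j
      by (rule entry_times_bound) (auto simp: entry_beyond_size)
    have "entry ((A * B) * C) i j = (\<Sum>l<?N. entry (A * B) i l * entry C l j)"
      by (rule entry_times_bound) (auto simp: entry_times entry_beyond_size)
    also have "\<dots> = (\<Sum>l<?N. \<Sum>h<?N. entry A i h * entry B h l * entry C l j)"
      unfolding 1 by (simp add: sum_distrib_right)
    also have "\<dots> = (\<Sum>h<?N. \<Sum>l<?N. entry A i h * entry B h l * entry C l j)"
      by (rule sum.swap)
    also have "\<dots> = (\<Sum>h<?N. entry A i h * entry (B * C) h j)"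
      unfolding 2 by (simp add: sum_distrib_left mult.assoc)
    also have "\<dots> = entry (A * (B * C)) i j"
      by (rule entry_times_bound[symmetric]) (auto simp: entry_beyond_size)
    finally show "entry ((A * B) * C) i j = entry (A * (B * C)) i j" .
  qed
  show "(A + B) * C = A * C + B * C"
  proof (rule fmat_eqI)
    fix i j
    let ?N = "max (size_fmat A) (size_fmat B)"
    have "entry ((A + B) * C) i j = (\<Sum>l<?N. entry (A + B) i l * entry C l j)"
      "entry (A * C) i j = (\<Sum>l<?N. entry A i l * entry C l j)"
      "entry (B * C) i j = (\<Sum>l<?N. entry B i l * entry C l j)"
      by (rule entry_times_bound, auto simp: entry_beyond_size)+
    then show "entry ((A + B) * C) i j = entry (A * C + B * C) i j"
      by (simp add: sum.distrib algebra_simps)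
  qed
  show "A * (B + C) = A * B + A * C"
    by (rule fmat_eqI) (simp add: entry_times sum.distrib algebra_simps)
qed

end

section \<open>The Frobenius inner product and norm\<close>

definition fmat_inner :: "fmat \<Rightarrow> fmat \<Rightarrow> real" where
  "fmat_inner A B = (\<Sum>i<size_fmat A. \<Sum>j<size_fmat A. entry A i j * entry B i j)"

lemma fmat_inner_bound:
  assumes "\<And>i j. N \<le> i \<Longrightarrow> entry A i j * entry B i j = 0"
    and "\<And>i j. M \<le> j \<Longrightarrow> entry A i j * entry B i j = 0"
  shows "fmat_inner A B = (\<Sum>i<N. \<Sum>j<M. entry A i j * entry B i j)"
proof -
  have "fmat_inner A B = (\<Sum>i<size_fmat A. \<Sum>j<M. entry A i j * entry B i j)"
    unfolding fmat_inner_def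
    by (rule sum.cong[OF refl], rule sum_lessThan_cong_support)
      (use assms(2) in \<open>auto simp: entry_beyond_size\<close>)
  also have "\<dots> = (\<Sum>i<N. \<Sum>j<M. entry A i j * entry B i j)"
    by (rule sum_lessThan_cong_support, rule sum.neutral,
        use assms(1) in \<open>auto simp: entry_beyond_size\<close>, rule sum.neutral,
        use assms(1) in \<open>auto simp: entry_beyond_size\<close>)
  finally show ?thesis .
qed

text \<open>With the trace form as inner product, the norm is the Frobenius norm, and the triangle
  and Cauchy-Schwarz inequalities come with the class.\<close>

instantiation fmat :: real_inner
begin

lift_definition scaleR_fmat :: "real \<Rightarrow> fmat \<Rightarrow> fmat" is "\<lambda>c f i j. c * f i j" by auto

lemma entry_scaleR [simp]: "entry (c *\<^sub>R A) i j = c * entry A i j"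
  by (simp add: scaleR_fmat.rep_eq)

definition inner_fmat :: "fmat \<Rightarrow> fmat \<Rightarrow> real" where "inner_fmat = fmat_inner"
definition norm_fmat :: "fmat \<Rightarrow> real" where "norm_fmat A = sqrt (fmat_inner A A)"
definition sgn_fmat :: "fmat \<Rightarrow> fmat" where "sgn_fmat A = inverse (norm A) *\<^sub>R A"
definition dist_fmat :: "fmat \<Rightarrow> fmat \<Rightarrow> real" where "dist_fmat A B = norm (A - B)"
definition uniformity_fmat :: "(fmat \<times> fmat) filter" where
  "uniformity_fmat = (INF e\<in>{0<..}. principal {(x, y). dist x y < e})"
definition open_fmat :: "fmat set \<Rightarrow> bool" where
  "open_fmat U \<longleftrightarrow> (\<forall>x\<in>U. eventually (\<lambda>(x', y). x' = x \<longrightarrow> y \<in> U) uniformity)"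

instance
proof
  fix A B C :: fmat and a b :: real
  show "a *\<^sub>R (A + B) = a *\<^sub>R A + a *\<^sub>R B" "(a + b) *\<^sub>R A = a *\<^sub>R A + b *\<^sub>R A"
    "a *\<^sub>R b *\<^sub>R A = (a * b) *\<^sub>R A" "1 *\<^sub>R A = A"
    by (auto intro!: fmat_eqI simp: algebra_simps)
  let ?N = "max (size_fmat A) (max (size_fmat B) (size_fmat C))"
  have *: "inner X Y = (\<Sum>i<?N. \<Sum>j<?N. entry X i j * entry Y i j)"
    if "\<And>i j. ?N \<le> i \<or> ?N \<le> j \<Longrightarrow> entry X i j * entry Y i j = 0" for X Y
    unfolding inner_fmat_def by (rule fmat_inner_bound) (use that in auto)
  have 0: "inner A B = (\<Sum>i<?N. \<Sum>j<?N. entry A i j * entry B i j)"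
    "inner B A = (\<Sum>i<?N. \<Sum>j<?N. entry B i j * entry A i j)"
    "inner A C = (\<Sum>i<?N. \<Sum>j<?N. entry A i j * entry C i j)"
    "inner B C = (\<Sum>i<?N. \<Sum>j<?N. entry B i j * entry C i j)"
    "inner A A = (\<Sum>i<?N. \<Sum>j<?N. entry A i j * entry A i j)"
    "inner (A + B) C = (\<Sum>i<?N. \<Sum>j<?N. entry (A + B) i j * entry C i j)"
    "inner (a *\<^sub>R A) B = (\<Sum>i<?N. \<Sum>j<?N. entry (a *\<^sub>R A) i j * entry B i j)"
    by (rule *, fastforce simp: entry_beyond_size)+
  show "inner A B = inner B A" unfolding 0 by (simp add: mult.commute)
  show "inner (A + B) C = inner A C + inner B C"
    unfolding 0 by (simp add: sum.distrib algebra_simps)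
  show "inner (a *\<^sub>R A) B = a * inner A B"
    unfolding 0 by (simp add: sum_distrib_left algebra_simps)
  show "0 \<le> inner A A" unfolding 0 by (intro sum_nonneg) simp
  show "inner A A = 0 \<longleftrightarrow> A = 0"
  proof
    assume "inner A A = 0"
    then have "\<forall>i<?N. (\<Sum>j<?N. entry A i j * entry A i j) = 0"
      unfolding 0 by (subst (asm) sum_nonneg_eq_0_iff) (auto intro: sum_nonneg)
    then have "\<forall>i<?N. \<forall>j<?N. entry A i j = 0"
      by (subst (asm) sum_nonneg_eq_0_iff) auto
    then show "A = 0"
      by (intro fmat_eqI) (metis entry_beyond_size leI max.bounded_iff zero_fmat.rep_eq)
  next
    assume "A = 0"
    then show "inner A A = 0" unfolding 0 by simp
  qed
qed (simp_all add: norm_fmat_def inner_fmat_def sgn_fmat_def dist_fmat_def uniformity_fmat_def open_fmat_def)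

end

lemma inner_fmat_bound:
  assumes "\<And>i j. N \<le> i \<Longrightarrow> entry A i j * entry B i j = 0"
    and "\<And>i j. M \<le> j \<Longrightarrow> entry A i j * entry B i j = 0"
  shows "inner A B = (\<Sum>i<N. \<Sum>j<M. entry A i j * entry B i j)"
  unfolding inner_fmat_def by (rule fmat_inner_bound) (use assms in auto)

lemma norm_fmat_square:
  assumes "\<And>i j. N \<le> i \<Longrightarrow> entry A i j = 0" and "\<And>i j. M \<le> j \<Longrightarrow> entry A i j = 0"
  shows "(norm A)\<^sup>2 = (\<Sum>i<N. \<Sum>j<M. (entry A i j)\<^sup>2)"
  unfolding power2_norm_eq_inner
  by (subst inner_fmat_bound[of N _ _ M]) (auto simp: assms power2_eq_square)

section \<open>Transposition as adjoint, submultiplicativity\<close>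

lift_definition tr :: "fmat \<Rightarrow> fmat" is "\<lambda>f i j. f j i" by auto

lemma entry_tr [simp]: "entry (tr A) i j = entry A j i"
  by (simp add: tr.rep_eq)

lemma tr_simps [simp]: "tr (tr A) = A" "tr (A + B) = tr A + tr B" "tr (A - B) = tr A - tr B"
  "tr (- A) = - tr A" "tr 0 = 0"
  by (auto intro!: fmat_eqI)

lemma tr_times [simp]: "tr (A * B) = tr B * tr A"
proof (rule fmat_eqI)
  fix i j
  let ?N = "max (size_fmat A) (size_fmat B)"
  have "entry (A * B) j i = (\<Sum>l<?N. entry A j l * entry B l i)"
    by (rule entry_times_bound) (auto simp: entry_beyond_size)
  moreover have "entry (tr B * tr A) i j = (\<Sum>l<?N. entry (tr B) i l * entry (tr A) l j)"
    by (rule entry_times_bound) (auto simp: entry_beyond_size)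
  ultimately show "entry (tr (A * B)) i j = entry (tr B * tr A) i j"
    by (simp add: mult.commute)
qed

lemma inner_tr [simp]: "inner (tr A) (tr B) = inner A B"
proof -
  let ?N = "max (size_fmat A) (size_fmat B)"
  have "inner (tr A) (tr B) = (\<Sum>i<?N. \<Sum>j<?N. entry A j i * entry B j i)"
    by (subst inner_fmat_bound[of ?N _ _ ?N]) (auto simp: entry_beyond_size)
  also have "\<dots> = (\<Sum>i<?N. \<Sum>j<?N. entry A i j * entry B i j)" by (rule sum.swap)
  also have "\<dots> = inner A B"
    by (subst inner_fmat_bound[of ?N _ _ ?N]) (auto simp: entry_beyond_size)
  finally show ?thesis .
qed

lemma norm_tr [simp]: "norm (tr A) = norm A"
  by (simp add: norm_eq_sqrt_inner)

text \<open>Transposition is the adjoint for the trace form. This turns Gram forms into squared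
  norms and replaces spectral arguments throughout.\<close>

lemma inner_times_left: "inner (A * B) C = inner B (tr A * C)"
proof -
  let ?N = "max (size_fmat A) (max (size_fmat B) (size_fmat C))"
  have 1: "entry (A * B) i j = (\<Sum>l<?N. entry A i l * entry B l j)" for i j
    by (rule entry_times_bound) (auto simp: entry_beyond_size)
  have 2: "entry (tr A * C) l j = (\<Sum>i<?N. entry A i l * entry C i j)" for l j
    by (subst entry_times_bound[of ?N]) (auto simp: entry_beyond_size)
  have "inner (A * B) C = (\<Sum>i<?N. \<Sum>j<?N. entry (A * B) i j * entry C i j)"
    by (subst inner_fmat_bound[of ?N _ _ ?N]) (auto simp: entry_beyond_size)
  also have "\<dots> = (\<Sum>i<?N. \<Sum>j<?N. \<Sum>l<?N. entry A i l * entry B l j * entry C i j)"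
    unfolding 1 by (simp add: sum_distrib_right)
  also have "\<dots> = (\<Sum>i<?N. \<Sum>l<?N. \<Sum>j<?N. entry A i l * entry B l j * entry C i j)"
    by (rule sum.cong[OF refl]) (rule sum.swap)
  also have "\<dots> = (\<Sum>l<?N. \<Sum>i<?N. \<Sum>j<?N. entry A i l * entry B l j * entry C i j)"
    by (rule sum.swap)
  also have "\<dots> = (\<Sum>l<?N. \<Sum>j<?N. \<Sum>i<?N. entry A i l * entry B l j * entry C i j)"
    by (rule sum.cong[OF refl]) (rule sum.swap)
  also have "\<dots> = (\<Sum>l<?N. \<Sum>j<?N. entry B l j * entry (tr A * C) l j)"
    unfolding 2 by (simp add: sum_distrib_left algebra_simps)
  also have "\<dots> = inner B (tr A * C)"
    by (subst inner_fmat_bound[of ?N _ _ ?N]) (auto simp: entry_beyond_size)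
  finally show ?thesis .
qed

lemma inner_times_right: "inner (A * B) C = inner A (C * tr B)"
  by (metis inner_times_left inner_tr tr_simps(1) tr_times)

lemma Cauchy_Schwarz_sum:
  fixes f g :: "'a \<Rightarrow> real"
  shows "(\<Sum>l\<in>A. f l * g l)\<^sup>2 \<le> (\<Sum>l\<in>A. (f l)\<^sup>2) * (\<Sum>l\<in>A. (g l)\<^sup>2)"
proof -
  have "\<bar>\<Sum>l\<in>A. f l * g l\<bar> \<le> L2_set f A * L2_set g A"
    by (rule order_trans[OF sum_abs order_trans[OF _ L2_set_mult_ineq]]) (simp add: abs_mult)
  then have "(\<Sum>l\<in>A. f l * g l)\<^sup>2 \<le> (L2_set f A * L2_set g A)\<^sup>2"
    by (meson abs_ge_zero power2_abs power_mono abs_le_square_iff order_trans abs_ge_self)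
  then show ?thesis
    by (simp add: L2_set_def power_mult_distrib sum_nonneg)
qed

lemma norm_fmat_mult: "norm (A * B) \<le> norm A * norm B" for A B :: fmat
proof -
  let ?N = "max (size_fmat A) (size_fmat B)"
  have 1: "entry (A * B) i j = (\<Sum>l<?N. entry A i l * entry B l j)" for i j
    by (rule entry_times_bound) (auto simp: entry_beyond_size)
  have "(norm (A * B))\<^sup>2 = (\<Sum>i<?N. \<Sum>j<?N. (entry (A * B) i j)\<^sup>2)"
    by (rule norm_fmat_square) (auto simp: entry_beyond_size entry_times)
  also have "\<dots> \<le> (\<Sum>i<?N. \<Sum>j<?N. (\<Sum>l<?N. (entry A i l)\<^sup>2) * (\<Sum>l<?N. (entry B l j)\<^sup>2))"
    unfolding 1 by (intro sum_mono Cauchy_Schwarz_sum)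
  also have "\<dots> = (\<Sum>i<?N. \<Sum>l<?N. (entry A i l)\<^sup>2) * (\<Sum>j<?N. \<Sum>l<?N. (entry B l j)\<^sup>2)"
    by (simp add: sum_product)
  also have "(\<Sum>j<?N. \<Sum>l<?N. (entry B l j)\<^sup>2) = (\<Sum>l<?N. \<Sum>j<?N. (entry B l j)\<^sup>2)"
    by (rule sum.swap)
  also have "(\<Sum>i<?N. \<Sum>l<?N. (entry A i l)\<^sup>2) = (norm A)\<^sup>2"
    by (rule norm_fmat_square[symmetric]) (auto simp: entry_beyond_size)
  also have "(\<Sum>l<?N. \<Sum>j<?N. (entry B l j)\<^sup>2) = (norm B)\<^sup>2"
    by (rule norm_fmat_square[symmetric]) (auto simp: entry_beyond_size)
  also have "(norm A)\<^sup>2 * (norm B)\<^sup>2 = (norm A * norm B)\<^sup>2" by (simp add: power_mult_distrib)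
  finally show ?thesis by (rule power2_le_imp_le) simp
qed

instance fmat :: real_normed_algebra
proof
  fix A B :: fmat and c :: real
  show "c *\<^sub>R A * B = c *\<^sub>R (A * B)"
  proof (rule fmat_eqI)
    fix i j
    have "entry (c *\<^sub>R A * B) i j = (\<Sum>l<size_fmat A. entry (c *\<^sub>R A) i l * entry B l j)"
      by (rule entry_times_bound) (simp add: entry_beyond_size)
    then show "entry (c *\<^sub>R A * B) i j = entry (c *\<^sub>R (A * B)) i j"
      by (simp add: entry_times sum_distrib_left mult.assoc)
  qed
  show "A * c *\<^sub>R B = c *\<^sub>R (A * B)"
    by (rule fmat_eqI) (simp add: entry_times sum_distrib_left algebra_simps)
  show "norm (A * B) \<le> norm A * norm B" by (rule norm_fmat_mult)
qed

lemma tr_scaleR [simp]: "tr (c *\<^sub>R A) = c *\<^sub>R tr A"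
  by (rule fmat_eqI) simp

section \<open>Partial identities and block selectors\<close>

lift_definition idm :: "nat \<Rightarrow> fmat" is "\<lambda>n i j. if i = j \<and> i < n then 1 else 0"
  by (rename_tac n, rule_tac x = n in exI) auto

text \<open>\<open>tr (sel n s) * A\<close> shifts A below n rows, and \<open>sel n s * A\<close>
  reads off s rows from row n on. Since the ring has no unit, dimensions are expressed by
  \<open>idm n * A = A\<close> (nonzero entries only in the first n rows) and
  \<open>A * idm n = A\<close> (likewise for columns).\<close>

lift_definition sel :: "nat \<Rightarrow> nat \<Rightarrow> fmat" is "\<lambda>n s i j. if i < s \<and> j = n + i then 1 else 0"
  by (rename_tac n s, rule_tac x = "n + s" in exI) auto

lemmas entry_idm = idm.rep_eq and entry_sel = sel.rep_eq

lemma entry_idm_times [simp]: "entry (idm n * A) i j = (if i < n then entry A i j else 0)"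
proof -
  have "entry (idm n * A) i j = (\<Sum>l<n. entry (idm n) i l * entry A l j)"
    by (rule entry_times_bound) (auto simp: entry_idm)
  also have "\<dots> = (\<Sum>l<n. if i = l then entry A l j else 0)"
    by (rule sum.cong) (auto simp: entry_idm)
  finally show ?thesis by (simp add: sum.delta')
qed

lemma entry_times_idm [simp]: "entry (A * idm n) i j = (if j < n then entry A i j else 0)"
proof -
  have "entry (A * idm n) i j = (\<Sum>l<n. entry A i l * entry (idm n) l j)"
    by (rule entry_times_bound) (auto simp: entry_idm)
  also have "\<dots> = (\<Sum>l<n. if l = j then entry A l j * 0 + entry A i j else 0)"
    by (rule sum.cong) (auto simp: entry_idm)
  finally show ?thesis by simp
qed

lemma entry_sel_times: "entry (sel n s * A) i j = (if i < s then entry A (n + i) j else 0)"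
proof -
  have "entry (sel n s * A) i j = (\<Sum>l<n + s. entry (sel n s) i l * entry A l j)"
    by (rule entry_times_bound) (auto simp: entry_sel)
  also have "\<dots> = (\<Sum>l<n + s. if l = n + i then if i < s then entry A (n + i) j else 0 else 0)"
    by (rule sum.cong) (auto simp: entry_sel)
  finally show ?thesis by simp
qed

lemma entry_times_sel: "entry (A * sel n s) i j = (if n \<le> j \<and> j < n + s then entry A i (j - n) else 0)"
proof -
  have "entry (A * sel n s) i j = (\<Sum>l<s. entry A i l * entry (sel n s) l j)"
    by (rule entry_times_bound) (auto simp: entry_sel)
  also have "\<dots> = (\<Sum>l<s. if l = j - n then if n \<le> j then entry A i (j - n) else 0 else 0)"
    by (rule sum.cong) (auto simp: entry_sel)
  finally show ?thesis by auto
qed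

lemma tr_idm [simp]: "tr (idm n) = idm n"
  by (rule fmat_eqI) (auto simp: entry_idm)

lemma idm_idm [simp]: "idm n * idm n = idm n"
  by (rule fmat_eqI) (auto simp: entry_idm)

lemma idm_idm_mult [simp]: "idm n * (idm n * A) = idm n * A"
  by (simp add: mult.assoc[symmetric])

lemma idm_sel [simp]: "idm s * sel n s = sel n s"
  by (rule fmat_eqI) (auto simp: entry_sel)

lemma sel_idm [simp]: "sel n s * idm n = 0" "sel n s * idm (n + s) = sel n s"
  by (rule fmat_eqI; auto simp: entry_sel)+

lemma sel_tr_sel [simp]: "sel n s * tr (sel n s) = idm s"
  by (rule fmat_eqI) (auto simp: entry_sel_times entry_sel entry_idm)

lemma idm_add: "idm (n + s) = idm n + tr (sel n s) * sel n s"
  by (rule fmat_eqI) (auto simp: entry_times_sel entry_sel entry_idm)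

lemma idm_add_mult_idm [simp]: "idm (n + s) * idm n = idm n" "idm n * idm (n + s) = idm n"
  by (rule fmat_eqI; auto simp: entry_idm)+

lemma idm_tr_sel [simp]: "idm n * tr (sel n s) = 0" "tr (sel n s) * idm s = tr (sel n s)"
  by (metis sel_idm(1) tr_idm tr_simps(5) tr_times, metis idm_sel tr_idm tr_times)

lemma idm_left_iff: "idm n * A = A \<longleftrightarrow> (\<forall>i j. n \<le> i \<longrightarrow> entry A i j = 0)"
  by (metis entry_idm_times fmat_eqI leD leI)

lemma idm_right_iff: "A * idm n = A \<longleftrightarrow> (\<forall>i j. n \<le> j \<longrightarrow> entry A i j = 0)"
  by (metis entry_times_idm fmat_eqI leD leI)

lemma norm_fmat_square_idm:
  assumes "idm m * A = A" "A * idm n = A"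
  shows "(norm A)\<^sup>2 = (\<Sum>i<m. \<Sum>j<n. (entry A i j)\<^sup>2)"
  using assms by (intro norm_fmat_square) (auto simp: idm_left_iff idm_right_iff)

lemma abs_entry_le_norm: "\<bar>entry A i j\<bar> \<le> norm A"
proof -
  let ?N = "Suc (max (size_fmat A) (max i j))"
  have "(entry A i j)\<^sup>2 \<le> (\<Sum>j<?N. (entry A i j)\<^sup>2)"
    by (rule member_le_sum) auto
  also have "\<dots> \<le> (\<Sum>i<?N. \<Sum>j<?N. (entry A i j)\<^sup>2)"
    by (rule member_le_sum[where f = "\<lambda>i. \<Sum>j<?N. (entry A i j)\<^sup>2"]) (auto intro!: sum_nonneg simp del: sum.lessThan_Suc)
  also have "\<dots> = (norm A)\<^sup>2"
    by (rule norm_fmat_square[symmetric]) (meson Suc_leD entry_beyond_size max.bounded_iff)+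
  finally show ?thesis by (metis abs_le_square_iff abs_norm_cancel)
qed

lemma norm_fmat_le:
  assumes "idm m * A = A" "A * idm n = A" "0 \<le> c" "\<And>i j. i < m \<Longrightarrow> j < n \<Longrightarrow> \<bar>entry A i j\<bar> \<le> c * b i j"
    "\<And>i j. 0 \<le> b i j" "(\<Sum>i<m. \<Sum>j<n. (b i j)\<^sup>2) \<le> t\<^sup>2" "0 \<le> t"
  shows "norm A \<le> c * t"
proof -
  have "(norm A)\<^sup>2 \<le> (\<Sum>i<m. \<Sum>j<n. (c * b i j)\<^sup>2)"
    unfolding norm_fmat_square_idm[OF assms(1,2)]
    by (intro sum_mono) (meson assms abs_ge_zero lessThan_iff order_trans power2_abs power_mono power2_le_iff_abs_le mult_nonneg_nonneg)
  also have "\<dots> = c\<^sup>2 * (\<Sum>i<m. \<Sum>j<n. (b i j)\<^sup>2)"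
    by (simp add: power_mult_distrib sum_distrib_left)
  also have "\<dots> \<le> c\<^sup>2 * t\<^sup>2" by (intro mult_left_mono assms) auto
  finally show ?thesis using assms by (metis mult_nonneg_nonneg power2_le_imp_le power_mult_distrib)
qed

lemma norm_fmat_le_const:
  assumes "idm m * A = A" "A * idm n = A" "0 \<le> c" "\<And>i j. i < m \<Longrightarrow> j < n \<Longrightarrow> \<bar>entry A i j\<bar> \<le> c"
  shows "norm A \<le> c * sqrt (real m * real n)"
  by (rule norm_fmat_le[where b = "\<lambda>_ _. 1", OF assms(1,2)]) (use assms in \<open>auto simp: real_sqrt_mult power_mult_distrib\<close>)

lemma norm_idm: "norm (idm n) = sqrt (real n)"
proof -
  have "(norm (idm n))\<^sup>2 = (\<Sum>i<n. \<Sum>j<n. (entry (idm n) i j)\<^sup>2)"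
    by (rule norm_fmat_square_idm) simp_all
  also have "\<dots> = (\<Sum>i<n. \<Sum>j<n. if j = i then 1 else 0)"
    by (intro sum.cong) (auto simp: entry_idm)
  also have "\<dots> = real n" by (simp add: sum.delta)
  finally show ?thesis by (simp add: real_sqrt_unique)
qed

lemma norm_times_sel:
  assumes "A * idm s = A"
  shows "norm (A * sel n s) = norm A"
  by (simp add: norm_eq_sqrt_inner inner_times_right mult.assoc assms)

lemma norm_tr_sel_times:
  assumes "idm s * A = A"
  shows "norm (tr (sel n s) * A) = norm A"
  by (metis assms norm_times_sel norm_tr tr_idm tr_simps(1) tr_times)

section \<open>Embedding of matrices and vectors\<close>

lift_definition emb :: "real mat \<Rightarrow> fmat" is
  "\<lambda>M i j. if i < dim_row M \<and> j < dim_col M then M $$ (i, j) else 0"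
  by (rename_tac M, rule_tac x = "max (dim_row M) (dim_col M)" in exI) auto

lemma entry_emb [simp]: "entry (emb M) i j = (if i < dim_row M \<and> j < dim_col M then M $$ (i, j) else 0)"
  by (simp add: emb.rep_eq)

lemma emb_carrier:
  assumes "M \<in> carrier_mat m n"
  shows "idm m * emb M = emb M" "emb M * idm n = emb M"
  using assms by (auto simp: idm_left_iff idm_right_iff)

lemma emb_simps:
  assumes "A \<in> carrier_mat m n" "B \<in> carrier_mat m n"
  shows "emb (A + B) = emb A + emb B" "emb (A - B) = emb A - emb B"
  using assms by (auto intro!: fmat_eqI)

lemma emb_uminus [simp]: "emb (- A) = - emb A"
  by (auto intro!: fmat_eqI)

lemma emb_transpose [simp]: "emb (A\<^sup>T) = tr (emb A)"
  by (auto intro!: fmat_eqI)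

lemma emb_one [simp]: "emb (1\<^sub>m n) = idm n"
  by (auto intro!: fmat_eqI simp: entry_idm)

lemma emb_zero [simp]: "emb (0\<^sub>m m n) = 0"
  by (auto intro!: fmat_eqI)

lemma emb_mult:
  assumes "dim_col A = dim_row B"
  shows "emb (A * B) = emb A * emb B"
proof (rule fmat_eqI)
  fix i j
  have "entry (emb A * emb B) i j = (\<Sum>l<dim_col A. entry (emb A) i l * entry (emb B) l j)"
    by (rule entry_times_bound) auto
  then show "entry (emb (A * B)) i j = entry (emb A * emb B) i j"
    using assms by (auto simp: scalar_prod_def atLeast0LessThan intro!: sum.cong)
qed

lemma emb_four_block:
  assumes "A \<in> carrier_mat r c" "B \<in> carrier_mat r c'" "C \<in> carrier_mat r' c" "D \<in> carrier_mat r' c'"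
  shows "emb (four_block_mat A B C D) =
    emb A + emb B * sel c c' + tr (sel r r') * emb C + tr (sel r r') * (emb D * sel c c')"
proof (rule fmat_eqI)
  fix i j
  have 1: "entry (tr (sel r r') * F) i j = (if r \<le> i \<and> i < r + r' then entry F (i - r) j else 0)" for F
    using entry_times_sel[of "tr F" r r' j i] by (metis entry_tr tr_simps(1) tr_times)
  show "entry (emb (four_block_mat A B C D)) i j = entry
     (emb A + emb B * sel c c' + tr (sel r r') * emb C + tr (sel r r') * (emb D * sel c c')) i j"
    using assms by (auto simp: 1 entry_times_sel)
qed

lemma append_cols_carrier [simp]:
  "A \<in> carrier_mat m n \<Longrightarrow> B \<in> carrier_mat m s \<Longrightarrow> A @\<^sub>c B \<in> carrier_mat m (n + s)"
  unfolding append_cols_def by auto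

lemma emb_append_cols:
  assumes "A \<in> carrier_mat m n" "B \<in> carrier_mat m s"
  shows "emb (A @\<^sub>c B) = emb A + emb B * sel n s"
  unfolding append_cols_def using assms
  by (subst emb_four_block[of _ m n _ s _ 0]) auto

lemma emb_append_rows:
  assumes "A \<in> carrier_mat n s" "B \<in> carrier_mat r s"
  shows "emb (A @\<^sub>r B) = emb A + tr (sel n r) * emb B"
  unfolding append_rows_def using assms
  by (subst emb_four_block[of _ n s _ 0 _ r]) auto

definition unemb :: "nat \<Rightarrow> nat \<Rightarrow> fmat \<Rightarrow> real mat" where
  "unemb m n A = mat m n (\<lambda>(i, j). entry A i j)"

lemma unemb_carrier [simp]: "unemb m n A \<in> carrier_mat m n"
  by (simp add: unemb_def)

lemma emb_unemb: "idm m * A = A \<Longrightarrow> A * idm n = A \<Longrightarrow> emb (unemb m n A) = A"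
  by (rule fmat_eqI) (auto simp: unemb_def idm_left_iff idm_right_iff)

lift_definition vemb :: "real vec \<Rightarrow> fmat" is "\<lambda>v i j. if j = 0 \<and> i < dim_vec v then v $ i else 0"
  by (rename_tac v, rule_tac x = "Suc (dim_vec v)" in exI) auto

lemma entry_vemb [simp]: "entry (vemb v) i j = (if j = 0 \<and> i < dim_vec v then v $ i else 0)"
  by (simp add: vemb.rep_eq)

lemma vemb_carrier: "v \<in> carrier_vec n \<Longrightarrow> idm n * vemb v = vemb v"
  by (auto simp: idm_left_iff)

lemma vemb_mult:
  assumes "v \<in> carrier_vec (dim_col M)"
  shows "vemb (M *\<^sub>v v) = emb M * vemb v"
proof (rule fmat_eqI)
  fix i j
  have "entry (emb M * vemb v) i j = (\<Sum>l<dim_col M. entry (emb M) i l * entry (vemb v) l j)"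
    by (rule entry_times_bound) auto
  then show "entry (vemb (M *\<^sub>v v)) i j = entry (emb M * vemb v) i j"
    using assms by (auto simp: scalar_prod_def atLeast0LessThan intro!: sum.cong)
qed

lemma norm_vemb: "norm (vemb v) = vec_norm2 v"
proof -
  have "(norm (vemb v))\<^sup>2 = (\<Sum>i<dim_vec v. \<Sum>j<1. (entry (vemb v) i j)\<^sup>2)"
    by (rule norm_fmat_square) auto
  then show ?thesis
    by (simp add: vec_norm2_def scalar_prod_def atLeast0LessThan power2_eq_square real_sqrt_unique)
qed

lemma vemb_eq_iff: "v \<in> carrier_vec n \<Longrightarrow> w \<in> carrier_vec n \<Longrightarrow> vemb v = vemb w \<longleftrightarrow> v = w"
  by (metis carrier_vecD entry_vemb eq_vecI)

lemma vemb_smult [simp]: "vemb (c \<cdot>\<^sub>v v) = c *\<^sub>R vemb v"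
  by (rule fmat_eqI) auto

lemma vemb_zero [simp]: "vemb (0\<^sub>v n) = 0"
  by (rule fmat_eqI) auto

text \<open>A column of a nonzero kernel element is a kernel vector.\<close>

lemma eigenvalue_emb:
  assumes M: "M \<in> carrier_mat n n"
  shows "eigenvalue M e \<longleftrightarrow> (\<exists>V. idm n * V = V \<and> V \<noteq> 0 \<and> emb M * V = e *\<^sub>R V)"
proof
  assume "eigenvalue M e"
  then obtain v where "v \<in> carrier_vec n" "v \<noteq> 0\<^sub>v n" "M *\<^sub>v v = e \<cdot>\<^sub>v v"
    using M by (auto simp: eigenvalue_def eigenvector_def)
  then have "idm n * vemb v = vemb v \<and> vemb v \<noteq> 0 \<and> emb M * vemb v = e *\<^sub>R vemb v"
    using M by (metis carrier_matD(2) vemb_carrier vemb_eq_iff vemb_mult vemb_smult vemb_zero zero_carrier_vec)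
  then show "\<exists>V. idm n * V = V \<and> V \<noteq> 0 \<and> emb M * V = e *\<^sub>R V" ..
next
  assume "\<exists>V. idm n * V = V \<and> V \<noteq> 0 \<and> emb M * V = e *\<^sub>R V"
  then obtain V where V: "idm n * V = V" "V \<noteq> 0" "emb M * V = e *\<^sub>R V" by blast
  then obtain i j where ij: "entry V i j \<noteq> 0" by (metis fmat_eqI zero_fmat.rep_eq)
  define v where "v = vec n (\<lambda>i. entry V i j)"
  have v: "v \<in> carrier_vec n" by (simp add: v_def)
  have "vemb v \<noteq> 0"
  proof
    assume "vemb v = 0"
    then have "entry (vemb v) i 0 = 0" by simp
    then show False using ij V(1) by (auto simp: v_def idm_left_iff split: if_splits)
  qed
  moreover have "vemb (M *\<^sub>v v) = vemb (e \<cdot>\<^sub>v v)"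
  proof (rule fmat_eqI)
    fix i' j'
    have "entry (emb M * V) i' j = (\<Sum>l<n. entry (emb M) i' l * entry V l j)"
      by (rule entry_times_bound) (use M in auto)
    moreover have "entry (emb M * vemb v) i' 0 = (\<Sum>l<n. entry (emb M) i' l * entry (vemb v) l 0)"
      by (rule entry_times_bound) (use M in auto)
    ultimately have "entry (vemb (M *\<^sub>v v)) i' 0 = e * entry V i' j"
      using M v V(3) by (subst vemb_mult) (auto simp: v_def intro!: sum.cong)
    then have "entry (vemb (M *\<^sub>v v)) i' 0 = entry (vemb (e \<cdot>\<^sub>v v)) i' 0"
      using V(1) by (auto simp: v_def idm_left_iff split: if_splits)
    then show "entry (vemb (M *\<^sub>v v)) i' j' = entry (vemb (e \<cdot>\<^sub>v v)) i' j'"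
      by (cases "j' = 0") auto
  qed
  ultimately have "eigenvector M v e"
    unfolding eigenvector_def using M v
    by (metis carrier_matD(1) mult_mat_vec_carrier smult_carrier_vec vemb_eq_iff vemb_zero zero_carrier_vec)
  then show "eigenvalue M e" unfolding eigenvalue_def ..
qed

text \<open>Injectivity excludes a zero determinant, because a kernel vector would embed as a
  one-column V. It supplies inverses of computed factors that are not known in advance to be
  regular.\<close>

lemma fmat_inverse:
  assumes A: "idm n * A = A" "A * idm n = A"
    and ker: "\<And>V. idm n * V = V \<Longrightarrow> A * V = 0 \<Longrightarrow> V = 0"
  obtains J where "idm n * J = J" "J * idm n = J" "J * A = idm n" "A * J = idm n"
proof -
  let ?A = "unemb n n A"
  have "det ?A \<noteq> 0"
  proof
    assume "det ?A = 0"
    then obtain v where v: "v \<in> carrier_vec n" "v \<noteq> 0\<^sub>v n" "?A *\<^sub>v v = 0\<^sub>v n"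
      using det_0_iff_vec_prod_zero[of ?A n] by auto
    have "emb ?A * vemb v = vemb (?A *\<^sub>v v)"
      by (rule vemb_mult[symmetric]) (use v in \<open>simp add: unemb_def\<close>)
    then have "A * vemb v = 0" by (simp add: v emb_unemb A)
    then show False using ker vemb_carrier[OF v(1)] vemb_eq_iff[of v n "0\<^sub>v n"] v by auto
  qed
  from det_non_zero_imp_unit[OF unemb_carrier this, of "()"]
  obtain B where B: "B \<in> carrier_mat n n" "B * ?A = 1\<^sub>m n" "?A * B = 1\<^sub>m n"
    by (auto simp: Units_def ring_mat_def)
  show ?thesis
  proof (rule that[of "emb B"])
    show "idm n * emb B = emb B" "emb B * idm n = emb B" using emb_carrier[OF B(1)] by auto
    have "emb (B * ?A) = emb B * emb ?A" "emb (?A * B) = emb ?A * emb B"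
      by (rule emb_mult, use B in \<open>simp add: unemb_def\<close>)+
    then show "emb B * A = idm n" "A * emb B = idm n" by (simp_all add: B emb_unemb[OF A])
  qed
qed

section \<open>Singular values and the 2-norm\<close>

text \<open>A quantitative form of the fact that an injective semidefinite form is definite.
  Semidefiniteness at the gradient step V - (1/b) B V, with b above \<open>norm B\<close>, gives
  (norm (B V))^2 / b \<le> \<open>inner V (B * V)\<close>; the inverse J then bounds
  \<open>norm V\<close> by a multiple of norm (B V).\<close>

lemma psd_coercive:
  assumes B: "idm n * B = B" "B * idm n = B" "tr B = B"
    and psd: "\<And>V. idm n * V = V \<Longrightarrow> 0 \<le> inner V (B * V)"
    and ker: "\<And>V. idm n * V = V \<Longrightarrow> B * V = 0 \<Longrightarrow> V = 0"
  obtains c where "0 < c" "\<And>V. idm n * V = V \<Longrightarrow> c * (norm V)\<^sup>2 \<le> inner V (B * V)"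
proof -
  obtain J where J: "J * B = idm n"
    using fmat_inverse[OF B(1,2) ker] by metis
  define b where "b = norm B + 1"
  define h where "h = (norm J)\<^sup>2 + 1"
  have b: "0 < b" and h: "0 < h" by (simp_all add: b_def h_def add_nonneg_pos)
  show ?thesis
  proof (rule that[of "1 / (b * h)"])
    show "0 < 1 / (b * h)" using b h by simp
    fix V assume V: "idm n * V = V"
    define W where "W = B * V"
    have W: "idm n * W = W" by (simp add: W_def mult.assoc[symmetric] B)
    have 1: "inner V (B * W) = (norm W)\<^sup>2"
      by (metis B(3) W_def inner_times_left power2_norm_eq_inner)
    have "inner W (B * W) \<le> norm W * (norm B * norm W)"
      by (meson norm_cauchy_schwarz norm_mult_ineq mult_left_mono norm_ge_zero order_trans)
    also have "\<dots> \<le> b * (norm W)\<^sup>2" by (simp add: b_def power2_eq_square algebra_simps)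
    finally have 2: "inner W (B * W) \<le> b * (norm W)\<^sup>2" .
    let ?Z = "V - (1 / b) *\<^sub>R W"
    have "idm n * ?Z = ?Z" by (simp add: right_diff_distrib V W)
    from psd[OF this] have "0 \<le> inner ?Z (W - (1 / b) *\<^sub>R (B * W))"
      by (simp add: right_diff_distrib W_def)
    also have "\<dots> = inner V W - 2 / b * (norm W)\<^sup>2 + (1 / b)\<^sup>2 * inner W (B * W)"
      by (simp add: inner_diff_left inner_diff_right 1 power2_norm_eq_inner[of W, symmetric]
          power2_eq_square algebra_simps)
    also have "\<dots> \<le> inner V W - 2 / b * (norm W)\<^sup>2 + (1 / b)\<^sup>2 * (b * (norm W)\<^sup>2)"
      using 2 by (simp add: mult_left_mono)
    also have "\<dots> = inner V W - (norm W)\<^sup>2 / b" using b by (simp add: power2_eq_square field_simps)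
    finally have 3: "(norm W)\<^sup>2 / b \<le> inner V W" by simp
    have "norm V = norm (J * W)" using J V by (simp add: W_def mult.assoc[symmetric])
    then have "(norm V)\<^sup>2 \<le> (norm J)\<^sup>2 * (norm W)\<^sup>2"
      by (metis norm_ge_zero norm_mult_ineq power_mono power_mult_distrib)
    also have "\<dots> \<le> h * (norm W)\<^sup>2" by (simp add: h_def algebra_simps)
    finally have "(norm V)\<^sup>2 / (b * h) \<le> (norm W)\<^sup>2 / b" using b h by (simp add: field_simps)
    then show "1 / (b * h) * (norm V)\<^sup>2 \<le> inner V (B * V)" using 3 by (simp add: W_def)
  qed
qed

text \<open>The infimum of the Rayleigh quotient is an eigenvalue, since otherwise the shifted form would
  be coercive. No compactness is needed.\<close>

lemma symmetric_least_eigenvalue: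
  assumes H: "idm n * H = H" "H * idm n = H" "tr H = H" and n: "1 \<le> n"
  obtains e V where "idm n * V = V" "V \<noteq> 0" "H * V = e *\<^sub>R V"
    "\<And>V. idm n * V = V \<Longrightarrow> e * (norm V)\<^sup>2 \<le> inner V (H * V)"
proof -
  define S where "S = {inner V (H * V) | V. idm n * V = V \<and> norm V = 1}"
  define e where "e = Inf S"
  have I: "norm (idm n) \<noteq> 0" using n by (simp add: norm_idm)
  \<comment> \<open>Unit vectors are matrices of Frobenius norm 1 here, so the scaled identity shows
    that the unit sphere is nonempty.\<close>
  define V where "V = (1 / norm (idm n)) *\<^sub>R idm n"
  have "idm n * V = V \<and> norm V = 1" using I by (simp add: V_def)
  then have "inner V (H * V) \<in> S" unfolding S_def by blast
  then have ne: "S \<noteq> {}" by blast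
  have bdd: "bdd_below S"
  proof (rule bdd_belowI[of _ "- norm H"])
    fix x assume "x \<in> S"
    then obtain V where V: "norm V = 1" "x = inner V (H * V)" by (auto simp: S_def)
    have "\<bar>x\<bar> \<le> norm V * norm (H * V)" unfolding V(2) by (rule Cauchy_Schwarz_ineq2)
    also have "\<dots> \<le> norm H" using norm_mult_ineq[of H V] V by simp
    finally show "- norm H \<le> x" by simp
  qed
  have low: "e * (norm V)\<^sup>2 \<le> inner V (H * V)" if V: "idm n * V = V" for V
  proof (cases "V = 0")
    case False
    let ?V = "(1 / norm V) *\<^sub>R V"
    have "inner ?V (H * ?V) \<in> S"
      unfolding S_def using V False by (intro CollectI exI[of _ ?V]) auto
    then have "e \<le> inner ?V (H * ?V)" unfolding e_def by (rule cInf_lower) (rule bdd)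
    then show ?thesis using False by (simp add: power2_eq_square field_simps)
  qed simp
  have "\<exists>V. idm n * V = V \<and> V \<noteq> 0 \<and> (H - e *\<^sub>R idm n) * V = 0"
  proof (rule ccontr)
    assume nex: "\<not> ?thesis"
    have form: "inner V ((H - e *\<^sub>R idm n) * V) = inner V (H * V) - e * (norm V)\<^sup>2"
      if "idm n * V = V" for V
      by (simp add: left_diff_distrib inner_diff_right that power2_norm_eq_inner)
    obtain c where c: "0 < c" "\<And>V. idm n * V = V \<Longrightarrow> c * (norm V)\<^sup>2 \<le> inner V ((H - e *\<^sub>R idm n) * V)"
    proof (rule psd_coercive[of n "H - e *\<^sub>R idm n"])
      show "idm n * (H - e *\<^sub>R idm n) = H - e *\<^sub>R idm n" "(H - e *\<^sub>R idm n) * idm n = H - e *\<^sub>R idm n"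
        "tr (H - e *\<^sub>R idm n) = H - e *\<^sub>R idm n"
        by (simp_all add: left_diff_distrib right_diff_distrib H)
    qed (use nex low form in auto)
    have "e + c \<le> Inf S"
    proof (rule cInf_greatest[OF ne])
      fix x assume "x \<in> S"
      then show "e + c \<le> x" using c(2) form by (force simp: S_def)
    qed
    then show False using c(1) by (simp add: e_def)
  qed
  then obtain V where "idm n * V = V" "V \<noteq> 0" "(H - e *\<^sub>R idm n) * V = 0" by blast
  then show ?thesis using that[OF _ _ _ low] by (simp add: left_diff_distrib)
qed

section \<open>Extreme singular values through the Gram form\<close>

context
  fixes M :: "real mat" and m n :: nat and A :: fmat
  assumes M: "M \<in> carrier_mat m n" and n: "1 \<le> n"
  defines "A \<equiv> emb M"
begin

lemma emb_M_carrier: "idm m * A = A" "A * idm n = A"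
  unfolding A_def using emb_carrier[OF M] by auto

lemma singular_value_iff:
  "\<sigma> \<in> singular_values M \<longleftrightarrow>
    0 \<le> \<sigma> \<and> (\<exists>V. idm n * V = V \<and> V \<noteq> 0 \<and> tr A * A * V = \<sigma>\<^sup>2 *\<^sub>R V)"
proof -
  have "M\<^sup>T * M \<in> carrier_mat n n" using M by auto
  moreover have "emb (M\<^sup>T * M) = tr A * A" using M by (simp add: emb_mult A_def)
  ultimately show ?thesis by (simp add: singular_values_def eigenvalue_emb)
qed

lemma inner_gram: "inner V (tr A * A * V) = (norm (A * V))\<^sup>2"
  by (metis inner_commute inner_times_left mult.assoc power2_norm_eq_inner tr_simps(1))

lemma singular_value_vector:
  assumes "\<sigma> \<in> singular_values M"
  obtains V where "idm n * V = V" "V \<noteq> 0" "norm (A * V) = \<sigma> * norm V"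
proof -
  obtain V where V: "0 \<le> \<sigma>" "idm n * V = V" "V \<noteq> 0" "tr A * A * V = \<sigma>\<^sup>2 *\<^sub>R V"
    using assms singular_value_iff by blast
  have "(norm (A * V))\<^sup>2 = (\<sigma> * norm V)\<^sup>2"
    using inner_gram[of V] V(4) by (simp add: power2_norm_eq_inner power_mult_distrib)
  then show ?thesis using that V by (simp add: power2_eq_iff_nonneg)
qed

lemma finite_singular_values: "finite (singular_values M)"
proof -
  have MM: "M\<^sup>T * M \<in> carrier_mat n n" using M by auto
  have "finite {e. poly (char_poly (M\<^sup>T * M)) e = 0}"
    using degree_monic_char_poly[OF MM] n by (intro poly_roots_finite) auto
  then have "finite (sqrt ` {e. eigenvalue (M\<^sup>T * M) e})"
    unfolding eigenvalue_root_char_poly[OF MM] by simp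
  moreover have "singular_values M \<subseteq> sqrt ` {e. eigenvalue (M\<^sup>T * M) e}"
    unfolding singular_values_def by (force simp: image_iff)
  ultimately show ?thesis by (rule finite_subset[rotated])
qed

lemma gram_carrier: "idm n * (tr A * A) = tr A * A" "tr A * A * idm n = tr A * A"
  by (metis emb_M_carrier(2) mult.assoc tr_idm tr_times, simp add: emb_M_carrier mult.assoc)

text \<open>The least eigenvalue of the Gram matrix is one of its Rayleigh quotients, hence
  nonnegative, and has a root.\<close>

lemma ex_least_singular_value:
  "\<exists>\<sigma>\<in>singular_values M. \<forall>V. idm n * V = V \<longrightarrow> \<sigma> * norm V \<le> norm (A * V)"
proof -
  obtain e V where V: "idm n * V = V" "V \<noteq> 0" "tr A * A * V = e *\<^sub>R V"
    and e: "\<And>V. idm n * V = V \<Longrightarrow> e * (norm V)\<^sup>2 \<le> inner V (tr A * A * V)"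
    using symmetric_least_eigenvalue[OF gram_carrier _ n] by (metis tr_simps(1) tr_times)
  have "e * (norm V)\<^sup>2 = (norm (A * V))\<^sup>2"
    using inner_gram[of V] V(3) by (simp add: power2_norm_eq_inner)
  then have "0 \<le> e" using V(2)
    by (metis zero_le_power2 zero_le_mult_iff zero_less_norm_iff zero_less_power not_less)
  then have "sqrt e \<in> singular_values M" using V singular_value_iff by auto
  moreover have "sqrt e * norm W \<le> norm (A * W)" if "idm n * W = W" for W
  proof -
    have "(sqrt e * norm W)\<^sup>2 \<le> (norm (A * W))\<^sup>2"
      using e[OF that] inner_gram[of W] \<open>0 \<le> e\<close> by (simp add: power_mult_distrib)
    then show ?thesis by (rule power2_le_imp_le) simp
  qed
  ultimately show ?thesis by blast
qed

text \<open>Obtained from the least eigenvalue of the negated Gram matrix.\<close>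

lemma ex_greatest_singular_value:
  "\<exists>\<sigma>\<in>singular_values M. \<forall>V. idm n * V = V \<longrightarrow> norm (A * V) \<le> \<sigma> * norm V"
proof -
  have 1: "idm n * (- (tr A * A)) = - (tr A * A)" "- (tr A * A) * idm n = - (tr A * A)"
    "tr (- (tr A * A)) = - (tr A * A)"
    by (simp_all add: gram_carrier)
  obtain e V where V: "idm n * V = V" "V \<noteq> 0" "- (tr A * A) * V = e *\<^sub>R V"
    and e: "\<And>V. idm n * V = V \<Longrightarrow> e * (norm V)\<^sup>2 \<le> inner V (- (tr A * A) * V)"
    using symmetric_least_eigenvalue[OF 1 n] by metis
  have V3: "tr A * A * V = (- e) *\<^sub>R V" using V(3) by (metis minus_minus mult_minus_left scaleR_minus_left)
  have e': "(norm (A * W))\<^sup>2 \<le> (- e) * (norm W)\<^sup>2" if "idm n * W = W" for W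
    using e[OF that] inner_gram[of W] by simp
  have "0 \<le> (- e) * (norm V)\<^sup>2" using e'[OF V(1)] by (meson order_trans zero_le_power2)
  then have ge: "0 \<le> - e" using V(2)
    by (metis zero_le_mult_iff zero_less_norm_iff zero_less_power not_less)
  then have "sqrt (- e) \<in> singular_values M" using V3 V singular_value_iff by auto
  moreover have "norm (A * W) \<le> sqrt (- e) * norm W" if "idm n * W = W" for W
  proof -
    have "(norm (A * W))\<^sup>2 \<le> (sqrt (- e) * norm W)\<^sup>2"
      using e'[OF that] ge by (simp add: power_mult_distrib)
    then show ?thesis using ge by (auto intro: power2_le_imp_le)
  qed
  ultimately show ?thesis by blast
qed

lemma singular_values_nonempty: "singular_values M \<noteq> {}"
  using ex_least_singular_value by blast

lemma sigma_min_mult_le: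
  assumes "idm n * V = V"
  shows "sigma_min M * norm V \<le> norm (A * V)"
proof -
  obtain \<sigma> where \<sigma>: "\<sigma> \<in> singular_values M" "\<sigma> * norm V \<le> norm (A * V)"
    using ex_least_singular_value assms by blast
  have "sigma_min M \<le> \<sigma>" unfolding sigma_min_def by (rule Min_le[OF finite_singular_values \<sigma>(1)])
  then show ?thesis using \<sigma>(2) by (meson mult_right_mono norm_ge_zero order_trans)
qed

lemma sigma_max_mult_ge:
  assumes "idm n * V = V"
  shows "norm (A * V) \<le> sigma_max M * norm V"
proof -
  obtain \<sigma> where \<sigma>: "\<sigma> \<in> singular_values M" "norm (A * V) \<le> \<sigma> * norm V"
    using ex_greatest_singular_value assms by blast
  have "\<sigma> \<le> sigma_max M" unfolding sigma_max_def by (rule Max_ge[OF finite_singular_values \<sigma>(1)])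
  then show ?thesis using \<sigma>(2) by (meson mult_right_mono norm_ge_zero order_trans)
qed

text \<open>\<open>sigma_min\<close> is attained at an eigenvector of the Gram matrix, where it can
  be compared with c. This lemma and the next let operator bounds on W control its condition
  number.\<close>

lemma le_sigma_min:
  assumes "\<And>V. idm n * V = V \<Longrightarrow> c * norm V \<le> norm (A * V)"
  shows "c \<le> sigma_min M"
proof -
  have "sigma_min M \<in> singular_values M"
    unfolding sigma_min_def by (rule Min_in[OF finite_singular_values singular_values_nonempty])
  then show ?thesis
    by (metis assms mult_le_cancel_right_pos singular_value_vector zero_less_norm_iff)
qed

lemma sigma_max_le:
  assumes "\<And>V. idm n * V = V \<Longrightarrow> norm (A * V) \<le> c * norm V"
  shows "sigma_max M \<le> c"
proof -
  have "sigma_max M \<in> singular_values M"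
    unfolding sigma_max_def by (rule Max_in[OF finite_singular_values singular_values_nonempty])
  then show ?thesis
    by (metis assms mult_le_cancel_right_pos singular_value_vector zero_less_norm_iff)
qed

lemma sigma_min_le_sigma_max: "sigma_min M \<le> sigma_max M"
  unfolding sigma_max_def sigma_min_def
  using Max_in[OF finite_singular_values singular_values_nonempty] finite_singular_values by simp

section \<open>Comparison of the 2-norm with the Frobenius norm\<close>

lemma norm_mult_vec_le: "v \<in> carrier_vec n \<Longrightarrow> vec_norm2 (M *\<^sub>v v) \<le> norm A * vec_norm2 v"
  using norm_mult_ineq[of A "vemb v"] M by (simp add: norm_vemb[symmetric] vemb_mult A_def)

lemma vec_norm2_unit_vec: "j < n \<Longrightarrow> vec_norm2 (unit_vec n j) = 1"
  by (simp add: vec_norm2_def)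

lemma norm2_le_norm: "norm2 M \<le> norm A"
  unfolding norm2_def
proof (rule cSUP_least)
  have "unit_vec n 0 \<in> {v \<in> carrier_vec (dim_col M). vec_norm2 v = 1}"
    using M n by (simp add: vec_norm2_unit_vec)
  then show "{v \<in> carrier_vec (dim_col M). vec_norm2 v = 1} \<noteq> {}" by blast
qed (use norm_mult_vec_le M in force)

lemma norm2_unit_vec:
  assumes "j < n"
  shows "vec_norm2 (M *\<^sub>v unit_vec n j) \<le> norm2 M"
  unfolding norm2_def
proof (rule cSUP_upper)
  show "bdd_above ((\<lambda>v. vec_norm2 (M *\<^sub>v v)) ` {v \<in> carrier_vec (dim_col M). vec_norm2 v = 1})"
    using norm_mult_vec_le M by (force intro!: bdd_aboveI[of _ "norm A"])
qed (use M assms in \<open>simp add: vec_norm2_unit_vec\<close>)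

text \<open>Each column is the image of a unit vector, so its length is at most
  \<open>norm2 M\<close>. The factor depends on the dimension only and is therefore absorbed by the
  constants.\<close>

lemma norm_le_norm2: "norm A \<le> sqrt (real n) * norm2 M"
proof -
  have nn: "0 \<le> vec_norm2 v" for v using norm_vemb[of v] by (metis norm_ge_zero)
  have c: "(\<Sum>i<m. (entry A i j)\<^sup>2) \<le> (norm2 M)\<^sup>2" if "j < n" for j
  proof -
    have "M *\<^sub>v unit_vec n j = col M j" using M that by (intro eq_vecI) auto
    then have "(vec_norm2 (M *\<^sub>v unit_vec n j))\<^sup>2 = (\<Sum>i<m. (entry A i j)\<^sup>2)"
      using M that by (simp add: vec_norm2_def scalar_prod_def power2_eq_square A_def
          atLeast0LessThan sum_nonneg)
    then show ?thesis using norm2_unit_vec[OF that] nn by (metis power_mono)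
  qed
  have "0 \<le> norm2 M" using norm2_unit_vec[of 0] n nn[of "M *\<^sub>v unit_vec n 0"] by simp
  have "(norm A)\<^sup>2 = (\<Sum>i<m. \<Sum>j<n. (entry A i j)\<^sup>2)"
    by (rule norm_fmat_square_idm[OF emb_M_carrier])
  also have "\<dots> = (\<Sum>j<n. \<Sum>i<m. (entry A i j)\<^sup>2)" by (rule sum.swap)
  also have "\<dots> \<le> (\<Sum>j<n. (norm2 M)\<^sup>2)" by (rule sum_mono) (use c in simp)
  also have "\<dots> = (sqrt (real n) * norm2 M)\<^sup>2" by (simp add: power_mult_distrib)
  finally show ?thesis by (rule power2_le_imp_le) (simp add: \<open>0 \<le> norm2 M\<close>)
qed

end

section \<open>Rounding errors\<close>

lemma norm_fmat_mono:
  assumes "\<And>i j. \<bar>entry A i j\<bar> \<le> entry B i j"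
  shows "norm A \<le> norm B"
proof -
  let ?N = "max (size_fmat A) (size_fmat B)"
  have "(norm A)\<^sup>2 = (\<Sum>i<?N. \<Sum>j<?N. (entry A i j)\<^sup>2)"
    by (rule norm_fmat_square) (auto simp: entry_beyond_size)
  also have "\<dots> \<le> (\<Sum>i<?N. \<Sum>j<?N. (entry B i j)\<^sup>2)"
    by (intro sum_mono) (metis assms abs_ge_zero power2_abs power_mono)
  also have "\<dots> = (norm B)\<^sup>2"
    by (rule norm_fmat_square[symmetric]) (auto simp: entry_beyond_size)
  finally show ?thesis by (rule power2_le_imp_le) simp
qed

text \<open>Rounding errors of products are bounded entrywise by products of moduli. The Frobenius
  norm does not see the modulus, so such bounds pass to norms without a dimension factor.\<close>

lift_definition abs_fmat :: "fmat \<Rightarrow> fmat" is "\<lambda>f i j. \<bar>f i j\<bar>" by auto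

lemma entry_abs_fmat [simp]: "entry (abs_fmat A) i j = \<bar>entry A i j\<bar>"
  by (simp add: abs_fmat.rep_eq)

lemma norm_abs_fmat [simp]: "norm (abs_fmat A) = norm A"
proof -
  let ?N = "size_fmat A"
  have "(norm (abs_fmat A))\<^sup>2 = (\<Sum>i<?N. \<Sum>j<?N. (entry (abs_fmat A) i j)\<^sup>2)"
    by (rule norm_fmat_square) (simp_all add: entry_beyond_size)
  moreover have "(norm A)\<^sup>2 = (\<Sum>i<?N. \<Sum>j<?N. (entry A i j)\<^sup>2)"
    by (rule norm_fmat_square) (simp_all add: entry_beyond_size)
  ultimately show ?thesis by (simp add: power2_eq_imp_eq)
qed

lemma sum_mset_abs_nonneg: "0 \<le> (\<Sum>x\<in>#M. \<bar>f x :: real\<bar>)"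
  by (induction M) auto

lemma sum_mset_abs: "\<bar>\<Sum>x\<in>#M. f x :: real\<bar> \<le> (\<Sum>x\<in>#M. \<bar>f x\<bar>)"
  by (induction M) (auto intro: order_trans[OF abs_triangle_ineq])

lemma one_add_power_mono: "0 \<le> u \<Longrightarrow> j \<le> k \<Longrightarrow> (1 + u) ^ j \<le> (1 + u :: real) ^ k"
  by (rule power_increasing) auto

text \<open>The order of summation is immaterial: a rounded addition raises the exponent by one
  above the larger of its two parts, and both parts are nonempty.\<close>

lemma fl_sum_error:
  assumes "fl_sum u M s" "0 \<le> u"
  shows "\<bar>s - sum_mset M\<bar> \<le> ((1 + u) ^ size M - 1) * (\<Sum>x\<in>#M. \<bar>x\<bar>)"
  using assms
proof (induction rule: fl_sum.induct)
  case (single x)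
  then show ?case by simp
next
  case (add M N a b s)
  define P where "P = (\<Sum>x\<in>#M. \<bar>x\<bar>)"
  define R where "R = (\<Sum>x\<in>#N. \<bar>x\<bar>)"
  define g where "g = (1 + u) ^ max (size M) (size N)"
  have nn: "0 \<le> P" "0 \<le> R" by (auto simp: P_def R_def sum_mset_abs_nonneg)
  have "\<bar>a - sum_mset M\<bar> \<le> (g - 1) * P"
    using add.IH[OF add.prems] one_add_power_mono[OF add.prems, of "size M" "max (size M) (size N)"] nn
    by (smt (verit) P_def g_def max.cobounded1 mult_right_mono)
  moreover have "\<bar>b - sum_mset N\<bar> \<le> (g - 1) * R"
    using add.IH[OF add.prems] one_add_power_mono[OF add.prems, of "size N" "max (size M) (size N)"] nn
    by (smt (verit) R_def g_def max.cobounded2 mult_right_mono)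
  moreover have "\<bar>sum_mset M\<bar> \<le> P" "\<bar>sum_mset N\<bar> \<le> R"
    unfolding P_def R_def using sum_mset_abs[of "\<lambda>x. x"] by auto
  ultimately have 1: "\<bar>a + b - (sum_mset M + sum_mset N)\<bar> \<le> (g - 1) * (P + R)"
    and 2: "\<bar>sum_mset M + sum_mset N\<bar> \<le> P + R" by (auto simp: algebra_simps)
  have 3: "\<bar>a + b\<bar> \<le> g * (P + R)" using 1 2 by (simp add: algebra_simps)
  obtain \<delta> where \<delta>: "\<bar>\<delta>\<bar> \<le> u" "s = (a + b) * (1 + \<delta>)"
    using \<open>rounded u (a + b) s\<close> by (auto simp: rounded_def)
  have 4: "\<bar>\<delta> * (a + b)\<bar> \<le> u * (g * (P + R))"
    unfolding abs_mult by (intro mult_mono \<delta> 3) (use add.prems in auto)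
  have "s - (sum_mset M + sum_mset N) = (a + b - (sum_mset M + sum_mset N)) + \<delta> * (a + b)"
    by (simp add: \<delta> algebra_simps)
  then have "\<bar>s - (sum_mset M + sum_mset N)\<bar> \<le> (g - 1) * (P + R) + u * (g * (P + R))"
    using 1 4 by linarith
  also have "\<dots> = ((1 + u) ^ Suc (max (size M) (size N)) - 1) * (P + R)"
    by (simp add: g_def algebra_simps)
  also have "\<dots> \<le> ((1 + u) ^ (size M + size N) - 1) * (P + R)"
  proof (intro mult_right_mono diff_right_mono one_add_power_mono)
    have "size M \<noteq> 0" "size N \<noteq> 0" using add(1,2) by auto
    then show "Suc (max (size M) (size N)) \<le> size M + size N" by linarith
  qed (use nn add.prems in auto)
  finally show ?case by (simp add: P_def R_def)
qed simp

text \<open>The extra 1 in the exponent pays for rounding the products; k is left free so that inner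
  products of different lengths can share one factor.\<close>

lemma fl_inner_error:
  assumes "fl_inner u M n a b r" "0 \<le> u" "size M + n + 1 \<le> k"
  shows "\<bar>r - (sum_mset M + (\<Sum>l<n. a l * b l))\<bar>
    \<le> ((1 + u) ^ k - 1) * ((\<Sum>x\<in>#M. \<bar>x\<bar>) + (\<Sum>l<n. \<bar>a l\<bar> * \<bar>b l\<bar>))"
proof -
  obtain t where t: "\<And>l. l < n \<Longrightarrow> rounded u (a l * b l) (t l)"
    and r: "fl_sum u (M + image_mset t (mset_set {..<n})) r"
    using assms(1) by (auto simp: fl_inner_def)
  define P where "P = (\<Sum>x\<in>#M. \<bar>x\<bar>)"
  define R where "R = (\<Sum>l<n. \<bar>a l\<bar> * \<bar>b l\<bar>)"
  define g where "g = (1 + u) ^ (size M + n)"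
  have nn: "0 \<le> P" "0 \<le> R" by (auto simp: P_def R_def sum_mset_abs_nonneg sum_nonneg)
  have g: "1 \<le> g" using assms(2) by (simp add: g_def)
  have t1: "\<bar>t l - a l * b l\<bar> \<le> u * (\<bar>a l\<bar> * \<bar>b l\<bar>)" if l: "l < n" for l
  proof -
    obtain \<delta> where "\<bar>\<delta>\<bar> \<le> u" "t l = a l * b l * (1 + \<delta>)"
      using t[OF l] by (auto simp: rounded_def)
    moreover from this have "t l - a l * b l = \<delta> * (a l * b l)" by (simp add: algebra_simps)
    ultimately show ?thesis by (simp add: abs_mult mult_right_mono)
  qed
  have "\<bar>(\<Sum>l<n. t l) - (\<Sum>l<n. a l * b l)\<bar> \<le> (\<Sum>l<n. \<bar>t l - a l * b l\<bar>)"
    unfolding sum_subtractf[symmetric] by (rule sum_abs)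
  also have "\<dots> \<le> (\<Sum>l<n. u * (\<bar>a l\<bar> * \<bar>b l\<bar>))" by (rule sum_mono) (use t1 in auto)
  finally have 1: "\<bar>(\<Sum>l<n. t l) - (\<Sum>l<n. a l * b l)\<bar> \<le> u * R"
    by (simp add: R_def sum_distrib_left)
  have "(\<Sum>l<n. \<bar>t l\<bar>) \<le> (\<Sum>l<n. (1 + u) * (\<bar>a l\<bar> * \<bar>b l\<bar>))"
  proof (rule sum_mono)
    fix l assume "l \<in> {..<n}"
    then show "\<bar>t l\<bar> \<le> (1 + u) * (\<bar>a l\<bar> * \<bar>b l\<bar>)"
      using t1[of l] by (simp add: abs_mult[symmetric] algebra_simps)
  qed
  then have 2: "(\<Sum>l<n. \<bar>t l\<bar>) \<le> (1 + u) * R" by (simp add: R_def sum_distrib_left)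
  have "\<bar>r - (sum_mset M + (\<Sum>l<n. t l))\<bar> \<le> (g - 1) * (P + (\<Sum>l<n. \<bar>t l\<bar>))"
    using fl_sum_error[OF r assms(2)]
    by (simp add: g_def P_def multiset.map_comp o_def sum_unfold_sum_mset)
  also have "\<dots> \<le> (g - 1) * (P + (1 + u) * R)"
    using 2 g by (intro mult_left_mono) auto
  finally have "\<bar>r - (sum_mset M + (\<Sum>l<n. a l * b l))\<bar> \<le> (g - 1) * (P + (1 + u) * R) + u * R"
    using 1 by linarith
  also have "\<dots> \<le> (g * (1 + u) - 1) * (P + R)"
    using nn g assms(2) mult_nonneg_nonneg[of "g * u" P] by (simp add: algebra_simps)
  also have "g * (1 + u) = (1 + u) ^ (size M + n + 1)" by (simp add: g_def algebra_simps)
  also have "((1 + u) ^ (size M + n + 1) - 1) * (P + R) \<le> ((1 + u) ^ k - 1) * (P + R)"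
    using nn one_add_power_mono[OF assms(2,3)] by (intro mult_right_mono diff_right_mono) auto
  finally show ?thesis by (simp add: P_def R_def)
qed

lemma entry_emb_times:
  assumes "A \<in> carrier_mat m n" "B \<in> carrier_mat n q" "i < m" "j < q"
  shows "entry (emb A * emb B) i j = (\<Sum>l<n. A $$ (i, l) * B $$ (l, j))"
proof -
  have "entry (emb A * emb B) i j = (\<Sum>l<n. entry (emb A) i l * entry (emb B) l j)"
    by (rule entry_times_bound) (use assms in auto)
  then show ?thesis using assms by (auto intro!: sum.cong)
qed

lemma entry_abs_fmat_emb_times:
  assumes "A \<in> carrier_mat m n" "B \<in> carrier_mat n q" "i < m" "j < q"
  shows "entry (abs_fmat (emb A) * abs_fmat (emb B)) i j = (\<Sum>l<n. \<bar>A $$ (i, l)\<bar> * \<bar>B $$ (l, j)\<bar>)"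
proof -
  have "entry (abs_fmat (emb A) * abs_fmat (emb B)) i j = (\<Sum>l<n. entry (abs_fmat (emb A)) i l * entry (abs_fmat (emb B)) l j)"
    by (rule entry_times_bound) (use assms in auto)
  then show ?thesis using assms by (auto intro!: sum.cong)
qed

lemma entry_abs_fmat_times_nonneg: "0 \<le> entry (abs_fmat A * abs_fmat B) i j"
  by (simp add: entry_times sum_nonneg)

lemma entry_outside:
  assumes "idm m * A = A" "A * idm q = A" "\<not> (i < m \<and> j < q)"
  shows "entry A i j = 0"
  using assms by (metis entry_idm_times entry_times_idm)

text \<open>The exponent n + 2 counts the n products, the summand from C and the rounding of the
  products. The same exponent is used for all kernels, so that a single g serves them.\<close>

lemma fl_add_mult_error:
  assumes fl: "fl_add_mult u C A B R"
    and c: "C \<in> carrier_mat m q" "A \<in> carrier_mat m n" "B \<in> carrier_mat n q"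
    and u: "0 \<le> u" "(1 + u) ^ (n + 2) - 1 \<le> g"
  shows "R \<in> carrier_mat m q"
    "norm (emb R - (emb C + emb A * emb B)) \<le> g * (norm (emb C) + norm (emb A) * norm (emb B))"
proof -
  show R: "R \<in> carrier_mat m q" using fl c by (auto simp: fl_add_mult_def)
  have g: "0 \<le> g" using u by (meson diff_ge_0_iff_ge le_add_same_cancel1 one_le_power order_trans)
  let ?E = "emb R - (emb C + emb A * emb B)" and ?F = "g *\<^sub>R (abs_fmat (emb C) + abs_fmat (emb A) * abs_fmat (emb B))"
  have E: "idm m * ?E = ?E" "?E * idm q = ?E"
    using emb_carrier[OF R] emb_carrier[OF c(1)] emb_carrier[OF c(2)] emb_carrier[OF c(3)]
    by (simp_all add: left_diff_distrib right_diff_distrib distrib_left distrib_right mult.assoc)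
      (simp add: mult.assoc[symmetric])
  have "norm ?E \<le> norm ?F"
  proof (rule norm_fmat_mono)
    fix i j
    show "\<bar>entry ?E i j\<bar> \<le> entry ?F i j"
    proof (cases "i < m \<and> j < q")
      case True
      then have "fl_inner u {#C $$ (i, j)#} n (\<lambda>l. A $$ (i, l)) (\<lambda>l. B $$ (l, j)) (R $$ (i, j))"
        using fl c by (auto simp: fl_add_mult_def)
      from fl_inner_error[OF this u(1), of "n + 2"]
      have "\<bar>entry ?E i j\<bar> \<le> ((1 + u) ^ (n + 2) - 1) * entry (abs_fmat (emb C) + abs_fmat (emb A) * abs_fmat (emb B)) i j"
        using True R c by (simp add: entry_emb_times[OF c(2,3)] entry_abs_fmat_emb_times[OF c(2,3)])
      also have "\<dots> \<le> g * entry (abs_fmat (emb C) + abs_fmat (emb A) * abs_fmat (emb B)) i j"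
        using u by (intro mult_right_mono) (auto simp: entry_abs_fmat_times_nonneg)
      finally show ?thesis by simp
    next
      case False
      then show ?thesis using entry_outside[OF E] g by (simp add: entry_abs_fmat_times_nonneg)
    qed
  qed
  also have "\<dots> = g * norm (abs_fmat (emb C) + abs_fmat (emb A) * abs_fmat (emb B))" using g by simp
  also have "\<dots> \<le> g * (norm (emb C) + norm (emb A) * norm (emb B))"
    using norm_triangle_ineq[of "abs_fmat (emb C)" "abs_fmat (emb A) * abs_fmat (emb B)"]
      norm_mult_ineq[of "abs_fmat (emb A)" "abs_fmat (emb B)"] g
    by (intro mult_left_mono) auto
  finally show "norm ?E \<le> g * (norm (emb C) + norm (emb A) * norm (emb B))" .
qed

lemma fl_mult_error:
  assumes fl: "fl_mult u A B R"
    and c: "A \<in> carrier_mat m n" "B \<in> carrier_mat n q"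
    and u: "0 \<le> u" "(1 + u) ^ (n + 2) - 1 \<le> g"
  shows "R \<in> carrier_mat m q"
    "norm (emb R - emb A * emb B) \<le> g * (norm (emb A) * norm (emb B))"
proof -
  show R: "R \<in> carrier_mat m q" using fl c by (auto simp: fl_mult_def)
  have g: "0 \<le> g" using u by (meson diff_ge_0_iff_ge le_add_same_cancel1 one_le_power order_trans)
  let ?E = "emb R - emb A * emb B" and ?F = "g *\<^sub>R (abs_fmat (emb A) * abs_fmat (emb B))"
  have E: "idm m * ?E = ?E" "?E * idm q = ?E"
    using emb_carrier[OF R] emb_carrier[OF c(1)] emb_carrier[OF c(2)]
    by (simp_all add: left_diff_distrib right_diff_distrib mult.assoc)
      (simp add: mult.assoc[symmetric])
  have "norm ?E \<le> norm ?F"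
  proof (rule norm_fmat_mono)
    fix i j
    show "\<bar>entry ?E i j\<bar> \<le> entry ?F i j"
    proof (cases "i < m \<and> j < q")
      case True
      then have "fl_inner u {#} n (\<lambda>l. A $$ (i, l)) (\<lambda>l. B $$ (l, j)) (R $$ (i, j))"
        using fl c by (auto simp: fl_mult_def)
      from fl_inner_error[OF this u(1), of "n + 2"]
      have "\<bar>entry ?E i j\<bar> \<le> ((1 + u) ^ (n + 2) - 1) * entry (abs_fmat (emb A) * abs_fmat (emb B)) i j"
        using True R c by (simp add: entry_emb_times[OF c] entry_abs_fmat_emb_times[OF c])
      also have "\<dots> \<le> g * entry (abs_fmat (emb A) * abs_fmat (emb B)) i j"
        using u by (intro mult_right_mono) (auto simp: entry_abs_fmat_times_nonneg)
      finally show ?thesis by simp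
    next
      case False
      then show ?thesis using entry_outside[OF E] g by (simp add: entry_abs_fmat_times_nonneg)
    qed
  qed
  also have "\<dots> = g * norm (abs_fmat (emb A) * abs_fmat (emb B))" using g by simp
  also have "\<dots> \<le> g * (norm (emb A) * norm (emb B))"
    using norm_mult_ineq[of "abs_fmat (emb A)" "abs_fmat (emb B)"] g by (intro mult_left_mono) auto
  finally show "norm ?E \<le> g * (norm (emb A) * norm (emb B))" .
qed

text \<open>The residual is bounded rather than the error of T, so the conditioning of L does not
  enter. The inner product in row i < n accounts for the exponent n + 1, the division for one
  more.\<close>

lemma fl_forward_subst_error:
  assumes fl: "fl_forward_subst u L B T"
    and c: "L \<in> carrier_mat n n" "B \<in> carrier_mat n q"
    and tri: "\<And>i l. i < l \<Longrightarrow> l < n \<Longrightarrow> L $$ (i, l) = 0"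
    and diag: "\<And>i. i < n \<Longrightarrow> L $$ (i, i) \<noteq> 0"
    and u: "0 \<le> u" "(1 + u) ^ (n + 2) - 1 \<le> g"
  shows "T \<in> carrier_mat n q"
    "norm (emb L * emb T - emb B) \<le> g * (norm (emb B) + norm (emb L) * norm (emb T))"
proof -
  show T: "T \<in> carrier_mat n q" using fl c by (auto simp: fl_forward_subst_def)
  have g: "0 \<le> g" using u by (meson diff_ge_0_iff_ge le_add_same_cancel1 one_le_power order_trans)
  let ?E = "emb L * emb T - emb B" and ?F = "g *\<^sub>R (abs_fmat (emb B) + abs_fmat (emb L) * abs_fmat (emb T))"
  have E: "idm n * ?E = ?E" "?E * idm q = ?E"
    using emb_carrier[OF T] emb_carrier[OF c(1)] emb_carrier[OF c(2)]
    by (simp_all add: left_diff_distrib right_diff_distrib mult.assoc)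
      (simp add: mult.assoc[symmetric])
  have "norm ?E \<le> norm ?F"
  proof (rule norm_fmat_mono)
    fix i j
    show "\<bar>entry ?E i j\<bar> \<le> entry ?F i j"
    proof (cases "i < n \<and> j < q")
      case True
      then obtain d where d: "fl_inner u {#B $$ (i, j)#} i (\<lambda>l. - L $$ (i, l)) (\<lambda>l. T $$ (l, j)) d"
        and "rounded u (d / L $$ (i, i)) (T $$ (i, j))"
        using fl c by (auto simp: fl_forward_subst_def)
      then obtain \<delta> where \<delta>: "\<bar>\<delta>\<bar> \<le> u" "T $$ (i, j) = d / L $$ (i, i) * (1 + \<delta>)"
        by (auto simp: rounded_def)
      have LT: "L $$ (i, i) * T $$ (i, j) = d * (1 + \<delta>)" using diag True \<delta> by simp
      define P where "P = \<bar>B $$ (i, j)\<bar> + (\<Sum>l<i. \<bar>L $$ (i, l)\<bar> * \<bar>T $$ (l, j)\<bar>)"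
      define D where "D = B $$ (i, j) - (\<Sum>l<i. L $$ (i, l) * T $$ (l, j))"
      have P: "0 \<le> P" by (simp add: P_def sum_nonneg add_nonneg_nonneg)
      have dD: "\<bar>d - D\<bar> \<le> ((1 + u) ^ (n + 1) - 1) * P"
        using fl_inner_error[OF d u(1), of "n + 1"] True by (simp add: P_def D_def sum_negf)
      have "\<bar>\<Sum>l<i. L $$ (i, l) * T $$ (l, j)\<bar> \<le> (\<Sum>l<i. \<bar>L $$ (i, l)\<bar> * \<bar>T $$ (l, j)\<bar>)"
        unfolding abs_mult[symmetric] by (rule sum_abs)
      then have "\<bar>D\<bar> \<le> P" by (simp add: D_def P_def)
      then have "\<bar>d\<bar> \<le> (1 + u) ^ (n + 1) * P" using dD by (simp add: algebra_simps)
      then have "\<bar>d * \<delta>\<bar> \<le> (1 + u) ^ (n + 1) * P * u"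
        unfolding abs_mult using \<delta>(1) by (intro mult_mono) (use P u in auto)
      then have 1: "\<bar>d * (1 + \<delta>) - D\<bar> \<le> ((1 + u) ^ (n + 1) - 1) * P + (1 + u) ^ (n + 1) * P * u"
        using dD by (simp add: algebra_simps)
      \<comment> \<open>Row i of L times T splits at the diagonal: the terms before it form the sum
        in the recurrence, the diagonal term is given by \<open>LT\<close>, and the terms after it
        vanish by triangularity.\<close>
      have "{..<n} = insert i {..<i} \<union> {i<..<n}" using True by auto
      then have split: "(\<Sum>l<n. h l) = h i + (\<Sum>l<i. h l) + (\<Sum>l\<in>{i<..<n}. h l)" for h :: "nat \<Rightarrow> real"
        by (simp add: sum.union_disjoint Int_def)
      have "entry ?E i j = d * (1 + \<delta>) - D"
        using True c tri by (simp add: entry_emb_times[OF c(1) T] split LT D_def)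
      also have "\<bar>\<dots>\<bar> \<le> ((1 + u) ^ (n + 2) - 1) * P" using 1 by (simp add: algebra_simps)
      also have "\<dots> \<le> g * P" using u P by (intro mult_right_mono)
      also have "\<dots> \<le> g * (\<bar>B $$ (i, j)\<bar> + (\<Sum>l<n. \<bar>L $$ (i, l)\<bar> * \<bar>T $$ (l, j)\<bar>))"
        unfolding P_def using True
        by (intro mult_left_mono[OF _ g] add_left_mono sum_mono2) auto
      finally show ?thesis using True c by (simp add: entry_abs_fmat_emb_times[OF c(1) T])
    next
      case False
      then show ?thesis using entry_outside[OF E] g by (simp add: entry_abs_fmat_times_nonneg)
    qed
  qed
  also have "\<dots> = g * norm (abs_fmat (emb B) + abs_fmat (emb L) * abs_fmat (emb T))" using g by simp
  also have "\<dots> \<le> g * (norm (emb B) + norm (emb L) * norm (emb T))"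
    using norm_triangle_ineq[of "abs_fmat (emb B)" "abs_fmat (emb L) * abs_fmat (emb T)"]
      norm_mult_ineq[of "abs_fmat (emb L)" "abs_fmat (emb T)"] g
    by (intro mult_left_mono) auto
  finally show "norm ?E \<le> g * (norm (emb B) + norm (emb L) * norm (emb T))" .
qed

text \<open>G is the diagonal entry, S the sum over the earlier rows, d the computed pivot before
  the root. The two conclusions live on different scales: the distance from 1 is of order \<eta>,
  which later contains \<kappa>, while the residual is of order g, which does not.\<close>

lemma cholesky_pivot_bounds:
  fixes g \<eta> u G S d \<delta> :: real
  assumes r: "0 \<le> u" "u \<le> g" "g \<le> \<eta>" "\<eta> \<le> 1 / 64"
    and G: "\<bar>G - 1\<bar> \<le> \<eta>" and S: "\<bar>S\<bar> \<le> \<eta> / 4"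
    and d: "\<bar>d - (G - S)\<bar> \<le> g * (\<bar>G\<bar> + \<eta> / 4)" and \<delta>: "\<bar>\<delta>\<bar> \<le> u"
  shows "\<bar>sqrt d * (1 + \<delta>) - 1\<bar> \<le> 4 * \<eta>"
    "\<bar>S + (sqrt d * (1 + \<delta>)) * (sqrt d * (1 + \<delta>)) - G\<bar> \<le> 4 * g"
proof -
  have "g * (\<bar>G\<bar> + \<eta> / 4) \<le> g * (17 / 16)" using r G by (intro mult_left_mono) auto
  then have d1: "\<bar>d - (G - S)\<bar> \<le> 17 / 16 * g" using d by simp
  then have d2: "\<bar>d - 1\<bar> \<le> 5 / 2 * \<eta>" using G S r by linarith
  define s where "s = sqrt d"
  have d0: "0 \<le> d" "d \<le> 69 / 64" using d2 r by linarith+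
  then have s: "0 \<le> s" "s * s = d" by (simp_all add: s_def)
  \<comment> \<open>As s + 1 is at least 1, the root of d is at most as far from 1 as d
    itself.\<close>
  have "\<bar>s - 1\<bar> * (s + 1) = \<bar>d - 1\<bar>"
  proof -
    have "(s - 1) * (s + 1) = d - 1" using s(2) by (simp add: algebra_simps)
    then have "\<bar>s - 1\<bar> * \<bar>s + 1\<bar> = \<bar>d - 1\<bar>" by (simp only: abs_mult[symmetric])
    then show ?thesis using s(1) by simp
  qed
  moreover have "\<bar>s - 1\<bar> * 1 \<le> \<bar>s - 1\<bar> * (s + 1)" using s by (intro mult_left_mono) auto
  ultimately have "\<bar>s - 1\<bar> \<le> \<bar>d - 1\<bar>" by simp
  then have s1: "\<bar>s - 1\<bar> \<le> 5 / 2 * \<eta>" using d2 by linarith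
  then have s2: "s \<le> 69 / 64" using r by linarith
  have "\<bar>s * \<delta>\<bar> \<le> 69 / 64 * u" unfolding abs_mult using s s2 \<delta> by (intro mult_mono) auto
  moreover have "s * (1 + \<delta>) - 1 = (s - 1) + s * \<delta>" by (simp add: algebra_simps)
  ultimately show "\<bar>sqrt d * (1 + \<delta>) - 1\<bar> \<le> 4 * \<eta>"
    using s1 r unfolding s_def[symmetric] by linarith
  have "\<bar>\<delta>\<bar> * \<bar>\<delta>\<bar> \<le> u * (1 / 64)" using \<delta> r by (intro mult_mono) auto
  then have "\<bar>2 * \<delta> + \<delta> * \<delta>\<bar> \<le> 129 / 64 * u"
    using \<delta> abs_mult[of \<delta> \<delta>] by linarith
  then have "\<bar>d * (2 * \<delta> + \<delta> * \<delta>)\<bar> \<le> 69 / 64 * (129 / 64 * u)"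
    unfolding abs_mult using d0 by (intro mult_mono) auto
  moreover have "(s * (1 + \<delta>)) * (s * (1 + \<delta>)) = d + d * (2 * \<delta> + \<delta> * \<delta>)"
    unfolding s(2)[symmetric] by (simp add: algebra_simps)
  ultimately show "\<bar>S + (sqrt d * (1 + \<delta>)) * (sqrt d * (1 + \<delta>)) - G\<bar> \<le> 4 * g"
    unfolding s_def[symmetric] using d1 r by linarith
qed

lemma cholesky_off_diagonal_bounds:
  fixes g \<eta> u G S d \<delta> c :: real
  assumes r: "0 \<le> u" "u \<le> g" "g \<le> \<eta>" "\<eta> \<le> 1 / 64"
    and G: "\<bar>G\<bar> \<le> \<eta>" and S: "\<bar>S\<bar> \<le> \<eta> / 4"
    and d: "\<bar>d - (G - S)\<bar> \<le> g * (\<bar>G\<bar> + \<eta> / 4)" and \<delta>: "\<bar>\<delta>\<bar> \<le> u"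
    and c: "\<bar>c - 1\<bar> \<le> 4 * \<eta>"
  shows "\<bar>d / c * (1 + \<delta>)\<bar> \<le> 4 * \<eta>" "\<bar>S + c * (d / c * (1 + \<delta>)) - G\<bar> \<le> 4 * g"
proof -
  have "g * (\<bar>G\<bar> + \<eta> / 4) \<le> g * (1 / 16)" using r G by (intro mult_left_mono) auto
  then have d1: "\<bar>d - (G - S)\<bar> \<le> 1 / 16 * g" using d by simp
  then have d2: "\<bar>d\<bar> \<le> 3 / 2 * \<eta>" using G S r by linarith
  have c1: "15 / 16 \<le> c" using c r by linarith
  have "\<bar>d\<bar> / c \<le> (3 / 2 * \<eta>) / (15 / 16)" using c1 d2 by (intro frac_le) auto
  then have "\<bar>d / c\<bar> * \<bar>1 + \<delta>\<bar> \<le> (8 / 5 * \<eta>) * (65 / 64)"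
    using c1 \<delta> r by (intro mult_mono) auto
  then show "\<bar>d / c * (1 + \<delta>)\<bar> \<le> 4 * \<eta>" 
    using r unfolding abs_mult[of "d / c"] by linarith
  have "\<bar>d * \<delta>\<bar> \<le> 1 * u" unfolding abs_mult using d2 r \<delta> by (intro mult_mono) auto
  moreover have "c * (d / c * (1 + \<delta>)) = d + d * \<delta>" using c1 by (simp add: field_simps)
  ultimately show "\<bar>S + c * (d / c * (1 + \<delta>)) - G\<bar> \<le> 4 * g" using d1 r by linarith
qed

text \<open>Row by row, the factor stays within 4 \<eta> of the identity, so pivots stay near 1 and
  no breakdown occurs. Only the upper triangle of G is read and the computed G need not be
  symmetric; the residual is therefore measured against an arbitrary symmetric B near G.\<close>

lemma fl_chol_near_identity:
  assumes fl: "fl_chol u G C" and G: "G \<in> carrier_mat n n"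
    and u: "0 \<le> u" "(1 + u) ^ (n + 2) - 1 \<le> g" and g: "g \<le> \<eta>" and n: "1 \<le> n" "64 * real n * \<eta> \<le> 1"
    and near: "norm (emb G - idm n) \<le> \<eta>"
  shows "C \<in> carrier_mat n n" "\<And>i l. l < i \<Longrightarrow> i < n \<Longrightarrow> C $$ (i, l) = 0"
    "\<And>i. i < n \<Longrightarrow> C $$ (i, i) \<noteq> 0" "norm (emb C - idm n) \<le> 1 / 2"
    "\<And>B h. idm n * B = B \<Longrightarrow> B * idm n = B \<Longrightarrow> tr B = B \<Longrightarrow> norm (emb G - B) \<le> h \<Longrightarrow>
      norm (tr (emb C) * emb C - B) \<le> real n * (4 * g + h)"
proof -
  show C: "C \<in> carrier_mat n n" using fl G by (auto simp: fl_chol_def)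
  have upper: "C $$ (i, l) = 0" if "l < i" "i < n" for i l
    using fl that C by (auto simp: fl_chol_def upper_triangular_def)
  then show "\<And>i l. l < i \<Longrightarrow> i < n \<Longrightarrow> C $$ (i, l) = 0" .
  have ug: "u \<le> g" using one_add_power_mono[OF u(1), of 1 "n + 2"] u(2) by simp
  have \<eta>0: "0 \<le> \<eta>" using u ug g by linarith
  have "1 * \<eta> \<le> real n * \<eta>" using n \<eta>0 by (intro mult_right_mono) auto
  then have \<eta>1: "\<eta> \<le> 1 / 64" using n(2) by linarith
  note r = u(1) ug g \<eta>1
  have Gij: "\<bar>G $$ (i, j) - (if i = j then 1 else 0)\<bar> \<le> \<eta>" if "i < n" "j < n" for i j
    using abs_entry_le_norm[of "emb G - idm n" i j] near that G by (auto simp: entry_idm)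
  have rows: "\<bar>C $$ (i, i) - 1\<bar> \<le> 4 * \<eta> \<and> (\<forall>j. i < j \<longrightarrow> j < n \<longrightarrow> \<bar>C $$ (i, j)\<bar> \<le> 4 * \<eta>) \<and>
    (\<forall>j. i \<le> j \<longrightarrow> j < n \<longrightarrow>
      \<bar>(\<Sum>l<i. C $$ (l, i) * C $$ (l, j)) + C $$ (i, i) * C $$ (i, j) - G $$ (i, j)\<bar> \<le> 4 * g)"
    if "i < n" for i
    using that
  proof (induction i rule: less_induct)
    case (less i)
    have prev: "\<bar>C $$ (l, j)\<bar> \<le> 4 * \<eta>" if "l < i" "i \<le> j" "j < n" for l j
      using less.IH[of l] that less.prems by auto
    have step: "\<exists>d. \<bar>d - (G $$ (i, j) - (\<Sum>l<i. C $$ (l, i) * C $$ (l, j)))\<bar> \<le> g * (\<bar>G $$ (i, j)\<bar> + \<eta> / 4)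
       \<and> (if i = j then rounded u (sqrt d) (C $$ (i, j)) else rounded u (d / C $$ (i, i)) (C $$ (i, j)))"
      and S: "\<bar>\<Sum>l<i. C $$ (l, i) * C $$ (l, j)\<bar> \<le> \<eta> / 4" if j: "i \<le> j" "j < n" for j
    proof -
      \<comment> \<open>Earlier rows contribute at most n (4 \<eta>)^2, and
        \<open>64 * real n * \<eta> \<le> 1\<close> is what brings this below \<eta> / 4; so the
        bound 4 \<eta> reproduces itself from row to row.\<close>
      have "(\<Sum>l<i. \<bar>C $$ (l, i)\<bar> * \<bar>C $$ (l, j)\<bar>) \<le> (\<Sum>l<i. (4 * \<eta>) * (4 * \<eta>))"
        using prev j less.prems \<eta>0 by (intro sum_mono mult_mono) auto
      also have "\<dots> \<le> real n * ((4 * \<eta>) * (4 * \<eta>))"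
        using less.prems by (simp add: mult_right_mono)
      also have "\<dots> = (64 * real n * \<eta>) * (\<eta> / 4)" by simp
      also have "\<dots> \<le> 1 * (\<eta> / 4)" using n \<eta>0 by (intro mult_right_mono) auto
      finally have P: "(\<Sum>l<i. \<bar>C $$ (l, i)\<bar> * \<bar>C $$ (l, j)\<bar>) \<le> \<eta> / 4" by simp
      have "\<bar>\<Sum>l<i. C $$ (l, i) * C $$ (l, j)\<bar> \<le> (\<Sum>l<i. \<bar>C $$ (l, i)\<bar> * \<bar>C $$ (l, j)\<bar>)"
        unfolding abs_mult[symmetric] by (rule sum_abs)
      then show "\<bar>\<Sum>l<i. C $$ (l, i) * C $$ (l, j)\<bar> \<le> \<eta> / 4" using P by linarith
      obtain d where d: "fl_inner u {#G $$ (i, j)#} i (\<lambda>l. - C $$ (l, i)) (\<lambda>l. C $$ (l, j)) d"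
        and piv: "if i = j then rounded u (sqrt d) (C $$ (i, j)) else rounded u (d / C $$ (i, i)) (C $$ (i, j))"
        using fl G j by (auto simp: fl_chol_def)
      have "\<bar>d - (G $$ (i, j) - (\<Sum>l<i. C $$ (l, i) * C $$ (l, j)))\<bar>
        \<le> ((1 + u) ^ (n + 2) - 1) * (\<bar>G $$ (i, j)\<bar> + (\<Sum>l<i. \<bar>C $$ (l, i)\<bar> * \<bar>C $$ (l, j)\<bar>))"
        using fl_inner_error[OF d u(1), of "n + 2"] less.prems by (simp add: sum_negf)
      also have "\<dots> \<le> g * (\<bar>G $$ (i, j)\<bar> + \<eta> / 4)"
        using u P ug \<eta>0 by (intro mult_mono) (auto intro!: add_nonneg_nonneg sum_nonneg)
      finally show "\<exists>d. \<bar>d - (G $$ (i, j) - (\<Sum>l<i. C $$ (l, i) * C $$ (l, j)))\<bar> \<le> g * (\<bar>G $$ (i, j)\<bar> + \<eta> / 4)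
       \<and> (if i = j then rounded u (sqrt d) (C $$ (i, j)) else rounded u (d / C $$ (i, i)) (C $$ (i, j)))"
        using piv by blast
    qed
    obtain d \<delta> where d: "\<bar>d - (G $$ (i, i) - (\<Sum>l<i. C $$ (l, i) * C $$ (l, i)))\<bar> \<le> g * (\<bar>G $$ (i, i)\<bar> + \<eta> / 4)"
      "\<bar>\<delta>\<bar> \<le> u" "C $$ (i, i) = sqrt d * (1 + \<delta>)"
      using step[of i] less.prems by (auto simp: rounded_def)
    have "\<bar>G $$ (i, i) - 1\<bar> \<le> \<eta>" using Gij[of i i] less.prems by simp
    note piv = cholesky_pivot_bounds[OF r this S[OF order_refl less.prems] d(1,2), folded d(3)]
    have off: "\<bar>C $$ (i, j)\<bar> \<le> 4 * \<eta> \<and>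
      \<bar>(\<Sum>l<i. C $$ (l, i) * C $$ (l, j)) + C $$ (i, i) * C $$ (i, j) - G $$ (i, j)\<bar> \<le> 4 * g"
      if j: "i < j" "j < n" for j
    proof -
      obtain d' \<delta>' where d': "\<bar>d' - (G $$ (i, j) - (\<Sum>l<i. C $$ (l, i) * C $$ (l, j)))\<bar> \<le> g * (\<bar>G $$ (i, j)\<bar> + \<eta> / 4)"
        "\<bar>\<delta>'\<bar> \<le> u" "C $$ (i, j) = d' / C $$ (i, i) * (1 + \<delta>')"
        using step[of j] j by (auto simp: rounded_def)
      have "\<bar>G $$ (i, j)\<bar> \<le> \<eta>" using Gij[of i j] j less.prems by simp
      from cholesky_off_diagonal_bounds[OF r this S[OF less_imp_le[OF j(1)] j(2)] d'(1,2) piv(1), folded d'(3)]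
      show ?thesis ..
    qed
    have "\<bar>(\<Sum>l<i. C $$ (l, i) * C $$ (l, j)) + C $$ (i, i) * C $$ (i, j) - G $$ (i, j)\<bar> \<le> 4 * g"
      if "i \<le> j" "j < n" for j
      using piv(2) off[of j] that by (cases "i = j") auto
    then show ?case using piv(1) off by blast
  qed
  show "C $$ (i, i) \<noteq> 0" if "i < n" for i using rows[OF that] \<eta>1 by auto
  have cC: "idm n * emb C = emb C" "emb C * idm n = emb C" using emb_carrier[OF C] by auto
  have "norm (emb C - idm n) \<le> (4 * \<eta>) * sqrt (real n * real n)"
  proof (rule norm_fmat_le_const[of n _ n])
    fix i j assume ij: "i < n" "j < n"
    show "\<bar>entry (emb C - idm n) i j\<bar> \<le> 4 * \<eta>"
      using rows[OF ij(1)] upper[of j i] ij C \<eta>0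
      by (cases i j rule: linorder_cases) (auto simp: entry_idm)
  qed (use \<eta>0 in \<open>simp_all add: left_diff_distrib right_diff_distrib cC\<close>)
  moreover have "(4 * \<eta>) * sqrt (real n * real n) \<le> 1 / 2" using n(2) by (simp add: algebra_simps)
  ultimately show "norm (emb C - idm n) \<le> 1 / 2" by linarith
  fix B h
  assume B: "idm n * B = B" "B * idm n = B" "tr B = B" "norm (emb G - B) \<le> h"
  let ?D = "tr (emb C) * emb C - B"
  \<comment> \<open>The recurrence controls the upper half of the residual only; the lower half
    follows by symmetry.\<close>
  have D: "tr ?D = ?D" by (simp add: B)
  have ent: "\<bar>entry ?D i j\<bar> \<le> 4 * g + h" if ij: "i \<le> j" "j < n" for i j
  proof -
    have "entry (tr (emb C) * emb C) i j = (\<Sum>l<n. entry (tr (emb C)) i l * entry (emb C) l j)"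
      by (rule entry_times_bound) (use C in auto)
    also have "\<dots> = (\<Sum>l<n. C $$ (l, i) * C $$ (l, j))" using C ij by (auto intro!: sum.cong)
    also have "\<dots> = (\<Sum>l\<in>insert i {..<i}. C $$ (l, i) * C $$ (l, j))"
      using ij upper by (intro sum.mono_neutral_right) auto
    also have "\<dots> = (\<Sum>l<i. C $$ (l, i) * C $$ (l, j)) + C $$ (i, i) * C $$ (i, j)" by simp
    finally have "\<bar>entry (tr (emb C) * emb C) i j - G $$ (i, j)\<bar> \<le> 4 * g"
      using rows[of i] ij by simp
    moreover have "\<bar>G $$ (i, j) - entry B i j\<bar> \<le> h"
      using abs_entry_le_norm[of "emb G - B" i j] B(4) G ij by simp
    ultimately show ?thesis by (simp only: entry_arith)
  qed
  have "norm ?D \<le> (4 * g + h) * sqrt (real n * real n)"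
  proof (rule norm_fmat_le_const[of n _ n])
    show "idm n * ?D = ?D" "?D * idm n = ?D"
      using B cC by (simp_all add: left_diff_distrib right_diff_distrib mult.assoc)
        (metis cC(2) mult.assoc tr_idm tr_times)
    show "0 \<le> 4 * g + h" using r B(4) norm_ge_zero[of "emb G - B"] by linarith
    fix i j assume "i < n" "j < n"
    then show "\<bar>entry ?D i j\<bar> \<le> 4 * g + h"
      using ent[of i j] ent[of j i] D by (metis entry_tr nle_le)
  qed
  then show "norm ?D \<le> real n * (4 * g + h)" by (simp add: mult.commute)
qed

section \<open>Analysis of one step\<close>

text \<open>The squared Frobenius norm is the trace of \<open>tr Q * Q\<close>, which is at most n +
  sqrt n.\<close>

lemma norm_near_orthonormal:
  assumes Q: "Q * idm n = Q" and near: "norm (tr Q * Q - idm n) \<le> 1"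
  shows "norm Q \<le> 2 * sqrt (real n)"
proof -
  have "(norm Q)\<^sup>2 = inner (tr Q * Q) (idm n)"
    by (metis Q inner_commute inner_times_left power2_norm_eq_inner tr_simps(1))
  also have "\<dots> = inner (tr Q * Q - idm n) (idm n) + (norm (idm n))\<^sup>2"
    by (simp add: inner_diff_left power2_norm_eq_inner)
  also have "inner (tr Q * Q - idm n) (idm n) \<le> norm (tr Q * Q - idm n) * norm (idm n)"
    by (rule norm_cauchy_schwarz)
  also have "\<dots> \<le> 1 * sqrt (real n)" unfolding norm_idm by (rule mult_right_mono[OF near]) simp
  also have "1 * sqrt (real n) \<le> real n"
    by (cases n) (auto intro!: real_le_lsqrt simp: power2_eq_square)
  finally have "(norm Q)\<^sup>2 \<le> (2 * sqrt (real n))\<^sup>2" by (simp add: norm_idm power_mult_distrib)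
  then show ?thesis by (rule power2_le_imp_le) simp
qed

text \<open>With P = \<open>tr Q * V\<close>, the squared norm is that of V minus 2 (norm P)^2 plus
  (norm (Q P))^2, and the last term is at most 2 (norm P)^2. So I - Q Q^T is a contraction although
  Q is not exactly orthonormal, and \<open>sigma_max\<close> does not grow under it.\<close>

lemma norm_diff_projection_le:
  assumes Q: "Q * idm n = Q" and near: "norm (tr Q * Q - idm n) \<le> 1"
  shows "norm (V - Q * (tr Q * V)) \<le> norm V"
proof -
  let ?P = "tr Q * V"
  have P: "idm n * ?P = ?P" by (metis Q mult.assoc tr_idm tr_times)
  have "(norm (Q * ?P))\<^sup>2 = inner ?P (tr Q * Q * ?P)"
    by (simp add: power2_norm_eq_inner inner_times_left mult.assoc)
  also have "\<dots> = inner ?P ((tr Q * Q - idm n) * ?P) + (norm ?P)\<^sup>2"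
    by (simp add: left_diff_distrib inner_diff_right P power2_norm_eq_inner)
  also have "inner ?P ((tr Q * Q - idm n) * ?P) \<le> norm ?P * (norm (tr Q * Q - idm n) * norm ?P)"
    by (meson norm_cauchy_schwarz norm_mult_ineq mult_left_mono norm_ge_zero order_trans)
  also have "\<dots> \<le> norm ?P * (1 * norm ?P)"
    by (intro mult_left_mono mult_right_mono near) auto
  finally have 1: "(norm (Q * ?P))\<^sup>2 \<le> 2 * (norm ?P)\<^sup>2" by (simp add: power2_eq_square)
  have 2: "inner V (Q * ?P) = (norm ?P)\<^sup>2"
    unfolding inner_commute[of V "Q * ?P"] inner_times_left power2_norm_eq_inner ..
  have "(norm (V - Q * ?P))\<^sup>2 = (norm V)\<^sup>2 - 2 * inner V (Q * ?P) + (norm (Q * ?P))\<^sup>2"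
    unfolding power2_norm_eq_inner
    by (simp add: inner_diff_left inner_diff_right inner_commute[of "Q * ?P" V])
  then have "(norm (V - Q * ?P))\<^sup>2 \<le> (norm V)\<^sup>2" using 1 2 by simp
  then show ?thesis by (rule power2_le_imp_le) simp
qed

text \<open>Cancels a factor close to the identity without forming its inverse: the term (C - I) B
  takes up at most half of \<open>norm B\<close>.\<close>

lemma near_identity_left:
  assumes "idm s * B = B" "norm (C - idm s) \<le> 1 / 2"
  shows "norm B \<le> 2 * norm (C * B)"
proof -
  have "B = C * B - (C - idm s) * B" by (simp add: algebra_simps assms)
  then have "norm B \<le> norm (C * B) + norm ((C - idm s) * B)" by (metis norm_triangle_ineq4)
  also have "norm ((C - idm s) * B) \<le> norm (C - idm s) * norm B" by (rule norm_mult_ineq)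
  also have "\<dots> \<le> 1 / 2 * norm B" by (intro mult_right_mono assms) simp
  finally show ?thesis by simp
qed

lemma near_identity_right:
  assumes "B * idm s = B" "norm (C - idm s) \<le> 1 / 2"
  shows "norm B \<le> 2 * norm (B * C)"
proof -
  have "norm (tr C - idm s) \<le> 1 / 2" using assms(2) by (metis norm_tr tr_idm tr_simps(3))
  then have "norm (tr B) \<le> 2 * norm (tr C * tr B)"
    using assms(1) by (intro near_identity_left[of s]) (metis tr_idm tr_times, assumption)
  then show ?thesis by (metis norm_tr tr_times)
qed

text \<open>All error bounds have the form \<open>L ^ i * t\<close> with \<open>L\<close> polynomial in the dimensions; a sum is
  absorbed by raising the exponent, so that no explicit constants have to be tracked.\<close>

locale rounding_scale =
  fixes L u \<kappa> \<sigma> :: real and s :: nat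
  assumes L: "100 \<le> L" and u: "0 < u" and \<kappa>: "1 \<le> \<kappa>" and \<sigma>: "0 < \<sigma>"
    and small: "L ^ 60 * (u * \<kappa>) \<le> 1 / 2" and s: "1 \<le> s" "real s \<le> L" "2 * sqrt (real s) \<le> L"
begin

lemma nonneg [simp]: "0 \<le> L" "0 \<le> u" "0 \<le> \<kappa>" "0 \<le> \<sigma>" "0 < L" "0 < u" "0 < \<kappa>" "0 < \<sigma>"
  using L u \<kappa> \<sigma> by auto

lemma pow_mono: "i \<le> j \<Longrightarrow> 0 \<le> t \<Longrightarrow> L ^ i * t \<le> L ^ j * t"
  using L by (intro mult_right_mono power_increasing) auto

lemma pow_weaken: "a \<le> L ^ i * t \<Longrightarrow> i \<le> j \<Longrightarrow> 0 \<le> t \<Longrightarrow> a \<le> L ^ j * t"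
  using pow_mono order_trans by blast

lemma pow_mono2: "a \<le> L ^ i * t \<Longrightarrow> i \<le> j \<Longrightarrow> t \<le> r \<Longrightarrow> 0 \<le> r \<Longrightarrow> a \<le> L ^ j * r"
  by (meson mult_left_mono nonneg(1) order_trans pow_weaken zero_le_power)

text \<open>This is where \<open>100 \<le> L\<close> enters: a numerical factor costs one power of
  L.\<close>

lemma pow_scale:
  assumes "a \<le> L ^ i * t" "0 \<le> c" "c \<le> 100" "i < k" "0 \<le> t"
  shows "c * a \<le> L ^ k * t"
proof -
  have "c * a \<le> c * (L ^ i * t)" using assms by (intro mult_left_mono)
  also have "\<dots> \<le> L * (L ^ i * t)" using assms L by (intro mult_right_mono) auto
  also have "\<dots> = L ^ Suc i * t" by simp
  also have "\<dots> \<le> L ^ k * t" using assms by (intro pow_mono) auto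
  finally show ?thesis .
qed

lemma pow_add:
  assumes "a \<le> L ^ i * t" "b \<le> L ^ j * t" "i < k" "j < k" "0 \<le> t"
  shows "a + b \<le> L ^ k * t"
proof -
  obtain l where l: "k = Suc l" "i \<le> l" "j \<le> l" using assms(3,4) by (cases k) auto
  have "a + b \<le> 2 * (L ^ l * t)" using assms(1,2) pow_mono[OF l(2) assms(5)] pow_mono[OF l(3) assms(5)] by linarith
  also have "\<dots> \<le> L ^ k * t" using pow_scale[OF order_refl, of 2 l k t] l assms by simp
  finally show ?thesis .
qed

lemma pow_mult:
  assumes "a \<le> L ^ i * x" "b \<le> L ^ j * y" "0 \<le> a" "0 \<le> b" "i + j \<le> k" "x * y \<le> t" "0 \<le> t"
  shows "a * b \<le> L ^ k * t"
proof -
  have "a * b \<le> (L ^ i * x) * (L ^ j * y)" using assms(1-4) by (intro mult_mono) auto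
  also have "\<dots> = L ^ (i + j) * (x * y)" by (simp add: power_add algebra_simps)
  also have "\<dots> \<le> L ^ k * t" by (rule pow_mono2[OF order_refl]) (use assms in auto)
  finally show ?thesis .
qed

lemma norm_add_le:
  fixes A B :: fmat
  assumes "norm A \<le> L ^ i * t" "norm B \<le> L ^ j * t" "i < k" "j < k" "0 \<le> t"
  shows "norm (A + B) \<le> L ^ k * t"
  using norm_triangle_ineq[of A B] pow_add[OF assms] by linarith

lemma norm_diff_le:
  fixes A B :: fmat
  assumes "norm A \<le> L ^ i * t" "norm B \<le> L ^ j * t" "i < k" "j < k" "0 \<le> t"
  shows "norm (A - B) \<le> L ^ k * t"
  using norm_triangle_ineq4[of A B] pow_add[OF assms] by linarith

lemma norm_mult_le:
  fixes A B :: fmat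
  assumes "norm A \<le> L ^ i * x" "norm B \<le> L ^ j * y" "i + j \<le> k" "x * y \<le> t" "0 \<le> t"
  shows "norm (A * B) \<le> L ^ k * t"
  using norm_mult_ineq[of A B] pow_mult[OF assms(1,2) _ _ assms(3-5)] by simp

lemma u_le: "u \<le> u * \<kappa>" using \<kappa> by simp

lemma pow_small: "i \<le> 60 \<Longrightarrow> L ^ i * (u * \<kappa>) \<le> 1 / 2"
  by (rule order_trans[OF pow_mono small]) auto

lemma pow_u_small: "i \<le> 60 \<Longrightarrow> L ^ i * u \<le> 1 / 2"
  by (rule order_trans[OF mult_left_mono[OF u_le] pow_small]) auto

text \<open>Trades the small factor L^i u for 1; used when an error term only has to be dominated by
  the main term.\<close>

lemma absorb_u:
  assumes "a \<le> L ^ i * (u * t)" "i \<le> 60" "0 \<le> t"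
  shows "a \<le> L ^ 0 * t"
proof -
  have "(L ^ i * u) * t \<le> (1 / 2) * t" using pow_u_small[OF assms(2)] assms(3) by (rule mult_right_mono)
  then show ?thesis using assms by (simp add: mult.assoc)
qed

lemma norm_near_orthonormal_le:
  assumes "Q * idm s = Q" "norm (tr Q * Q - idm s) \<le> 1"
  shows "norm Q \<le> L ^ 1 * 1"
  using norm_near_orthonormal[OF assms] s(3) by simp

end

text \<open>Q holds all columns computed so far, X is the new block, S its computed coefficients and
  W the computed projection. The exponents 20 and 16 are what the induction hypothesis provides; the
  bound on W is the rounding error of forming it.\<close>

locale projection_step = rounding_scale +
  fixes n :: nat and Q X S W :: fmat
  assumes Q: "Q * idm n = Q" and SI: "idm n * S = S"
    and n: "2 * sqrt (real n) \<le> L"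
    and orth: "norm (tr Q * Q - idm n) \<le> L ^ 20 * u"
    and S: "norm (S - tr Q * X) \<le> L ^ 16 * (u * norm X)"
    and W: "norm (W - (X - Q * S)) \<le> L * u * (norm X + norm Q * norm S)"
begin

lemma orth1: "norm (tr Q * Q - idm n) \<le> 1"
  using orth pow_u_small[of 20] by simp

lemma Q_le: "norm Q \<le> L ^ 1 * 1"
  using norm_near_orthonormal[OF Q orth1] n by simp

lemma S_le: "norm S \<le> L ^ 2 * norm X"
proof -
  have "norm (tr Q * X) \<le> L ^ 1 * norm X"
    using norm_mult_le[of "tr Q" 1 1 X 0 "norm X" 1 "norm X"] Q_le by simp
  from norm_add_le[OF absorb_u[OF S] this, of 2]
  have "norm ((S - tr Q * X) + tr Q * X) \<le> L ^ 2 * norm X" by simp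
  then show ?thesis by simp
qed

lemma QS_le: "norm Q * norm S \<le> L ^ 3 * norm X"
  by (rule pow_mult[OF Q_le S_le]) auto

lemma W_err: "norm (W - (X - Q * S)) \<le> L ^ 5 * (u * norm X)"
proof -
  have "norm X + norm Q * norm S \<le> L ^ 4 * norm X"
    by (rule pow_add[OF _ QS_le, of _ 0]) auto
  then have "(L * u) * (norm X + norm Q * norm S) \<le> L ^ 5 * (u * norm X)"
    by (intro pow_mult[of "L * u" 1 u]) auto
  then show ?thesis using W by linarith
qed

lemma W_le: "norm W \<le> L ^ 5 * norm X"
proof -
  have "norm (X - Q * S) \<le> L ^ 4 * norm X"
    by (rule norm_diff_le[of _ 0 _ _ 3]) (use norm_mult_ineq[of Q S] QS_le in auto)
  from norm_add_le[OF absorb_u[OF W_err] this, of 5]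
  have "norm ((W - (X - Q * S)) + (X - Q * S)) \<le> L ^ 5 * norm X" by simp
  then show ?thesis by simp
qed

text \<open>Projecting W onto the old columns leaves three errors: the rounding of W, the error of
  S, and the loss of orthogonality applied to S. All are of order u times \<open>norm X\<close>,
  with no \<kappa> yet.\<close>

lemma QW_le: "norm (tr Q * W) \<le> L ^ 23 * (u * norm X)"
proof -
  have 1: "norm ((tr Q * Q - idm n) * S) \<le> L ^ 22 * (u * norm X)"
    by (rule norm_mult_le[OF orth S_le]) auto
  have 2: "norm (tr Q * (W - (X - Q * S))) \<le> L ^ 6 * (u * norm X)"
    by (rule norm_mult_le[of _ 1 1, OF _ W_err]) (use Q_le in auto)
  have "norm (tr Q * (W - (X - Q * S)) - (S - tr Q * X)) \<le> L ^ 17 * (u * norm X)"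
    by (rule norm_diff_le[OF 2 S]) auto
  from norm_diff_le[OF this 1, of 23]
  have "norm (tr Q * (W - (X - Q * S)) - (S - tr Q * X) - (tr Q * Q - idm n) * S) \<le> L ^ 23 * (u * norm X)"
    by simp
  moreover have "tr Q * (W - (X - Q * S)) - (S - tr Q * X) - (tr Q * Q - idm n) * S = tr Q * W"
    using SI by (simp add: algebra_simps)
  ultimately show ?thesis by simp
qed

text \<open>Replacing S by \<open>tr Q * X\<close> makes W equal to (I - Q Q^T) X up to a small
  error, and I - Q Q^T is a contraction. Hence the factor N survives with no dimension
  factor.\<close>

lemma W_upper:
  assumes X: "norm (X * V) \<le> N * norm V" and N: "norm X \<le> L * N"
  shows "norm (W * V) \<le> N * (1 + L ^ 19 * u) * norm V"
proof -
  have e1: "norm (Q * (S - tr Q * X)) \<le> L ^ 17 * (u * norm X)"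
    by (rule norm_mult_le[OF Q_le S]) auto
  have "norm (W - (X - Q * S) - Q * (S - tr Q * X)) \<le> L ^ 18 * (u * norm X)"
    by (rule norm_diff_le[OF W_err e1]) auto
  also have "\<dots> \<le> L ^ 18 * (u * (L * N))" using N by (intro mult_left_mono) auto
  also have "\<dots> = L ^ (18 + 1) * u * N" by (simp only: power_add power_one_right mult_ac)
  also have "\<dots> = L ^ 19 * u * N" by simp
  finally have e2: "norm (W - (X - Q * S) - Q * (S - tr Q * X)) \<le> L ^ 19 * u * N" .
  have "W * V = (X * V - Q * (tr Q * (X * V))) + (W - (X - Q * S) - Q * (S - tr Q * X)) * V"
    by (simp add: algebra_simps)
  then have "norm (W * V) \<le> norm (X * V - Q * (tr Q * (X * V)))
      + norm ((W - (X - Q * S) - Q * (S - tr Q * X)) * V)"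
    by (metis norm_triangle_ineq)
  also have "norm (X * V - Q * (tr Q * (X * V))) \<le> norm (X * V)"
    by (rule norm_diff_projection_le[OF Q orth1])
  also have "norm ((W - (X - Q * S) - Q * (S - tr Q * X)) * V) \<le> (L ^ 19 * u * N) * norm V"
    by (rule order_trans[OF norm_mult_ineq mult_right_mono[OF e2]]) simp
  finally show ?thesis using X by (simp add: algebra_simps)
qed

end

context projection_step
begin

text \<open>\<open>Q S\<close> lies in the range of the slightly perturbed previous columns, so \<open>W V\<close> is, up to
  small errors, the image of \<open>(V, - R\<^sup>-\<^sup>1 S V)\<close> under all columns.\<close>

lemma W_lower:
  assumes XX: "\<And>V Z. idm s * V = V \<Longrightarrow> idm n * Z = Z \<Longrightarrow> \<sigma> * norm V \<le> norm (X * V - XX * Z)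
      \<and> \<sigma> * norm Z \<le> norm (X * V - XX * Z)"
    and XX0: "\<And>Z. idm n * Z = Z \<Longrightarrow> \<sigma> * norm Z \<le> norm (XX * Z)"
    and R: "idm n * R = R" "R * idm n = R"
    and res: "norm (XX - Q * R) \<le> L ^ 22 * (u * (\<kappa> * \<sigma>))"
    and X: "norm X \<le> L * (\<kappa> * \<sigma>)" and V: "idm s * V = V"
  shows "\<sigma> * (1 - L ^ 23 * (u * \<kappa>)) * norm V \<le> norm (W * V)"
proof -
  have res1: "norm (XX - Q * R) \<le> \<sigma> * (L ^ 22 * (u * \<kappa>))" using res by (simp only: mult_ac)
  have res2: "norm (XX - Q * R) \<le> \<sigma> / 2"
    using res1 mult_left_mono[OF pow_small[of 22] nonneg(4)] by linarith
  \<comment> \<open>R is injective: Q R is within \<sigma> / 2 of XX, and XX stretches every Z by at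
    least \<sigma>.\<close>
  have ker: "Z = 0" if Z: "idm n * Z = Z" "R * Z = 0" for Z
  proof -
    have "(XX - Q * R) * Z = XX * Z" using Z by (simp add: left_diff_distrib mult.assoc)
    then have "\<sigma> * norm Z \<le> norm ((XX - Q * R) * Z)" using XX0[OF Z(1)] by simp
    also have "\<dots> \<le> norm (XX - Q * R) * norm Z" by (rule norm_mult_ineq)
    also have "\<dots> \<le> \<sigma> / 2 * norm Z" by (rule mult_right_mono[OF res2]) simp
    finally have "\<sigma> * norm Z \<le> 0" by simp
    then show "Z = 0" using \<sigma> by (simp add: mult_le_0_iff)
  qed
  obtain J where J: "idm n * J = J" "R * J = idm n"
    by (rule fmat_inverse[OF R ker])
  define Z where "Z = J * (S * V)"
  have Z: "idm n * Z = Z" by (simp add: Z_def mult.assoc[symmetric] J)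
  have RZ: "R * Z = S * V" by (simp add: Z_def mult.assoc[symmetric] J SI)
  \<comment> \<open>\<sigma> times either of \<open>norm V\<close> and \<open>norm Z\<close> is at
    most w, so all errors are absorbed into w itself and the size of the inverse J never
    enters.\<close>
  define w where "w = norm (X * V - XX * Z)"
  have w: "\<sigma> * norm V \<le> w" "\<sigma> * norm Z \<le> w" using XX[OF V Z] by (auto simp: w_def)
  have "W * V = (X * V - XX * Z) + (W - (X - Q * S)) * V + (XX - Q * R) * Z"
    using RZ by (simp add: algebra_simps mult.assoc)
  then have "X * V - XX * Z = W * V - ((W - (X - Q * S)) * V + (XX - Q * R) * Z)" by simp
  then have "w \<le> norm (W * V) + (norm ((W - (X - Q * S)) * V) + norm ((XX - Q * R) * Z))"
    unfolding w_def by (metis norm_triangle_ineq4 norm_triangle_ineq add_left_mono order_trans)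
  also have "norm ((XX - Q * R) * Z) \<le> \<sigma> * (L ^ 22 * (u * \<kappa>)) * norm Z"
    by (rule order_trans[OF norm_mult_ineq mult_right_mono[OF res1]]) simp
  also have "\<dots> = L ^ 22 * (u * \<kappa>) * (\<sigma> * norm Z)" by simp
  also have "\<dots> \<le> L ^ 22 * (u * \<kappa>) * w" by (intro mult_left_mono w) auto
  also have "norm ((W - (X - Q * S)) * V) \<le> L ^ 6 * (u * \<kappa>) * w"
  proof -
    have "norm (W - (X - Q * S)) \<le> L ^ 5 * (u * (L * (\<kappa> * \<sigma>)))"
      by (rule order_trans[OF W_err]) (intro mult_left_mono X, auto)
    then have "norm ((W - (X - Q * S)) * V) \<le> L ^ 5 * (u * (L * (\<kappa> * \<sigma>))) * norm V"
      by (rule order_trans[OF norm_mult_ineq mult_right_mono]) simp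
    also have "\<dots> = L ^ (5 + 1) * (u * \<kappa>) * (\<sigma> * norm V)"
      by (simp only: power_add power_one_right mult_ac)
    also have "\<dots> = L ^ 6 * (u * \<kappa>) * (\<sigma> * norm V)" by simp
    also have "\<dots> \<le> L ^ 6 * (u * \<kappa>) * w" by (intro mult_left_mono w) auto
    finally show ?thesis .
  qed
  also have "L ^ 6 * (u * \<kappa>) * w + L ^ 22 * (u * \<kappa>) * w \<le> L ^ 23 * (u * \<kappa>) * w"
  proof -
    have "L ^ 6 * (u * \<kappa>) + L ^ 22 * (u * \<kappa>) \<le> L ^ 23 * (u * \<kappa>)"
      by (rule pow_add[OF order_refl order_refl]) auto
    then have "(L ^ 6 * (u * \<kappa>) + L ^ 22 * (u * \<kappa>)) * w \<le> L ^ 23 * (u * \<kappa>) * w"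
      by (rule mult_right_mono) (simp add: w_def)
    then show ?thesis by (simp only: distrib_right)
  qed
  finally have "(1 - L ^ 23 * (u * \<kappa>)) * w \<le> norm (W * V)" by (simp add: left_diff_distrib)
  moreover have "(1 - L ^ 23 * (u * \<kappa>)) * (\<sigma> * norm V) \<le> (1 - L ^ 23 * (u * \<kappa>)) * w"
    by (intro mult_left_mono w) (use pow_small[of 23] in simp)
  ultimately have "(1 - L ^ 23 * (u * \<kappa>)) * (\<sigma> * norm V) \<le> norm (W * V)" by (rule order_trans[rotated])
  then show ?thesis by (simp only: mult_ac)
qed


end


text \<open>dW is the backward error of the intraorthogonalization, Om and G are the computed Gram
  matrix and Cholesky argument. \<open>UU\<close> is only O(u) \<kappa>, which is all that an
  exponent \<alpha> at most 1 guarantees; the normalization has to repair this.\<close>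

locale orthogonalization_step = projection_step +
  fixes dW U Sd Y Om G :: fmat
  assumes dW: "norm dW \<le> L * u * norm W" and WU: "W + dW = U * Sd"
    and UI: "U * idm s = U" and SdI: "idm s * Sd = Sd" "Sd * idm s = Sd"
    and UU: "norm (tr U * U - idm s) \<le> L ^ 2 * (u * \<kappa>)"
    and W_low: "\<And>V. idm s * V = V \<Longrightarrow> \<sigma> / 2 * norm V \<le> norm (W * V)"
    and XN: "norm X \<le> L * (\<kappa> * \<sigma>)"
    and YI: "idm n * Y = Y" "Y * idm s = Y"
    and Y: "norm (Y - tr Q * U) \<le> L * u * (norm Q * norm U)"
    and Om: "norm (Om - tr U * U) \<le> L * u * (norm U * norm U)"
    and G: "norm (G - (Om - tr Y * Y)) \<le> L * u * (norm Om + norm Y * norm Y)"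
begin

lemma dW_le: "norm dW \<le> L ^ 6 * (u * norm X)"
  by (rule order_trans[OF dW], rule pow_mult[OF _ W_le, of _ 1 u]) auto

lemma U_near: "norm (tr U * U - idm s) \<le> 1 / 2"
  using UU pow_small[of 2] by simp

lemma U_le: "norm U \<le> L ^ 1 * 1"
  by (rule norm_near_orthonormal_le[OF UI]) (use U_near in simp)

lemma WdW_le: "norm (W + dW) \<le> L ^ 6 * norm X"
  by (rule norm_add_le[OF W_le absorb_u[OF dW_le]]) auto

lemma Sd_le: "norm Sd \<le> L ^ 8 * norm X"
proof -
  have "norm Sd \<le> 2 * norm (tr U * U * Sd)" by (rule near_identity_left[OF SdI(1) U_near])
  also have "tr U * U * Sd = tr U * (W + dW)" by (simp add: WU mult.assoc)
  also have "norm (tr U * (W + dW)) \<le> L ^ 7 * norm X"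
    by (rule norm_mult_le[of _ 1 1, OF _ WdW_le]) (use U_le in auto)
  then have "2 * norm (tr U * (W + dW)) \<le> L ^ 8 * norm X" by (rule pow_scale) auto
  finally show ?thesis .
qed

text \<open>W stretches by at least \<sigma> / 2 and dW takes away at most half of that; since U Sd
  = W + dW with U of size L, Sd itself is bounded below by \<sigma> up to powers of L.\<close>

lemma Sd_inverse:
  obtains J where "Sd * J = idm s" "norm J \<le> L ^ 3 * (1 / \<sigma>)"
proof -
  have low: "\<sigma> / 4 * norm V \<le> L * norm (Sd * V)" if V: "idm s * V = V" for V
  proof -
    have "norm dW \<le> L ^ 6 * (u * (L * (\<kappa> * \<sigma>)))"
      by (rule order_trans[OF dW_le]) (intro mult_left_mono XN, auto)
    also have "\<dots> = (L ^ (6 + 1) * (u * \<kappa>)) * \<sigma>" by (simp only: power_add power_one_right mult_ac)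
    also have "\<dots> \<le> 1 / 4 * \<sigma>"
    proof (rule mult_right_mono)
      have "2 * (L ^ 7 * (u * \<kappa>)) \<le> L ^ 8 * (u * \<kappa>)" by (rule pow_scale[OF order_refl]) auto
      moreover have "L ^ 8 * (u * \<kappa>) \<le> 1 / 2" by (rule pow_small) simp
      ultimately have "L ^ 7 * (u * \<kappa>) \<le> 1 / 4" by linarith
      then show "L ^ (6 + 1) * (u * \<kappa>) \<le> 1 / 4" by simp
    qed simp
    finally have "norm (dW * V) \<le> 1 / 4 * \<sigma> * norm V"
      by (rule order_trans[OF norm_mult_ineq mult_right_mono]) simp
    moreover have "norm (W * V) \<le> norm (U * (Sd * V)) + norm (dW * V)"
      using norm_triangle_ineq4[of "U * Sd * V" "dW * V"] unfolding WU[symmetric]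
      by (simp add: distrib_right) (simp add: WU[symmetric] mult.assoc[symmetric] distrib_right)
    moreover have "norm (U * (Sd * V)) \<le> norm U * norm (Sd * V)" by (rule norm_mult_ineq)
    moreover have "norm U * norm (Sd * V) \<le> L * norm (Sd * V)"
      by (rule mult_right_mono) (use U_le in auto)
    ultimately show ?thesis using W_low[OF V] by linarith
  qed
  have ker: "V = 0" if "idm s * V = V" "Sd * V = 0" for V
    using low[OF that(1)] that(2) \<sigma> by (simp add: mult_le_0_iff)
  obtain J where J: "idm s * J = J" "Sd * J = idm s"
    by (rule fmat_inverse[OF SdI ker])
  have "0 \<le> sqrt (real s)" by simp
  then have "norm (Sd * J) \<le> L" unfolding J norm_idm using s(3) by linarith
  then have "L * norm (Sd * J) \<le> L * L" by (intro mult_left_mono) auto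
  then have "\<sigma> * norm J \<le> 4 * (L ^ 2 * 1)" using low[OF J(1)] unfolding power2_eq_square by linarith
  also have "\<dots> \<le> L ^ 3 * 1" by (rule pow_scale[OF order_refl]) auto
  finally have "norm J \<le> L ^ 3 * (1 / \<sigma>)" using \<sigma> by (simp add: field_simps)
  then show ?thesis using that J by blast
qed

text \<open>\<open>tr Q * U\<close> is \<open>tr Q * (W + dW)\<close> times the inverse of Sd. The
  numerator is O(u) \<open>norm X\<close> and the inverse O(1 / \<sigma>); since
  \<open>norm X\<close> is at most L \<kappa> \<sigma>, exactly one \<kappa> remains.\<close>

lemma QU_le: "norm (tr Q * U) \<le> L ^ 28 * (u * \<kappa>)"
proof -
  obtain J where J: "Sd * J = idm s" "norm J \<le> L ^ 3 * (1 / \<sigma>)" by (rule Sd_inverse)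
  have "norm (tr Q * dW) \<le> L ^ 7 * (u * norm X)"
    by (rule norm_mult_le[of _ 1 1, OF _ dW_le]) (use Q_le in auto)
  then have "norm (tr Q * W + tr Q * dW) \<le> L ^ 24 * (u * norm X)"
    by (rule norm_add_le[OF QW_le]) auto
  also have "u * norm X \<le> L * (u * (\<kappa> * \<sigma>))"
    using mult_left_mono[OF XN, of u] by (simp only: nonneg mult_ac)
  then have "L ^ 24 * (u * norm X) \<le> L ^ 24 * (L * (u * (\<kappa> * \<sigma>)))" by (intro mult_left_mono) auto
  also have "\<dots> = L ^ (24 + 1) * (u * (\<kappa> * \<sigma>))" by (simp only: power_add power_one_right mult_ac)
  finally have 1: "norm (tr Q * W + tr Q * dW) \<le> L ^ 25 * (u * (\<kappa> * \<sigma>))" by simp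
  have "tr Q * U = tr Q * (U * Sd) * J" using UI by (simp add: mult.assoc J)
  also have "\<dots> = (tr Q * W + tr Q * dW) * J" by (simp only: WU[symmetric] distrib_left)
  also have "norm \<dots> \<le> L ^ 28 * (u * \<kappa>)"
    by (rule norm_mult_le[OF 1 J(2)]) auto
  finally show ?thesis .
qed

lemma QU_err: "norm (tr Q * U - Y) \<le> L ^ 3 * u"
proof -
  have "norm Q * norm U \<le> L ^ 2 * 1" by (rule pow_mult[OF Q_le U_le]) auto
  then have "(L * u) * (norm Q * norm U) \<le> L ^ 3 * u" by (intro pow_mult[of "L * u" 1 u _ 2 1]) auto
  then show ?thesis using Y unfolding norm_minus_commute[of _ Y] by linarith
qed

lemma Y_le: "norm Y \<le> L ^ 29 * (u * \<kappa>)"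
proof -
  have "norm (tr Q * U - Y) \<le> L ^ 3 * (u * \<kappa>)"
    by (rule pow_mono2[OF QU_err]) (use u_le in auto)
  from norm_diff_le[OF QU_le this, of 29] show ?thesis by simp
qed

text \<open>The most demanding use of the smallness condition: 20 powers from the orthogonality
  invariant and 29 from \<open>Y_le\<close>, which the exponent 60 in \<open>small\<close> covers
  with slack.\<close>

lemma Y_small: "L ^ 20 * norm Y \<le> 1 / 2"
proof -
  have "L ^ 20 * norm Y \<le> L ^ 60 * (1 * (u * \<kappa>))"
    by (rule pow_mult[OF _ Y_le, of _ 20 1]) auto
  then show ?thesis using small by simp
qed

lemma Y_le_1: "norm Y \<le> L ^ 0 * 1"
  using Y_small pow_mono[of 0 20 "norm Y"] by simp

lemma YY_le: "norm Y * norm Y \<le> L ^ 29 * (u * \<kappa>)"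
  by (rule pow_mult[OF Y_le Y_le_1]) auto

lemma Om_err: "norm (Om - tr U * U) \<le> L ^ 3 * u"
proof -
  have "norm U * norm U \<le> L ^ 2 * 1" by (rule pow_mult[OF U_le U_le]) auto
  then have "(L * u) * (norm U * norm U) \<le> L ^ 3 * u" by (intro pow_mult[of "L * u" 1 u _ 2 1]) auto
  then show ?thesis using Om by linarith
qed

text \<open>Two estimates for G serve different ends: this one, free of \<kappa>, carries the
  orthogonality of the new columns; \<open>G_near\<close>, with \<kappa>, keeps the Cholesky
  factorization from breaking down.\<close>

lemma G_err: "norm (G - (tr U * U - tr Y * Y)) \<le> L ^ 6 * u"
proof -
  have UU2: "norm (tr U * U) \<le> L ^ 2 * 1"
    by (rule norm_mult_le[of _ 1 1, OF _ U_le]) (use U_le in auto)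
  have "norm (Om - tr U * U) \<le> L ^ 0 * 1" using Om_err pow_u_small[of 3] by simp
  from norm_add_le[OF this UU2, of 3] have "norm Om \<le> L ^ 3 * 1" by simp
  moreover have "norm Y * norm Y \<le> L ^ 0 * 1" by (rule pow_mult[OF Y_le_1 Y_le_1]) auto
  ultimately have "norm Om + norm Y * norm Y \<le> L ^ 4 * 1" by (rule pow_add) auto
  then have "(L * u) * (norm Om + norm Y * norm Y) \<le> L ^ 5 * u" by (intro pow_mult[of "L * u" 1 u _ 4 1]) auto
  then have "norm (G - (Om - tr Y * Y)) \<le> L ^ 5 * u" using G by linarith
  from norm_add_le[OF this Om_err, of 6] show ?thesis by (simp add: algebra_simps)
qed

lemma G_near: "norm (G - idm s) \<le> L ^ 31 * (u * \<kappa>)"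
proof -
  have "norm (tr Y * Y) \<le> L ^ 29 * (u * \<kappa>)" using norm_mult_ineq[of "tr Y" Y] YY_le by simp
  from norm_diff_le[OF UU this, of 30]
  have 1: "norm ((tr U * U - idm s) - tr Y * Y) \<le> L ^ 30 * (u * \<kappa>)" by simp
  have "norm (G - (tr U * U - tr Y * Y)) \<le> L ^ 6 * (u * \<kappa>)"
    by (rule pow_mono2[OF G_err]) (use u_le in auto)
  from norm_add_le[OF this 1, of 31] show ?thesis by (simp add: algebra_simps)
qed

lemma G_near_cholesky:
  "L * u \<le> L ^ 31 * (u * \<kappa>)" "64 * real s * (L ^ 31 * (u * \<kappa>)) \<le> 1"
proof -
  show "L * u \<le> L ^ 31 * (u * \<kappa>)" using pow_mono2[of "L * u" 1 u 31 "u * \<kappa>"] u_le by simp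
  have "real s * (L ^ 31 * (u * \<kappa>)) \<le> L ^ 32 * (u * \<kappa>)"
    by (rule pow_mult[OF _ order_refl, of _ 1 1]) (use s(2) in auto)
  then have "64 * (real s * (L ^ 31 * (u * \<kappa>))) \<le> L ^ 33 * (u * \<kappa>)" by (rule pow_scale) auto
  then show "64 * real s * (L ^ 31 * (u * \<kappa>)) \<le> 1"
    using pow_small[of 33] unfolding mult.assoc[of 64 "real s"] by linarith
qed

end

text \<open>C is the computed Cholesky factor, V the block after the second projection and Qn the
  new orthonormal block. \<open>CC\<close> and \<open>C_near\<close> are the two scales of the
  Cholesky analysis.\<close>

locale normalization_step = orthogonalization_step +
  fixes C V Qn :: fmat
  assumes CI: "idm s * C = C" "C * idm s = C" and C_near: "norm (C - idm s) \<le> 1 / 2"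
    and CC: "norm (tr C * C - (tr U * U - tr Y * Y)) \<le> L ^ 8 * u"
    and QnI: "Qn * idm s = Qn"
    and V: "norm (V - (U - Q * Y)) \<le> L * u * (norm U + norm Q * norm Y)"
    and Qn: "norm (Qn * C - V) \<le> L * u * (norm V + norm C * norm Qn)"
begin

lemma C_le: "norm C \<le> L ^ 2 * 1"
proof -
  have "0 \<le> sqrt (real s)" by simp
  then have "norm (idm s) \<le> L ^ 1 * 1" unfolding norm_idm power_one_right mult_1_right using s(3) by linarith
  moreover have "norm (C - idm s) \<le> L ^ 1 * 1" using C_near L by simp
  ultimately have "norm ((C - idm s) + idm s) \<le> L ^ 2 * 1" by (intro norm_add_le[of _ 1 1 _ 1]) auto
  then show ?thesis by simp
qed

lemma V0_le: "norm (U - Q * Y) \<le> L ^ 2 * 1"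
  by (rule norm_diff_le[OF U_le norm_mult_le[OF Q_le Y_le_1, of 1]]) auto

lemma V_err: "norm (V - (U - Q * Y)) \<le> L ^ 3 * u"
proof -
  have "norm Q * norm Y \<le> L ^ 1 * 1" by (rule pow_mult[OF Q_le Y_le_1]) auto
  then have "norm U + norm Q * norm Y \<le> L ^ 2 * 1" by (rule pow_add[OF U_le]) auto
  then have "(L * u) * (norm U + norm Q * norm Y) \<le> L ^ 3 * u" by (intro pow_mult[of "L * u" 1 u _ 2 1]) auto
  then show ?thesis using V by linarith
qed

lemma V_le: "norm V \<le> L ^ 3 * 1"
proof -
  have "norm (V - (U - Q * Y)) \<le> L ^ 0 * 1" using V_err pow_u_small[of 3] by simp
  from norm_add_le[OF this V0_le, of 3] show ?thesis by simp
qed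

lemma Qn_le: "norm Qn \<le> L ^ 5 * 1"
proof -
  have 1: "norm Qn \<le> 2 * norm (Qn * C)" by (rule near_identity_right[OF QnI C_near])
  have 2: "norm (Qn * C) \<le> norm (Qn * C - V) + norm V" using norm_triangle_ineq[of "Qn * C - V" V] by simp
  \<comment> \<open>The residual of the solve involves \<open>norm Qn\<close> itself; its
    coefficient is at most 1/8, so that this term can be moved to the left-hand side.\<close>
  have 3: "L * u * norm V \<le> L ^ 3 * 1"
    by (rule pow_mult[of _ 0 1, OF _ V_le]) (use pow_u_small[of 1] in auto)
  have "L * u * norm C \<le> L ^ 3 * u" by (rule pow_mult[of _ 1 u, OF _ C_le]) auto
  then have "4 * (L * u * norm C) \<le> L ^ 4 * u" by (rule pow_scale) auto
  moreover have "L ^ 4 * u \<le> 1 / 2" by (rule pow_u_small) simp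
  ultimately have "L * u * norm C \<le> 1 / 8" by linarith
  then have "(L * u * norm C) * norm Qn \<le> 1 / 8 * norm Qn" by (rule mult_right_mono) simp
  moreover have "norm (Qn * C - V) \<le> L * u * norm V + (L * u * norm C) * norm Qn"
    using Qn by (simp only: distrib_left mult.assoc)
  ultimately have "norm Qn \<le> 8 * (L ^ 3 * 1)" using 1 2 3 V_le norm_ge_zero[of Qn] by linarith
  also have "\<dots> \<le> L ^ 5 * 1" by (rule pow_scale[OF order_refl]) auto
  finally show ?thesis .
qed

text \<open>The error is free of \<kappa>, although U is orthonormal only up to O(u) \<kappa>. The
  orthogonality, the residual and the delayed coefficients all rest on this expansion of U.\<close>

lemma U_err: "norm (Qn * C + Q * Y - U) \<le> L ^ 10 * u"
proof -
  have "norm C * norm Qn \<le> L ^ 7 * 1" by (rule pow_mult[OF C_le Qn_le]) auto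
  then have "norm V + norm C * norm Qn \<le> L ^ 8 * 1" by (rule pow_add[OF V_le]) auto
  then have "(L * u) * (norm V + norm C * norm Qn) \<le> L ^ 9 * u" by (intro pow_mult[of "L * u" 1 u _ 8 1]) auto
  then have "norm (Qn * C - V) \<le> L ^ 9 * u" using Qn by linarith
  from norm_add_le[OF this V_err, of 10] show ?thesis by (simp add: algebra_simps)
qed

text \<open>The contribution of the previous loss of orthogonality is damped by \<open>Y\<close>, which is tiny; hence
  it accumulates additively over the steps rather than multiplicatively.\<close>

lemma damped: "norm (tr Q * Q - idm n) * norm Y \<le> L ^ 0 * u"
proof -
  have "norm (tr Q * Q - idm n) * norm Y \<le> L ^ 20 * u * norm Y"
    by (rule mult_right_mono[OF orth]) simp
  also have "\<dots> = u * (L ^ 20 * norm Y)" by simp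
  also have "\<dots> \<le> u * 1"
    by (intro mult_left_mono) (use Y_small in auto)
  finally show ?thesis by simp
qed

lemma EY_le: "norm ((tr Q * Q - idm n) * Y) \<le> L ^ 0 * u"
  using damped norm_mult_ineq order_trans by blast

text \<open>Multiplying the expansion of U by \<open>tr Q\<close> leaves the rounding of Y, the
  damped old loss and the error of the expansion; C is then cancelled.\<close>

lemma QQn_le: "norm (tr Q * Qn) \<le> L ^ 13 * u"
proof -
  have 1: "norm (tr Q * (Qn * C + Q * Y - U)) \<le> L ^ 11 * u"
    by (rule norm_mult_le[of _ 1 1, OF _ U_err]) (use Q_le in auto)
  have 2: "norm ((tr Q * U - Y) - (tr Q * Q - idm n) * Y) \<le> L ^ 4 * u"
    by (rule norm_diff_le[OF QU_err EY_le]) auto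
  have "tr Q * Qn * C = ((tr Q * U - Y) - (tr Q * Q - idm n) * Y) + tr Q * (Qn * C + Q * Y - U)"
    using YI by (simp add: algebra_simps)
  then have 3: "norm (tr Q * Qn * C) \<le> L ^ 12 * u"
    using norm_add_le[OF 2 1, of 12] by simp
  have "norm (tr Q * Qn) \<le> 2 * norm (tr Q * Qn * C)"
    by (rule near_identity_right[OF _ C_near]) (simp add: mult.assoc QnI)
  also have "\<dots> \<le> L ^ 13 * u" by (rule pow_scale[OF 3]) auto
  finally show ?thesis .
qed

text \<open>The Pythagorean identity behind the Cholesky argument. With D =
  \<open>tr Q * U - Y\<close> and E = \<open>tr Q * Q - idm n\<close>, the Gram matrix of U - Q Y is
  U^T U - Y^T Y + Y^T E Y - Y^T D - D^T Y, and \<open>tr C * C\<close> matches U^T U - Y^T Y up to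
  O(u). So the O(u) \<kappa> defect of U cancels, and only small terms remain in C^T (Qn^T Qn - I)
  C.\<close>

lemma QnQn_le: "norm (tr Qn * Qn - idm s) \<le> L ^ 17 * u"
proof -
  define D where "D = tr Q * U - Y"
  define F where "F = Qn * C + Q * Y - U"
  have D: "norm D \<le> L ^ 3 * u" unfolding D_def by (rule QU_err)
  have F: "norm F \<le> L ^ 10 * u" unfolding F_def by (rule U_err)
  have F1: "norm F \<le> L ^ 0 * 1" using F pow_u_small[of 10] by simp
  have 1: "norm (tr Y * D) \<le> L ^ 3 * u" by (rule norm_mult_le[of _ 0 1, OF _ D]) (use Y_le_1 in auto)
  have 2: "norm (tr D * Y) \<le> L ^ 3 * u" by (rule norm_mult_le[of _ 3 u, OF _ Y_le_1]) (use D in auto)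
  have 3: "norm (tr Y * ((tr Q * Q - idm n) * Y)) \<le> L ^ 3 * u"
    by (rule norm_mult_le[of _ 0 1, OF _ EY_le]) (use Y_le_1 in auto)
  have 4: "norm (tr F * (U - Q * Y)) \<le> L ^ 12 * u"
    by (rule norm_mult_le[of _ 10 u, OF _ V0_le]) (use F in auto)
  have 5: "norm (tr (U - Q * Y) * F) \<le> L ^ 12 * u"
    by (rule norm_mult_le[of _ 2 1, OF _ F]) (use V0_le in \<open>auto simp: norm_tr[of "U - Q * Y"] simp del: tr_simps\<close>)
  have 6: "norm (tr F * F) \<le> L ^ 10 * u"
    by (rule norm_mult_le[of _ 0 1, OF _ F]) (use F1 in auto)
  have 7: "norm (tr Y * ((tr Q * Q - idm n) * Y) - tr Y * D - tr D * Y) \<le> L ^ 5 * u"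
    by (rule norm_diff_le[OF norm_diff_le[OF 3 1, of 4] 2]) auto
  have 8: "norm (tr F * (U - Q * Y) + tr (U - Q * Y) * F + tr F * F) \<le> L ^ 14 * u"
    by (rule norm_add_le[OF norm_add_le[OF 4 5, of 13] 6]) auto
  have "norm (((tr Y * ((tr Q * Q - idm n) * Y) - tr Y * D - tr D * Y)
      + (tr F * (U - Q * Y) + tr (U - Q * Y) * F + tr F * F)) - (tr C * C - (tr U * U - tr Y * Y))) \<le> L ^ 16 * u"
    by (rule norm_diff_le[OF norm_add_le[OF 7 8, of 15] CC]) auto
  moreover have "tr C * ((tr Qn * Qn - idm s) * C) =
     ((tr Y * ((tr Q * Q - idm n) * Y) - tr Y * D - tr D * Y)
      + (tr F * (U - Q * Y) + tr (U - Q * Y) * F + tr F * F)) - (tr C * C - (tr U * U - tr Y * Y))"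
    using YI CI unfolding D_def F_def by (simp add: algebra_simps)
  ultimately have 9: "norm (tr C * ((tr Qn * Qn - idm s) * C)) \<le> L ^ 16 * u" by simp
  have "norm (tr Qn * Qn - idm s) \<le> 2 * norm ((tr Qn * Qn - idm s) * C)"
    by (rule near_identity_right[OF _ C_near]) (simp add: left_diff_distrib mult.assoc QnI)
  also have "norm ((tr Qn * Qn - idm s) * C) \<le> 2 * norm (tr C * ((tr Qn * Qn - idm s) * C))"
  proof (rule near_identity_left)
    have "idm s * tr Qn = tr Qn" by (metis QnI tr_idm tr_times)
    then show "idm s * ((tr Qn * Qn - idm s) * C) = (tr Qn * Qn - idm s) * C"
      by (simp add: mult.assoc[symmetric] right_diff_distrib)
    show "norm (tr C - idm s) \<le> 1 / 2" using C_near by (metis norm_tr tr_idm tr_simps(3))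
  qed
  finally have "norm (tr Qn * Qn - idm s) \<le> 4 * norm (tr C * ((tr Qn * Qn - idm s) * C))" by simp
  also have "\<dots> \<le> L ^ 17 * u" by (rule pow_scale[OF 9]) auto
  finally show ?thesis .
qed

text \<open>The new border of the Gram matrix has an O(u) bound that does not grow with the old
  loss, so each step adds a fixed amount.\<close>

lemma next_orthogonality:
  "norm (tr (Q + Qn * sel n s) * (Q + Qn * sel n s) - idm (n + s))
    \<le> norm (tr Q * Q - idm n) + L ^ 18 * u"
proof -
  have QnT: "idm s * tr Qn = tr Qn" by (metis QnI tr_idm tr_times)
  let ?A = "tr Q * Qn * sel n s" and ?B = "tr (sel n s) * ((tr Qn * Qn - idm s) * sel n s)"
  have A: "norm ?A \<le> L ^ 13 * u"
    using QQn_le by (subst norm_times_sel) (simp_all add: mult.assoc QnI)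
  have A': "norm (tr ?A) \<le> L ^ 13 * u" using A by (simp only: norm_tr)
  have "norm ?B = norm ((tr Qn * Qn - idm s) * sel n s)"
    by (rule norm_tr_sel_times) (simp add: mult.assoc[symmetric] right_diff_distrib QnT)
  also have "\<dots> = norm (tr Qn * Qn - idm s)"
    by (rule norm_times_sel) (simp add: left_diff_distrib mult.assoc QnI)
  finally have B: "norm ?B \<le> L ^ 17 * u" using QnQn_le by simp
  have "norm (?A + tr ?A + ?B) \<le> L ^ 18 * u"
    by (rule norm_add_le[OF norm_add_le[OF A A', of 14] B]) auto
  moreover have "tr (Q + Qn * sel n s) * (Q + Qn * sel n s) - idm (n + s)
      = (tr Q * Q - idm n) + (?A + tr ?A + ?B)"
    by (simp add: idm_add algebra_simps)
  ultimately show ?thesis using norm_triangle_ineq[of "tr Q * Q - idm n" "?A + tr ?A + ?B"] by simp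
qed

text \<open>Eliminating W and U from W \<approx> X - Q S, W + dW = U Sd and U \<approx> Q Y + Qn C
  gives X \<approx> Q (S + Y Sd) + Qn C Sd, which are the factors formed by the algorithm. Sd is
  O(1) \<open>norm X\<close>, so no \<kappa> appears.\<close>

lemma residual:
  assumes Rc: "norm (Rc - (S + Y * Sd)) \<le> L * u * (norm S + norm Y * norm Sd)"
    and Rd: "norm (Rd - C * Sd) \<le> L * u * (norm C * norm Sd)"
  shows "norm (X - Q * Rc - Qn * Rd) \<le> L ^ 20 * (u * norm X)"
proof -
  have "norm Y * norm Sd \<le> L ^ 8 * norm X" by (rule pow_mult[OF Y_le_1 Sd_le]) auto
  then have "norm S + norm Y * norm Sd \<le> L ^ 9 * norm X" by (rule pow_add[OF S_le]) auto
  then have "(L * u) * (norm S + norm Y * norm Sd) \<le> L ^ 10 * (u * norm X)"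
    by (intro pow_mult[of "L * u" 1 u _ 9 "norm X"]) auto
  then have rc: "norm (Rc - (S + Y * Sd)) \<le> L ^ 10 * (u * norm X)" using Rc by linarith
  have "norm C * norm Sd \<le> L ^ 10 * norm X" by (rule pow_mult[OF C_le Sd_le]) auto
  then have "(L * u) * (norm C * norm Sd) \<le> L ^ 11 * (u * norm X)"
    by (intro pow_mult[of "L * u" 1 u _ 10 "norm X"]) auto
  then have rd: "norm (Rd - C * Sd) \<le> L ^ 11 * (u * norm X)" using Rd by linarith
  have 1: "norm (Q * (Rc - (S + Y * Sd))) \<le> L ^ 11 * (u * norm X)"
    by (rule norm_mult_le[OF Q_le rc]) auto
  have 2: "norm (Qn * (Rd - C * Sd)) \<le> L ^ 16 * (u * norm X)"
    by (rule norm_mult_le[OF Qn_le rd]) auto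
  have 3: "norm ((Qn * C + Q * Y - U) * Sd) \<le> L ^ 18 * (u * norm X)"
    by (rule norm_mult_le[OF U_err Sd_le]) auto
  have 4: "norm (Q * (Rc - (S + Y * Sd)) + Qn * (Rd - C * Sd)) \<le> L ^ 17 * (u * norm X)"
    by (rule norm_add_le[OF 1 2]) auto
  have 5: "norm (dW + (W - (X - Q * S))) \<le> L ^ 7 * (u * norm X)"
    by (rule norm_add_le[OF dW_le W_err]) auto
  have "norm ((Q * (Rc - (S + Y * Sd)) + Qn * (Rd - C * Sd)) + (Qn * C + Q * Y - U) * Sd
      + (dW + (W - (X - Q * S)))) \<le> L ^ 20 * (u * norm X)"
    by (rule norm_add_le[OF norm_add_le[OF 4 3, of 19] 5]) auto
  moreover have "- (X - Q * Rc - Qn * Rd) = (Q * (Rc - (S + Y * Sd)) + Qn * (Rd - C * Sd))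
      + (Qn * C + Q * Y - U) * Sd + (dW + (W - (X - Q * S)))"
    using WU by (simp add: algebra_simps)
  ultimately show ?thesis by (metis norm_minus_cancel)
qed

text \<open>Why the delayed coefficients are correct: P - Y^T Z is close to (U - Q Y)^T X', hence to
  C^T Qn^T X' by the expansion of U, and the triangular solve removes C^T.\<close>

lemma next_coefficients:
  assumes Z: "norm (Z - tr Q * X') \<le> L * u * (norm Q * norm X')"
    and P: "norm (P - tr U * X') \<le> L * u * (norm U * norm X')"
    and T: "norm (T - (P - tr Y * Z)) \<le> L * u * (norm P + norm Y * norm Z)"
    and S': "norm (tr C * S' - T) \<le> L * u * (norm T + norm C * norm S')" and SI': "idm s * S' = S'"
  shows "norm (Z + tr (sel n s) * S' - tr (Q + Qn * sel n s) * X') \<le> L ^ 16 * (u * norm X')"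
proof -
  have QnT: "idm s * tr Qn = tr Qn" by (metis QnI tr_idm tr_times)
  have "norm Q * norm X' \<le> L ^ 1 * norm X'" by (rule pow_mult[OF Q_le, of _ 0]) auto
  then have "(L * u) * (norm Q * norm X') \<le> L ^ 2 * (u * norm X')"
    by (intro pow_mult[of "L * u" 1 u _ 1 "norm X'"]) auto
  then have z: "norm (Z - tr Q * X') \<le> L ^ 2 * (u * norm X')" using Z by linarith
  have "norm U * norm X' \<le> L ^ 1 * norm X'" by (rule pow_mult[OF U_le, of _ 0]) auto
  then have "(L * u) * (norm U * norm X') \<le> L ^ 2 * (u * norm X')"
    by (intro pow_mult[of "L * u" 1 u _ 1 "norm X'"]) auto
  then have p: "norm (P - tr U * X') \<le> L ^ 2 * (u * norm X')" using P by linarith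
  have QX: "norm (tr Q * X') \<le> L ^ 1 * norm X'"
    by (rule norm_mult_le[of _ 1 1 _ 0 "norm X'"]) (use Q_le in auto)
  have UX: "norm (tr U * X') \<le> L ^ 1 * norm X'"
    by (rule norm_mult_le[of _ 1 1 _ 0 "norm X'"]) (use U_le in auto)
  have zn: "norm Z \<le> L ^ 2 * norm X'" using norm_add_le[OF absorb_u[OF z] QX, of 2] by simp
  have pn: "norm P \<le> L ^ 2 * norm X'" using norm_add_le[OF absorb_u[OF p] UX, of 2] by simp
  have "norm Y * norm Z \<le> L ^ 2 * norm X'" by (rule pow_mult[OF Y_le_1 zn]) auto
  then have "norm P + norm Y * norm Z \<le> L ^ 3 * norm X'" by (rule pow_add[OF pn]) auto
  then have "(L * u) * (norm P + norm Y * norm Z) \<le> L ^ 4 * (u * norm X')"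
    by (intro pow_mult[of "L * u" 1 u _ 3 "norm X'"]) auto
  then have t: "norm (T - (P - tr Y * Z)) \<le> L ^ 4 * (u * norm X')" using T by linarith
  have 1: "norm (tr Y * (Z - tr Q * X')) \<le> L ^ 2 * (u * norm X')"
    by (rule norm_mult_le[of _ 0 1, OF _ z]) (use Y_le_1 in auto)
  have "norm (tr (Qn * C + Q * Y - U)) \<le> L ^ 10 * u" using U_err by (simp only: norm_tr)
  then have 2: "norm (tr (Qn * C + Q * Y - U) * X') \<le> L ^ 10 * (u * norm X')"
    by (rule norm_mult_le[of _ _ _ _ 0 "norm X'"]) auto
  have 3: "norm ((T - (P - tr Y * Z)) + (P - tr U * X')) \<le> L ^ 5 * (u * norm X')"
    by (rule norm_add_le[OF t p]) auto
  have "norm ((T - (P - tr Y * Z)) + (P - tr U * X') - tr Y * (Z - tr Q * X')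
      - tr (Qn * C + Q * Y - U) * X') \<le> L ^ 11 * (u * norm X')"
    by (rule norm_diff_le[OF norm_diff_le[OF 3 1, of 6] 2]) auto
  moreover have "(T - (P - tr Y * Z)) + (P - tr U * X') - tr Y * (Z - tr Q * X')
      - tr (Qn * C + Q * Y - U) * X' = T - tr C * (tr Qn * X')"
    by (simp add: algebra_simps)
  ultimately have t2: "norm (T - tr C * (tr Qn * X')) \<le> L ^ 11 * (u * norm X')" by (simp only:)
  have QnX: "norm (tr Qn * X') \<le> L ^ 5 * norm X'"
    by (rule norm_mult_le[of _ 5 1 _ 0 "norm X'"]) (use Qn_le in auto)
  have "norm (tr C * (tr Qn * X')) \<le> L ^ 7 * norm X'"
    by (rule norm_mult_le[of _ 2 1, OF _ QnX]) (use C_le in auto)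
  from norm_add_le[OF absorb_u[OF t2] this, of 8] have tn: "norm T \<le> L ^ 8 * norm X'" by simp
  have tC: "norm (tr C - idm s) \<le> 1 / 2" using C_near by (metis norm_tr tr_idm tr_simps(3))
  have s1: "norm S' \<le> 2 * norm (tr C * S')" by (rule near_identity_left[OF SI' tC])
  have s2: "norm (tr C * S') \<le> norm (tr C * S' - T) + norm T"
    using norm_triangle_ineq[of "tr C * S' - T" T] by simp
  have s3: "L * u * norm T \<le> L ^ 8 * norm X'"
    by (rule pow_mult[of _ 0 1, OF _ tn]) (use pow_u_small[of 1] in auto)
  \<comment> \<open>As for Qn, the residual of the solve contains the norm of the unknown S'; with
    coefficient at most 1/8 it is absorbed.\<close>
  have "L * u * norm C \<le> L ^ 3 * u" by (rule pow_mult[of _ 1 u, OF _ C_le]) auto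
  then have "4 * (L * u * norm C) \<le> L ^ 4 * u" by (rule pow_scale) auto
  moreover have "L ^ 4 * u \<le> 1 / 2" by (rule pow_u_small) simp
  ultimately have "L * u * norm C \<le> 1 / 8" by linarith
  then have s4: "(L * u * norm C) * norm S' \<le> 1 / 8 * norm S'" by (rule mult_right_mono) simp
  have "norm (tr C * S' - T) \<le> L * u * norm T + (L * u * norm C) * norm S'"
    using S' by (simp only: distrib_left mult.assoc)
  then have "norm S' \<le> 8 * (L ^ 8 * norm X')" using s1 s2 s3 s4 tn norm_ge_zero[of S'] by linarith
  also have "\<dots> \<le> L ^ 9 * norm X'" by (rule pow_scale[OF order_refl]) auto
  finally have sn: "norm S' \<le> L ^ 9 * norm X'" .
  have "norm C * norm S' \<le> L ^ 11 * norm X'" by (rule pow_mult[OF C_le sn]) auto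
  then have "norm T + norm C * norm S' \<le> L ^ 12 * norm X'" by (rule pow_add[OF tn]) auto
  then have "(L * u) * (norm T + norm C * norm S') \<le> L ^ 13 * (u * norm X')"
    by (intro pow_mult[of "L * u" 1 u _ 12 "norm X'"]) auto
  then have "norm (tr C * S' - T) \<le> L ^ 13 * (u * norm X')" using S' by linarith
  from norm_add_le[OF this t2, of 14]
  have 4: "norm (tr C * (S' - tr Qn * X')) \<le> L ^ 14 * (u * norm X')" by (simp add: algebra_simps)
  have SQ: "idm s * (S' - tr Qn * X') = S' - tr Qn * X'"
    by (simp add: right_diff_distrib SI' mult.assoc[symmetric] QnT)
  have "norm (tr (sel n s) * (S' - tr Qn * X')) = norm (S' - tr Qn * X')"
    by (rule norm_tr_sel_times[OF SQ])
  also have "\<dots> \<le> 2 * norm (tr C * (S' - tr Qn * X'))"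
    by (rule near_identity_left[OF SQ tC])
  also have "\<dots> \<le> L ^ 15 * (u * norm X')" by (rule pow_scale[OF 4]) auto
  finally have "norm ((Z - tr Q * X') + tr (sel n s) * (S' - tr Qn * X')) \<le> L ^ 16 * (u * norm X')"
    by (intro norm_add_le[OF z, of _ 15]) auto
  then show ?thesis by (simp add: algebra_simps)
qed

end

section \<open>Induction over the block columns\<close>

lemma idm_add_left: "idm n * V = V \<Longrightarrow> idm (n + s) * V = V"
  by (metis idm_add_mult_idm(1) mult.assoc)

lemma idm_add_stack: "idm n * Z = Z \<Longrightarrow> idm (n + s) * (Z + tr (sel n s) * V) = Z + tr (sel n s) * V"
proof -
  have "idm (n + s) * tr (sel n s) = tr (sel n s)" by (metis sel_idm(2) tr_idm tr_times)
  then show "idm n * Z = Z \<Longrightarrow> ?thesis"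
    by (simp add: distrib_left idm_add_left mult.assoc[symmetric])
qed

lemma sel_times_zero: "idm n * V = V \<Longrightarrow> sel n s * V = 0"
  by (metis mult.assoc mult_zero_left sel_idm(1))

lemma times_tr_sel_zero: "A * idm n = A \<Longrightarrow> A * tr (sel n s) = 0"
  by (metis idm_tr_sel(1) mult.assoc mult_zero_right)

lemma norm_append_cols:
  assumes "A * idm n = A" "B * idm s = B"
  shows "(norm (A + B * sel n s))\<^sup>2 = (norm A)\<^sup>2 + (norm B)\<^sup>2"
proof -
  have "inner (B * sel n s) A = 0"
    using inner_times_right[of B "sel n s" A] times_tr_sel_zero[OF assms(1)] by simp
  then have "(norm (A + B * sel n s))\<^sup>2 = (norm A)\<^sup>2 + (norm (B * sel n s))\<^sup>2"
    by (simp add: power2_norm_eq_inner inner_add_left inner_add_right inner_commute[of A "B * sel n s"])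
  then show ?thesis by (simp add: norm_times_sel[OF assms(2)])
qed

lemma norm_append_rows:
  assumes "idm n * A = A" "idm s * B = B"
  shows "(norm (A + tr (sel n s) * B))\<^sup>2 = (norm A)\<^sup>2 + (norm B)\<^sup>2"
proof -
  have "tr A * idm n = tr A" "tr B * idm s = tr B" using assms by (metis tr_idm tr_times)+
  from norm_append_cols[OF this] have "(norm (tr (tr A + tr B * sel n s)))\<^sup>2 = (norm A)\<^sup>2 + (norm B)\<^sup>2"
    by (simp only: norm_tr)
  then show ?thesis by simp
qed

lemma sqrt_sum_ge: "c\<^sup>2 = a\<^sup>2 + b\<^sup>2 \<Longrightarrow> 0 \<le> c \<Longrightarrow> a \<le> c \<and> b \<le> (c::real)"
  by (metis add.commute le_add_same_cancel1 power2_le_imp_le zero_le_power2)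

text \<open>In the application \<sigma> and \<kappa> \<sigma> are the least and greatest singular
  value of all columns together. They serve as common bounds for all leading blocks, so one \<kappa>
  is used in every step.\<close>

locale block_columns = rounding_scale +
  fixes m p :: nat and X :: "nat \<Rightarrow> real mat"
  assumes X: "\<And>j. j \<in> {1..p} \<Longrightarrow> X j \<in> carrier_mat m s"
    and low: "\<And>V. idm (p * s) * V = V \<Longrightarrow> \<sigma> * norm V \<le> norm (emb (block_row m X p) * V)"
    and up: "\<And>V. idm (p * s) * V = V \<Longrightarrow> norm (emb (block_row m X p) * V) \<le> \<kappa> * \<sigma> * norm V"
begin

lemma block_row_carrier:
  assumes "\<And>j. j \<in> {1..k} \<Longrightarrow> B j \<in> carrier_mat m s"
  shows "block_row m B k \<in> carrier_mat m (k * s)"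
  using assms
proof (induction k)
  case (Suc k)
  then have "block_row m B k @\<^sub>c B (Suc k) \<in> carrier_mat m (k * s + s)"
    by (intro append_cols_carrier) auto
  then show ?case by (simp add: add.commute)
qed simp

lemma X_row: "k \<le> p \<Longrightarrow> block_row m X k \<in> carrier_mat m (k * s)"
  by (rule block_row_carrier) (use X in auto)

lemma emb_X_row_Suc:
  assumes "k < p"
  shows "emb (block_row m X (k + 1)) = emb (block_row m X k) + emb (X (k + 1)) * sel (k * s) s"
  using emb_append_cols[OF X_row[of k] X[of "k + 1"]] assms by simp

text \<open>Downward induction from all columns: padding V with zero rows changes neither its norm
  nor its image.\<close>

lemma X_row_bounds:
  assumes "k \<le> p" "idm (k * s) * V = V"
  shows "\<sigma> * norm V \<le> norm (emb (block_row m X k) * V)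
    \<and> norm (emb (block_row m X k) * V) \<le> \<kappa> * \<sigma> * norm V"
  using assms
proof (induction k rule: inc_induct)
  case base
  then show ?case using low up by blast
next
  case (step k)
  have V: "idm (Suc k * s) * V = V" using idm_add_left[OF step.prems, of s] by (simp add: add.commute)
  have "emb (block_row m X (Suc k)) * V = emb (block_row m X k) * V"
    using emb_X_row_Suc[OF step.hyps(2)] sel_times_zero[OF step.prems]
    by (simp add: distrib_right mult.assoc)
  then show ?case using step.IH[OF V] by simp
qed

text \<open>All three bounds come from the leading k + 1 blocks applied to -H stacked on V, whose
  norm is at least that of either part.\<close>

lemma block_bounds:
  assumes k: "k < p"
  shows "idm s * V = V \<Longrightarrow> idm (k * s) * H = H \<Longrightarrow>
      \<sigma> * norm V \<le> norm (emb (X (k + 1)) * V - emb (block_row m X k) * H)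
      \<and> \<sigma> * norm H \<le> norm (emb (X (k + 1)) * V - emb (block_row m X k) * H)"
    and "idm s * V = V \<Longrightarrow> norm (emb (X (k + 1)) * V) \<le> \<kappa> * \<sigma> * norm V"
    and "norm (emb (X (k + 1))) \<le> L * (\<kappa> * \<sigma>)"
proof -
  let ?n = "k * s" and ?x = "emb (X (k + 1))" and ?X = "emb (block_row m X k)"
  have Xc: "?X * idm ?n = ?X" using emb_carrier[OF X_row[of k]] k by simp
  have xc: "?x * idm s = ?x" using emb_carrier[OF X[of "k + 1"]] k by simp
  have main: "norm V \<le> norm (- H + tr (sel ?n s) * V) \<and> norm H \<le> norm (- H + tr (sel ?n s) * V) \<and>
      \<sigma> * norm (- H + tr (sel ?n s) * V) \<le> norm (?x * V - ?X * H) \<and>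
      norm (?x * V - ?X * H) \<le> \<kappa> * \<sigma> * norm (- H + tr (sel ?n s) * V)"
    if V: "idm s * V = V" and H: "idm ?n * H = H" for V H
  proof -
    have mH: "idm ?n * (- H) = - H" using H by simp
    let ?T = "- H + tr (sel ?n s) * V"
    have "idm (Suc k * s) * ?T = ?T" using idm_add_stack[OF mH, of s] by (simp add: add.commute)
    moreover have "emb (block_row m X (Suc k)) * ?T = ?x * V - ?X * H"
    proof -
      have "?x * sel ?n s * H = 0" using sel_times_zero[OF H] by (simp add: mult.assoc)
      moreover have "?X * (tr (sel ?n s) * V) = 0"
        using times_tr_sel_zero[OF Xc] by (simp add: mult.assoc[symmetric])
      moreover have "?x * sel ?n s * (tr (sel ?n s) * V) = ?x * V"
        by (metis V mult.assoc sel_tr_sel)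
      ultimately show ?thesis
        using emb_X_row_Suc[OF k] by (simp add: distrib_left distrib_right right_diff_distrib)
    qed
    moreover have "(norm ?T)\<^sup>2 = (norm (- H))\<^sup>2 + (norm V)\<^sup>2" by (rule norm_append_rows[OF mH V])
    ultimately show ?thesis
      using X_row_bounds[of "Suc k" ?T] k sqrt_sum_ge[of "norm ?T" "norm (- H)" "norm V"] by simp
  qed
  show "\<sigma> * norm V \<le> norm (?x * V - ?X * H) \<and> \<sigma> * norm H \<le> norm (?x * V - ?X * H)"
    if "idm s * V = V" "idm ?n * H = H" for V H
    using main[OF that] mult_left_mono[of "norm V" _ \<sigma>] mult_left_mono[of "norm H" _ \<sigma>]
    by (meson nonneg(4) order_trans)
  have up1: "norm (?x * V) \<le> \<kappa> * \<sigma> * norm V" if "idm s * V = V" for V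
    using main[OF that, of 0] norm_tr_sel_times[OF that] by simp
  then show "idm s * V = V \<Longrightarrow> norm (?x * V) \<le> \<kappa> * \<sigma> * norm V" .
  have "0 \<le> sqrt (real s)" by simp
  then have "sqrt (real s) \<le> L" using s(3) by linarith
  \<comment> \<open>Applying the operator bound to \<open>idm s\<close> gives the Frobenius norm of
    the block itself, at the price of sqrt s.\<close>
  then have "\<kappa> * \<sigma> * norm (idm s) \<le> \<kappa> * \<sigma> * L" by (intro mult_left_mono) (auto simp: norm_idm)
  then show "norm ?x \<le> L * (\<kappa> * \<sigma>)" 
    using order_trans[OF up1[OF idm_idm]] unfolding xc by (simp only: mult_ac)
qed

end

text \<open>The hypothesis on the second intraorthogonalization is restated with exactly the bounds
  that \<open>W_lower\<close> and \<open>W_upper\<close> deliver, which hides condition numbers and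
  the exponent \<alpha>. \<open>gam\<close> covers all inner product lengths that occur.\<close>

locale bcgs_run = block_columns +
  fixes Q Rc Rd S Sd U Y Yd \<Omega> Z P :: "nat \<Rightarrow> real mat"
    and IO\<^sub>1 :: "real mat \<Rightarrow> real mat \<times> real mat"
  assumes gam: "\<And>n. n \<le> m \<or> n \<le> p * s \<Longrightarrow> (1 + u) ^ (n + 2) - 1 \<le> L * u"
    and p: "real p \<le> L" "2 * sqrt (real (p * s)) \<le> L"
    and init: "Q 1 \<in> carrier_mat m s" "Rd 1 \<in> carrier_mat s s"
      "norm (tr (emb (Q 1)) * emb (Q 1) - idm s) \<le> L ^ 18 * u"
      "norm (emb (X 1) - emb (Q 1) * emb (Rd 1)) \<le> L ^ 20 * (u * norm (emb (X 1)))"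
    and S2: "2 \<le> p \<Longrightarrow> fl_mult u (Q 1)\<^sup>T (X 2) (S 2)"
    and IO\<^sub>1: "\<And>W U' R'. W \<in> carrier_mat m s \<Longrightarrow>
      (\<And>V. idm s * V = V \<Longrightarrow> \<sigma> * (1 - L ^ 23 * (u * \<kappa>)) * norm V \<le> norm (emb W * V)) \<Longrightarrow>
      (\<And>V. idm s * V = V \<Longrightarrow> norm (emb W * V) \<le> \<kappa> * \<sigma> * (1 + L ^ 19 * u) * norm V) \<Longrightarrow>
      IO\<^sub>1 W = (U', R') \<Longrightarrow> U' \<in> carrier_mat m s \<and> R' \<in> carrier_mat s s \<and>
        (\<exists>dW. emb W + dW = emb U' * emb R' \<and> norm dW \<le> L * u * norm (emb W)) \<and>
        norm (tr (emb U') * emb U' - idm s) \<le> L ^ 2 * (u * \<kappa>)"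
    and coefficients: "\<And>k. k \<in> {1..<p} \<Longrightarrow> 2 \<le> k \<Longrightarrow> \<exists>T S'.
      fl_add_mult u (P k) (- (Y k)\<^sup>T) (Z (k - 1)) T \<and> fl_forward_subst u (Yd k)\<^sup>T T S' \<and>
      S (k + 1) = Z (k - 1) @\<^sub>r S'"
    and projection: "\<And>k. k \<in> {1..<p} \<Longrightarrow> \<exists>W.
      fl_add_mult u (X (k + 1)) (- block_row m Q k) (S (k + 1)) W \<and> IO\<^sub>1 W = (U (k + 1), Sd (k + 1))"
    and products: "\<And>k. k \<in> {1..<p} \<Longrightarrow> fl_mult u (block_row m Q k)\<^sup>T (U (k + 1)) (Y (k + 1)) \<and>
      fl_mult u (U (k + 1))\<^sup>T (U (k + 1)) (\<Omega> (k + 1))"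
    and lookahead: "\<And>k. k \<in> {1..<p} \<Longrightarrow> k < p - 1 \<Longrightarrow>
      fl_mult u (block_row m Q k)\<^sup>T (X (k + 2)) (Z k) \<and> fl_mult u (U (k + 1))\<^sup>T (X (k + 2)) (P (k + 1))"
    and cholesky: "\<And>k. k \<in> {1..<p} \<Longrightarrow> \<exists>G.
      fl_add_mult u (\<Omega> (k + 1)) (- (Y (k + 1))\<^sup>T) (Y (k + 1)) G \<and> fl_chol u G (Yd (k + 1))"
    and normalization: "\<And>k. k \<in> {1..<p} \<Longrightarrow> \<exists>V.
      fl_add_mult u (U (k + 1)) (- block_row m Q k) (Y (k + 1)) V \<and>
      fl_forward_subst u (Yd (k + 1))\<^sup>T V\<^sup>T (Q (k + 1))\<^sup>T"
    and factors: "\<And>k. k \<in> {1..<p} \<Longrightarrow>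
      fl_add_mult u (S (k + 1)) (Y (k + 1)) (Sd (k + 1)) (Rc (k + 1)) \<and>
      fl_mult u (Yd (k + 1)) (Sd (k + 1)) (Rd (k + 1))"
begin

lemma gam_m: "(1 + u) ^ (m + 2) - 1 \<le> L * u"
  by (rule gam) simp

lemma gam_n: "k \<le> p \<Longrightarrow> (1 + u) ^ (k * s + 2) - 1 \<le> L * u"
  by (rule gam) simp

text \<open>The coefficients S of the next block belong to the invariant because they are computed
  from quantities of the current step. The loss of orthogonality is counted as k equal increments
  and the residual as a sum over blocks, so both grow additively.\<close>

definition accurate :: "nat \<Rightarrow> bool" where
  "accurate k \<longleftrightarrow> block_row m Q k \<in> carrier_mat m (k * s) \<and>
    block_upper Rc Rd k \<in> carrier_mat (k * s) (k * s) \<and>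
    norm (tr (emb (block_row m Q k)) * emb (block_row m Q k) - idm (k * s)) \<le> real k * (L ^ 18 * u) \<and>
    norm (emb (block_row m X k) - emb (block_row m Q k) * emb (block_upper Rc Rd k))
      \<le> (\<Sum>j = 1..k. L ^ 20 * (u * norm (emb (X j)))) \<and>
    (k < p \<longrightarrow> S (k + 1) \<in> carrier_mat (k * s) s \<and>
      norm (emb (S (k + 1)) - tr (emb (block_row m Q k)) * emb (X (k + 1))) \<le> L ^ 16 * (u * norm (emb (X (k + 1)))))"

lemma block_row_1: "B 1 \<in> carrier_mat m s \<Longrightarrow> block_row m B 1 = B 1"
  by (intro eq_matI) (auto simp: append_cols_def)

lemma accurate_1:
  assumes "1 \<le> p"
  shows "accurate 1"
proof -
  have Xr: "block_row m X 1 = X 1" and Qr: "block_row m Q 1 = Q 1"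
    using block_row_1 X init assms by auto
  have Rr: "block_upper Rc Rd 1 = Rd 1" using init(2) by (intro eq_matI) auto
  have "S 2 \<in> carrier_mat s s \<and> norm (emb (S 2) - tr (emb (Q 1)) * emb (X 2)) \<le> L ^ 16 * (u * norm (emb (X 2)))"
    if p2: "1 < p"
  proof -
    have fl: "fl_mult u (Q 1)\<^sup>T (X 2) (S 2)" using S2 p2 by simp
    have c: "(Q 1)\<^sup>T \<in> carrier_mat s m" "X 2 \<in> carrier_mat m s" using init X[of 2] p2 by auto
    note S = fl_mult_error[OF fl c nonneg(2) gam_m]
    have "L * u * (norm (emb (Q 1)) * norm (emb (X 2))) \<le> L ^ 16 * (u * norm (emb (X 2)))"
    proof -
      have "emb (Q 1) * idm s = emb (Q 1)" using emb_carrier[OF init(1)] by simp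
      then have "norm (emb (Q 1)) \<le> L ^ 1 * 1"
        by (rule norm_near_orthonormal_le) (use init(3) pow_u_small[of 18] in simp)
      then have "norm (emb (Q 1)) * norm (emb (X 2)) \<le> L ^ 1 * norm (emb (X 2))"
        by (rule pow_mult[of _ _ _ _ 0 "norm (emb (X 2))"]) auto
      then show ?thesis by (intro pow_mult[of "L * u" 1 u _ 1 "norm (emb (X 2))"]) auto
    qed
    with S(2) show ?thesis using S(1) unfolding emb_transpose norm_tr by (meson order_trans)
  qed
  then show ?thesis
    unfolding accurate_def Xr Qr Rr using init by (simp add: numeral_2_eq_2)
qed

lemma accurate_Suc:
  assumes k: "1 \<le> k" "k < p" and acc: "accurate k"
  shows "accurate (k + 1)"
proof -
  let ?n = "k * s" and ?Qk = "block_row m Q k" and ?Rk = "block_upper Rc Rd k"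
  let ?q = "emb ?Qk" and ?x = "emb (X (k + 1))" and ?X = "emb (block_row m X k)"
  have kp: "k \<in> {1..<p}" using k by simp
  have Qk: "?Qk \<in> carrier_mat m ?n" and Rk: "?Rk \<in> carrier_mat ?n ?n"
    and orth: "norm (tr ?q * ?q - idm ?n) \<le> real k * (L ^ 18 * u)"
    and res: "norm (?X - ?q * emb ?Rk) \<le> (\<Sum>j = 1..k. L ^ 20 * (u * norm (emb (X j))))"
    and Sc: "S (k + 1) \<in> carrier_mat ?n s"
    and Serr: "norm (emb (S (k + 1)) - tr ?q * ?x) \<le> L ^ 16 * (u * norm ?x)"
    using acc k unfolding accurate_def by auto
  have xc: "X (k + 1) \<in> carrier_mat m s" using X k by simp
  have gn: "(1 + u) ^ (?n + 2) - 1 \<le> L * u" using gam_n k by simp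
  have gs: "(1 + u) ^ (s + 2) - 1 \<le> L * u" using gam_n[of 1] k by simp
  have mQk: "- ?Qk \<in> carrier_mat m ?n" and QkT: "?Qk\<^sup>T \<in> carrier_mat ?n m" using Qk by auto
  obtain W where W: "fl_add_mult u (X (k + 1)) (- ?Qk) (S (k + 1)) W"
    and IO: "IO\<^sub>1 W = (U (k + 1), Sd (k + 1))" using projection[OF kp] by blast
  note Wf = fl_add_mult_error[OF W xc mQk Sc nonneg(2) gn]
  have kL: "real k \<le> L" using k p(1) by simp
  \<comment> \<open>The number of steps is at most L, so the accumulated loss costs one more power
    only.\<close>
  have orth20: "norm (tr ?q * ?q - idm ?n) \<le> L ^ 20 * u"
    by (rule order_trans[OF orth], rule pow_mult[of "real k" 1 1 _ 18 u]) (use kL in auto)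
  have "sqrt (real ?n) \<le> sqrt (real (p * s))" using k by (simp add: mult_right_mono)
  then have nL: "2 * sqrt (real ?n) \<le> L" using p(2) by linarith
  interpret PS: projection_step L u \<kappa> \<sigma> s ?n ?q ?x "emb (S (k + 1))" "emb W"
    using emb_carrier[OF Qk] emb_carrier[OF Sc] emb_carrier[OF xc] emb_carrier[OF Wf(1)] nL orth20 Serr Wf(2)
    by unfold_locales simp_all
  \<comment> \<open>One power for the size of each block in terms of \<kappa> \<sigma> and one for
    the number of blocks are added to the exponent 20.\<close>
  have res22: "norm (?X - ?q * emb ?Rk) \<le> L ^ 22 * (u * (\<kappa> * \<sigma>))"
  proof -
    have "(\<Sum>j = 1..k. L ^ 20 * (u * norm (emb (X j)))) \<le> (\<Sum>j = 1..k. L ^ 21 * (u * (\<kappa> * \<sigma>)))"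
    proof (rule sum_mono)
      fix j assume j: "j \<in> {1..k}"
      have "j - 1 < p" "j - 1 + 1 = j" using j k by auto
      from block_bounds(3)[OF this(1), unfolded this(2)]
      have "norm (emb (X j)) \<le> L ^ 1 * (\<kappa> * \<sigma>)" by simp
      then have "u * norm (emb (X j)) \<le> L ^ 1 * (u * (\<kappa> * \<sigma>))" by (intro pow_mult[of u 0 u _ 1 "\<kappa> * \<sigma>"]) auto
      then show "L ^ 20 * (u * norm (emb (X j))) \<le> L ^ 21 * (u * (\<kappa> * \<sigma>))"
        by (intro pow_mult[of "L ^ 20" 20 1 _ 1 "u * (\<kappa> * \<sigma>)"]) auto
    qed
    also have "\<dots> = real k * (L ^ 21 * (u * (\<kappa> * \<sigma>)))" by simp
    also have "\<dots> \<le> L ^ 22 * (u * (\<kappa> * \<sigma>))"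
      by (rule pow_mult[of "real k" 1 1, OF _ order_refl]) (use kL in auto)
    finally show ?thesis using res by linarith
  qed
  have W_low: "\<sigma> * (1 - L ^ 23 * (u * \<kappa>)) * norm V \<le> norm (emb W * V)" if "idm s * V = V" for V
  proof (rule PS.W_lower[OF block_bounds(1)[OF k(2)] _ emb_carrier[OF Rk] res22 block_bounds(3)[OF k(2)] that])
    show "\<sigma> * norm Z \<le> norm (?X * Z)" if "idm ?n * Z = Z" for Z
      using X_row_bounds[of k Z] k that by simp
  qed
  have W_up: "norm (emb W * V) \<le> \<kappa> * \<sigma> * (1 + L ^ 19 * u) * norm V" if "idm s * V = V" for V
    by (rule PS.W_upper[OF block_bounds(2)[OF k(2) that] block_bounds(3)[OF k(2)]])
  obtain dW where Uc: "U (k + 1) \<in> carrier_mat m s" and Sdc: "Sd (k + 1) \<in> carrier_mat s s"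
    and WU: "emb W + dW = emb (U (k + 1)) * emb (Sd (k + 1))" and dW: "norm dW \<le> L * u * norm (emb W)"
    and UU: "norm (tr (emb (U (k + 1))) * emb (U (k + 1)) - idm s) \<le> L ^ 2 * (u * \<kappa>)"
    using IO\<^sub>1[OF Wf(1) W_low W_up IO] by blast
  have W_low2: "\<sigma> / 2 * norm V \<le> norm (emb W * V)" if "idm s * V = V" for V
  proof -
    have "1 / 2 \<le> 1 - L ^ 23 * (u * \<kappa>)" using pow_small[of 23] by simp
    then have "\<sigma> * (1 / 2) * norm V \<le> \<sigma> * (1 - L ^ 23 * (u * \<kappa>)) * norm V"
      by (intro mult_right_mono mult_left_mono) auto
    also have "\<dots> \<le> norm (emb W * V)" by (rule W_low[OF that])
    finally show ?thesis by simp
  qed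
  have UcT: "(U (k + 1))\<^sup>T \<in> carrier_mat s m" using Uc by simp
  note Yf = fl_mult_error[OF conjunct1[OF products[OF kp]] QkT Uc nonneg(2) gam_m]
  note Omf = fl_mult_error[OF conjunct2[OF products[OF kp]] UcT Uc nonneg(2) gam_m]
  have mYT: "- (Y (k + 1))\<^sup>T \<in> carrier_mat s ?n" using Yf(1) by simp
  obtain G where G: "fl_add_mult u (\<Omega> (k + 1)) (- (Y (k + 1))\<^sup>T) (Y (k + 1)) G"
    and chol: "fl_chol u G (Yd (k + 1))" using cholesky[OF kp] by blast
  note Gf = fl_add_mult_error[OF G Omf(1) mYT Yf(1) nonneg(2) gn]
  interpret OS: orthogonalization_step L u \<kappa> \<sigma> s ?n ?q ?x "emb (S (k + 1))" "emb W" dW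
    "emb (U (k + 1))" "emb (Sd (k + 1))" "emb (Y (k + 1))" "emb (\<Omega> (k + 1))" "emb G"
    using dW WU UU W_low2 emb_carrier[OF Uc] emb_carrier[OF Sdc] emb_carrier[OF Yf(1)] Yf(2) Omf(2) Gf(2)
      block_bounds(3)[OF k(2)]
    by unfold_locales simp_all
  \<comment> \<open>Here g is L u and \<eta> is L^31 (u \<kappa>): the residual stays free of
    \<kappa>, the distance from the identity does not.\<close>
  note ch = fl_chol_near_identity[OF chol Gf(1) nonneg(2) gs OS.G_near_cholesky(1) s(1)
      OS.G_near_cholesky(2) OS.G_near]
  have CC: "norm (tr (emb (Yd (k + 1))) * emb (Yd (k + 1)) - (tr (emb (U (k + 1))) * emb (U (k + 1))
      - tr (emb (Y (k + 1))) * emb (Y (k + 1)))) \<le> L ^ 8 * u"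
  proof -
    have "idm s * tr (emb (U (k + 1))) = tr (emb (U (k + 1)))" "idm s * tr (emb (Y (k + 1))) = tr (emb (Y (k + 1)))"
      using OS.UI OS.YI by (metis tr_idm tr_times)+
    then have "norm (tr (emb (Yd (k + 1))) * emb (Yd (k + 1)) - (tr (emb (U (k + 1))) * emb (U (k + 1))
      - tr (emb (Y (k + 1))) * emb (Y (k + 1)))) \<le> real s * (4 * (L * u) + L ^ 6 * u)"
      using OS.UI OS.YI
      by (intro ch(5)[OF _ _ _ OS.G_err])
        (simp_all add: right_diff_distrib left_diff_distrib mult.assoc[symmetric], simp_all add: mult.assoc)
    also have "\<dots> \<le> L ^ 8 * u"
    proof (rule pow_mult[of "real s" 1 1])
      have "4 * (L * u) \<le> L ^ 2 * u" by (rule pow_scale[of _ 1]) auto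
      then show "4 * (L * u) + L ^ 6 * u \<le> L ^ 7 * u" by (rule pow_add) auto
    qed (use s in auto)
    finally show ?thesis .
  qed
  obtain V where V: "fl_add_mult u (U (k + 1)) (- ?Qk) (Y (k + 1)) V"
    and fs: "fl_forward_subst u (Yd (k + 1))\<^sup>T V\<^sup>T (Q (k + 1))\<^sup>T" using normalization[OF kp] by blast
  note Vf = fl_add_mult_error[OF V Uc mQk Yf(1) nonneg(2) gn]
  have YdT: "(Yd (k + 1))\<^sup>T \<in> carrier_mat s s" and VT: "V\<^sup>T \<in> carrier_mat s m" using ch(1) Vf(1) by auto
  have tri: "(Yd (k + 1))\<^sup>T $$ (i, l) = 0" if "i < l" "l < s" for i l
    using ch(1,2) that by simp
  have diag: "(Yd (k + 1))\<^sup>T $$ (i, i) \<noteq> 0" if "i < s" for i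
    using ch(1,3) that by simp
  note Qf = fl_forward_subst_error[OF fs YdT VT tri diag nonneg(2) gs]
  have Qc: "Q (k + 1) \<in> carrier_mat m s" using Qf(1) by (metis transpose_carrier_mat transpose_transpose)
  have Qerr: "norm (emb (Q (k + 1)) * emb (Yd (k + 1)) - emb V)
      \<le> L * u * (norm (emb V) + norm (emb (Yd (k + 1))) * norm (emb (Q (k + 1))))"
    using Qf(2) norm_tr[of "emb (Q (k + 1)) * emb (Yd (k + 1)) - emb V"] by simp
  interpret NS: normalization_step L u \<kappa> \<sigma> s ?n ?q ?x "emb (S (k + 1))" "emb W" dW
    "emb (U (k + 1))" "emb (Sd (k + 1))" "emb (Y (k + 1))" "emb (\<Omega> (k + 1))" "emb G"
    "emb (Yd (k + 1))" "emb V" "emb (Q (k + 1))"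
    using emb_carrier[OF ch(1)] ch(4) CC emb_carrier[OF Qc] Vf(2) Qerr
    by unfold_locales simp_all
  note Rcf = fl_add_mult_error[OF conjunct1[OF factors[OF kp]] Sc Yf(1) Sdc nonneg(2) gs]
  note Rdf = fl_mult_error[OF conjunct2[OF factors[OF kp]] ch(1) Sdc nonneg(2) gs]
  have nn: "(k + 1) * s = ?n + s" by simp
  have row: "block_row m Q (k + 1) = ?Qk @\<^sub>c Q (k + 1)" by simp
  have Qk1: "block_row m Q (k + 1) \<in> carrier_mat m ((k + 1) * s)"
    unfolding row nn by (rule append_cols_carrier[OF Qk Qc])
  have embQ: "emb (block_row m Q (k + 1)) = ?q + emb (Q (k + 1)) * sel ?n s"
    unfolding row by (rule emb_append_cols[OF Qk Qc])
  have up: "block_upper Rc Rd (k + 1) = four_block_mat ?Rk (Rc (k + 1)) (0\<^sub>m s ?n) (Rd (k + 1))"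
    using Rdf(1) Rk by simp
  have Rk1: "block_upper Rc Rd (k + 1) \<in> carrier_mat ((k + 1) * s) ((k + 1) * s)"
    unfolding up nn by (rule four_block_carrier_mat[OF Rk Rdf(1)])
  have embR: "emb (block_upper Rc Rd (k + 1)) = emb ?Rk + emb (Rc (k + 1)) * sel ?n s
      + tr (sel ?n s) * (emb (Rd (k + 1)) * sel ?n s)"
    unfolding up by (subst emb_four_block[OF Rk Rcf(1) zero_carrier_mat Rdf(1)]) simp
  have "norm (tr (emb (block_row m Q (k + 1))) * emb (block_row m Q (k + 1)) - idm ((k + 1) * s))
      \<le> real (k + 1) * (L ^ 18 * u)"
    unfolding embQ nn using NS.next_orthogonality orth by (simp add: distrib_right)
  moreover have "norm (emb (block_row m X (k + 1)) - emb (block_row m Q (k + 1)) * emb (block_upper Rc Rd (k + 1)))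
      \<le> (\<Sum>j = 1..k + 1. L ^ 20 * (u * norm (emb (X j))))"
  proof -
    let ?D = "?x - ?q * emb (Rc (k + 1)) - emb (Q (k + 1)) * emb (Rd (k + 1))"
    have 1: "sel ?n s * emb ?Rk = 0" "sel ?n s * emb (Rc (k + 1)) = 0"
      using sel_times_zero emb_carrier(1)[OF Rk] emb_carrier(1)[OF Rcf(1)] by auto
    have 2: "?q * tr (sel ?n s) = 0" by (rule times_tr_sel_zero[OF PS.Q])
    have 3: "emb (Q (k + 1)) * (sel ?n s * (tr (sel ?n s) * F)) = emb (Q (k + 1)) * F" for F
      using emb_carrier(2)[OF Qc] by (metis mult.assoc sel_tr_sel)
    have 4: "?q * (tr (sel ?n s) * F) = 0" for F using 2 by (metis mult.assoc mult_zero_left)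
    have 5: "sel ?n s * (emb (Rc (k + 1)) * F) = 0" for F using 1 by (metis mult.assoc mult_zero_left)
    have "emb (block_row m X (k + 1)) - emb (block_row m Q (k + 1)) * emb (block_upper Rc Rd (k + 1))
        = (?X - ?q * emb ?Rk) + ?D * sel ?n s"
      unfolding emb_X_row_Suc[OF k(2)] embQ embR
      by (simp add: distrib_left distrib_right left_diff_distrib mult.assoc 1 3[simplified] 4 5[simplified])
    moreover have "norm (?D * sel ?n s) = norm ?D"
      by (rule norm_times_sel) (simp only: left_diff_distrib mult.assoc emb_carrier(2)[OF xc]
          emb_carrier(2)[OF Rcf(1)] emb_carrier(2)[OF Rdf(1)])
    moreover have "norm ?D \<le> L ^ 20 * (u * norm ?x)" by (rule NS.residual[OF Rcf(2) Rdf(2)])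
    ultimately show ?thesis
      using res norm_triangle_ineq[of "?X - ?q * emb ?Rk" "?D * sel ?n s"] by simp
  qed
  moreover have "S (k + 1 + 1) \<in> carrier_mat ((k + 1) * s) s \<and>
      norm (emb (S (k + 1 + 1)) - tr (emb (block_row m Q (k + 1))) * emb (X (k + 1 + 1)))
        \<le> L ^ 16 * (u * norm (emb (X (k + 1 + 1))))" if k2: "k + 1 < p"
  proof -
    have "k < p - 1" "k + 1 \<in> {1..<p}" "2 \<le> k + 1" using k k2 by auto
    then obtain T S' where T: "fl_add_mult u (P (k + 1)) (- (Y (k + 1))\<^sup>T) (Z k) T"
      and S': "fl_forward_subst u (Yd (k + 1))\<^sup>T T S'" and SS: "S (k + 1 + 1) = Z k @\<^sub>r S'"
      and ZP: "fl_mult u (?Qk\<^sup>T) (X (k + 2)) (Z k)" "fl_mult u (U (k + 1))\<^sup>T (X (k + 2)) (P (k + 1))"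
      using coefficients[of "k + 1"] lookahead[OF kp] by auto
    have x2: "X (k + 2) \<in> carrier_mat m s" using X k2 by simp
    note Zf = fl_mult_error[OF ZP(1) QkT x2 nonneg(2) gam_m]
    note Pf = fl_mult_error[OF ZP(2) UcT x2 nonneg(2) gam_m]
    note Tf = fl_add_mult_error[OF T Pf(1) mYT Zf(1) nonneg(2) gn]
    note Sf = fl_forward_subst_error[OF S' YdT Tf(1) tri diag nonneg(2) gs]
    have c: "S (k + 1 + 1) \<in> carrier_mat ((k + 1) * s) s"
      unfolding SS nn by (rule carrier_append_rows[OF Zf(1) Sf(1)])
    have "emb (S (k + 1 + 1)) = emb (Z k) + tr (sel ?n s) * emb S'"
      unfolding SS by (rule emb_append_rows[OF Zf(1) Sf(1)])
    moreover have "norm (emb (Z k) + tr (sel ?n s) * emb S' - tr (?q + emb (Q (k + 1)) * sel ?n s) * emb (X (k + 2)))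
      \<le> L ^ 16 * (u * norm (emb (X (k + 2))))"
      by (rule NS.next_coefficients[of _ _ "emb (P (k + 1))" "emb T"])
        (use Zf(2) Pf(2) Tf(2) Sf(2) emb_carrier[OF Sf(1)] in simp_all)
    ultimately show ?thesis using c unfolding embQ by simp
  qed
  ultimately show ?thesis unfolding accurate_def using Qk1 Rk1 by blast
qed

lemma accurate:
  assumes "1 \<le> k" "k \<le> p"
  shows "accurate k"
  using assms
proof (induction k rule: nat_induct_at_least)
  case base
  then show ?case by (rule accurate_1)
next
  case (Suc k)
  then show ?case using accurate_Suc[of k] by simp
qed

end

section \<open>Polynomial constants and the choice of the scale\<close>

lemma dim_const_const: "0 \<le> c \<Longrightarrow> dim_const (\<lambda>m s p. c)"
  unfolding dim_const_def by (rule exI[of _ c], rule exI[of _ 0]) simp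

lemma dim_const_dimension: "dim_const (\<lambda>m s p. real (1 + m + s + p))"
  unfolding dim_const_def by (rule exI[of _ 1], rule exI[of _ 1]) simp

lemma dim_const_mult:
  assumes "dim_const a" "dim_const b"
  shows "dim_const (\<lambda>m s p. a m s p * b m s p)"
proof -
  obtain A B i j where a: "\<And>m s p. 0 \<le> a m s p \<and> a m s p \<le> A * real (1 + m + s + p) ^ i"
    and b: "\<And>m s p. 0 \<le> b m s p \<and> b m s p \<le> B * real (1 + m + s + p) ^ j"
    using assms unfolding dim_const_def by metis
  have "a m s p * b m s p \<le> A * B * real (1 + m + s + p) ^ (i + j)" for m s p
  proof -
    have "a m s p * b m s p \<le> (A * real (1 + m + s + p) ^ i) * (B * real (1 + m + s + p) ^ j)"
      using a[of m s p] b[of m s p] by (intro mult_mono) linarith+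
    then show ?thesis by (simp only: power_add mult_ac)
  qed
  then show ?thesis unfolding dim_const_def using a b by (meson mult_nonneg_nonneg)
qed

lemma dim_const_add:
  assumes "dim_const a" "dim_const b"
  shows "dim_const (\<lambda>m s p. a m s p + b m s p)"
proof -
  obtain A B i j where a: "\<And>m s p. 0 \<le> a m s p \<and> a m s p \<le> A * real (1 + m + s + p) ^ i"
    and b: "\<And>m s p. 0 \<le> b m s p \<and> b m s p \<le> B * real (1 + m + s + p) ^ j"
    using assms unfolding dim_const_def by metis
  have A: "0 \<le> A" "0 \<le> B" using a[of 0 0 0] b[of 0 0 0] by simp_all
  have "a m s p + b m s p \<le> (A + B) * real (1 + m + s + p) ^ (i + j)" for m s p
  proof -
    have "A * real (1 + m + s + p) ^ i \<le> A * real (1 + m + s + p) ^ (i + j)"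
      "B * real (1 + m + s + p) ^ j \<le> B * real (1 + m + s + p) ^ (i + j)"
      using A by (auto intro!: mult_left_mono power_increasing)
    then show ?thesis using a[of m s p] b[of m s p] by (simp only: distrib_right) linarith
  qed
  then show ?thesis unfolding dim_const_def using a b by (meson add_nonneg_nonneg)
qed

lemma dim_const_power: "dim_const a \<Longrightarrow> dim_const (\<lambda>m s p. a m s p ^ n)"
  by (induction n) (simp_all add: dim_const_const dim_const_mult)

lemma power_one_add_le:
  fixes u :: real
  assumes "0 \<le> u" "real N * u \<le> 1 / 2"
  shows "(1 + u) ^ N - 1 \<le> 2 * (real N * u)"
proof -
  let ?x = "real N * u"
  have "(1 + u) ^ N \<le> exp u ^ N" using assms by (intro power_mono) (auto simp: exp_ge_add_one_self)
  also have "\<dots> = exp ?x" by (simp add: exp_of_nat_mult)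
  also have "\<dots> \<le> 1 + ?x + ?x\<^sup>2" using assms by (intro exp_bound) auto
  also have "?x\<^sup>2 \<le> 1 * ?x" unfolding power2_eq_square using assms by (intro mult_right_mono) auto
  finally show ?thesis by linarith
qed

lemma norm_emb_le:
  assumes "M \<in> carrier_mat m s" "1 \<le> s" "norm2 M \<le> t"
  shows "norm (emb M) \<le> sqrt (real s) * t"
  using norm_le_norm2[OF assms(1,2)] mult_left_mono[OF assms(3), of "sqrt (real s)"] by simp

lemma emb_one_minus_gram:
  assumes "M \<in> carrier_mat m n"
  shows "emb (1\<^sub>m n - M\<^sup>T * M) = idm n - tr (emb M) * emb M" "1\<^sub>m n - M\<^sup>T * M \<in> carrier_mat n n"
proof -
  have c: "1\<^sub>m n \<in> carrier_mat n n" "M\<^sup>T * M \<in> carrier_mat n n" using assms by auto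
  show "emb (1\<^sub>m n - M\<^sup>T * M) = idm n - tr (emb M) * emb M"
    unfolding emb_simps(2)[OF c] using assms by (simp add: emb_mult)
  show "1\<^sub>m n - M\<^sup>T * M \<in> carrier_mat n n" by (rule minus_carrier_mat[OF c(2)])
qed

lemma add_diff_mat:
  fixes A B :: "real mat"
  assumes "A \<in> carrier_mat m n" "B \<in> carrier_mat m n"
  shows "A + (B - A) = B"
  using assms by (intro eq_matI) auto

text \<open>One scale L for fixed dimensions. The square of 1 + m + s + p dominates the rounding
  exponents m + 2 and p s + 2, the number of blocks and the roots from norm comparison; the last
  factor takes in the constants of both intraorthogonalizations; 100 absorbs numerical
  factors.\<close>

lemma bcgsi_p_2s_accurate:
  fixes cA cA' c1 c1' L u \<alpha> :: real
  assumes L: "L = 100 * real (1 + m + s + p) ^ 2 * (1 + cA + cA' + c1 + c1')"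
    and nn: "0 \<le> cA" "0 \<le> cA'" "0 \<le> c1" "0 \<le> c1'"
    and dims: "1 \<le> m" "1 \<le> s" "1 \<le> p" and u: "0 < u"
    and X: "\<forall>j\<in>{1..p}. X j \<in> carrier_mat m s"
    and IO: "intraorthogonalization m s IO_A" "intraorthogonalization m s IO_B"
    and run: "bcgsi_p_2s u IO_A IO_B m p X Q Rc Rd"
    and cond: "\<forall>k\<in>{1..p}. 0 < sigma_min (block_row m X k) \<and> L ^ 60 * u * cond2 (block_row m X k) \<le> 1 / 2"
    and IO_A: "cond2 (X 1) \<le> cond2 (block_row m X p) \<longrightarrow>
         (\<forall>Q' R'. IO_A (X 1) = (Q', R') \<longrightarrow>
            (\<exists>\<Delta> \<in> carrier_mat m s. X 1 + \<Delta> = Q' * R' \<and> norm2 \<Delta> \<le> cA * u * norm2 (X 1)) \<and>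
            norm2 (1\<^sub>m s - Q'\<^sup>T * Q') \<le> cA' * u)"
    and \<alpha>: "\<alpha> \<le> 1"
    and IO_B: "\<forall>B \<in> carrier_mat m s.
         0 < sigma_min B \<longrightarrow>
         cond2 B \<le> (1 + L ^ 24 * u * cond2 (block_row m X p)) * cond2 (block_row m X p) \<longrightarrow>
         (\<forall>Q' R'. IO_B B = (Q', R') \<longrightarrow>
            (\<exists>\<Delta> \<in> carrier_mat m s. B + \<Delta> = Q' * R' \<and> norm2 \<Delta> \<le> c1 * u * norm2 B) \<and>
            norm2 (1\<^sub>m s - Q'\<^sup>T * Q') \<le> c1' * u * cond2 B powr \<alpha>)"
    and k: "k \<in> {1..p}"
  shows "(\<exists>\<Delta> \<in> carrier_mat m (k * s).
            block_row m X k + \<Delta> = block_row m Q k * block_upper Rc Rd k \<and>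
            norm2 \<Delta> \<le> L ^ 22 * u * norm2 (block_row m X k)) \<and>
         norm2 (1\<^sub>m (k * s) - (block_row m Q k)\<^sup>T * block_row m Q k) \<le> L ^ 20 * u"
proof -
  define \<sigma> where "\<sigma> = sigma_min (block_row m X p)"
  define \<kappa> where "\<kappa> = cond2 (block_row m X p)"
  define D where "D = real (1 + m + s + p)"
  define K where "K = 1 + cA + cA' + c1 + c1'"
  have D: "4 \<le> D" using dims by (simp add: D_def)
  have "4 * D \<le> D ^ 2" unfolding power2_eq_square using D by (intro mult_right_mono) auto
  then have DD: "D \<le> D ^ 2" "1 \<le> D ^ 2" using D by linarith+
  have K: "1 \<le> K" using nn by (simp add: K_def)
  have LDK: "L = 100 * (D ^ 2 * K)" by (simp add: L D_def K_def)
  have DK: "D ^ 2 * c \<le> D ^ 2 * K" if "c \<le> K" for c using that by (intro mult_left_mono) auto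
  have D2: "100 * D ^ 2 \<le> L" using DK[OF K] LDK by simp
  have rs: "real s \<le> D" "sqrt (real s) \<le> D"
  proof -
    show "real s \<le> D" by (simp add: D_def)
    have "sqrt (real s) \<le> real s" using dims by (intro real_le_lsqrt) (auto simp: power2_eq_square)
    with \<open>real s \<le> D\<close> show "sqrt (real s) \<le> D" by linarith
  qed
  have sc: "2 * (sqrt (real s) * c) \<le> L" if "c \<le> K" "0 \<le> c" for c
  proof -
    have "sqrt (real s) * c \<le> D ^ 2 * c" using rs DD that by (intro mult_right_mono) auto
    moreover have "D ^ 2 * c \<le> D ^ 2 * K" by (rule DK[OF that(1)])
    moreover have "0 \<le> D ^ 2 * K" using K by simp
    ultimately show ?thesis using LDK by linarith
  qed
  have scs: "2 * (sqrt (real s) * cA) \<le> L" "2 * (sqrt (real s) * cA') \<le> L"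
    "2 * (sqrt (real s) * c1) \<le> L" "2 * (sqrt (real s) * c1') \<le> L"
    by (rule sc; use nn in \<open>simp add: K_def\<close>)+
  have Xp: "block_row m X k \<in> carrier_mat m (k * s)" if "k \<le> p" for k
    using that X
  proof (induction k)
    case (Suc k)
    then have "block_row m X k @\<^sub>c X (Suc k) \<in> carrier_mat m (k * s + s)"
      by (intro append_cols_carrier) auto
    then show ?case by (simp add: add.commute)
  qed simp
  have ps: "1 \<le> p * s" using dims by simp
  note sig = sigma_min_mult_le[OF Xp[OF order_refl] ps] sigma_max_mult_ge[OF Xp[OF order_refl] ps]
    sigma_min_le_sigma_max[OF Xp[OF order_refl] ps]
  have \<sigma>: "0 < \<sigma>" using cond dims by (simp add: \<sigma>_def)
  then have \<sigma>0: "\<sigma> \<noteq> 0" by simp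
  have \<kappa>\<sigma>: "\<kappa> * \<sigma> = sigma_max (block_row m X p)" using \<sigma> by (simp add: \<kappa>_def cond2_def \<sigma>_def)
  have \<kappa>: "1 \<le> \<kappa>" using sig(3) \<sigma> by (simp add: \<kappa>_def cond2_def \<sigma>_def)
  have small: "L ^ 60 * (u * \<kappa>) \<le> 1 / 2" using cond dims by (simp add: \<kappa>_def mult.assoc)
  interpret block_columns L u \<kappa> \<sigma> s m p X
  proof unfold_locales
    show "100 \<le> L" using D2 DD by linarith
    show "real s \<le> L" "2 * sqrt (real s) \<le> L" using D2 DD rs by linarith+
    show "\<sigma> * norm V \<le> norm (emb (block_row m X p) * V)" if "idm (p * s) * V = V" for V
      using sig(1)[OF that] by (simp add: \<sigma>_def)
    show "norm (emb (block_row m X p) * V) \<le> \<kappa> * \<sigma> * norm V" if "idm (p * s) * V = V" for V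
      using sig(2)[OF that] by (simp add: \<kappa>\<sigma>)
  qed (use u \<kappa> \<sigma> small dims X in auto)
  have X1: "X 1 \<in> carrier_mat m s" using X dims by simp
  \<comment> \<open>The case without preceding columns, with H = 0.\<close>
  have X1b: "\<sigma> * norm V \<le> norm (emb (X 1) * V)" "norm (emb (X 1) * V) \<le> \<kappa> * \<sigma> * norm V"
    if "idm s * V = V" for V
    using block_bounds(1)[of 0 V 0] block_bounds(2)[of 0 V] that dims by auto
  \<comment> \<open>The hypothesis on the first intraorthogonalization is guarded by this
    inequality.\<close>
  have "cond2 (X 1) \<le> cond2 (block_row m X p)"
  proof -
    have "\<sigma> \<le> sigma_min (X 1)" by (rule le_sigma_min[OF X1 dims(2) X1b(1)])
    moreover have "sigma_max (X 1) \<le> \<kappa> * \<sigma>" by (rule sigma_max_le[OF X1 dims(2) X1b(2)])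
    ultimately have "cond2 (X 1) \<le> (\<kappa> * \<sigma>) / \<sigma>"
      unfolding cond2_def using \<sigma> \<kappa> by (intro frac_le) auto
    then show ?thesis using \<sigma> by (simp add: \<kappa>_def)
  qed
  note IO_A' = IO_A[rule_format, OF this]
  obtain S Sd U Y Yd \<Omega> Z P where run0: "IO_A (X 1) = (Q 1, Rd 1)"
    and run1: "2 \<le> p \<longrightarrow> fl_mult u (Q 1)\<^sup>T (X 2) (S 2)"
    and run2: "\<forall>k \<in> {1..<p}. (2 \<le> k \<longrightarrow> (\<exists>T S'.
             fl_add_mult u (P k) (- (Y k)\<^sup>T) (Z (k - 1)) T \<and>
             fl_forward_subst u (Yd k)\<^sup>T T S' \<and>
             S (k + 1) = Z (k - 1) @\<^sub>r S')) \<and>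
          (\<exists>W. fl_add_mult u (X (k + 1)) (- block_row m Q k) (S (k + 1)) W \<and>
             IO_B W = (U (k + 1), Sd (k + 1))) \<and>
          fl_mult u (block_row m Q k)\<^sup>T (U (k + 1)) (Y (k + 1)) \<and>
          fl_mult u (U (k + 1))\<^sup>T (U (k + 1)) (\<Omega> (k + 1)) \<and>
          (k < p - 1 \<longrightarrow>
             fl_mult u (block_row m Q k)\<^sup>T (X (k + 2)) (Z k) \<and>
             fl_mult u (U (k + 1))\<^sup>T (X (k + 2)) (P (k + 1))) \<and>
          (\<exists>G. fl_add_mult u (\<Omega> (k + 1)) (- (Y (k + 1))\<^sup>T) (Y (k + 1)) G \<and>
             fl_chol u G (Yd (k + 1))) \<and>
          (\<exists>V. fl_add_mult u (U (k + 1)) (- block_row m Q k) (Y (k + 1)) V \<and>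
             fl_forward_subst u (Yd (k + 1))\<^sup>T V\<^sup>T (Q (k + 1))\<^sup>T) \<and>
          fl_add_mult u (S (k + 1)) (Y (k + 1)) (Sd (k + 1)) (Rc (k + 1)) \<and>
          fl_mult u (Yd (k + 1)) (Sd (k + 1)) (Rd (k + 1))"
    using run unfolding bcgsi_p_2s_def Let_def by blast
  have Q1: "Q 1 \<in> carrier_mat m s" "Rd 1 \<in> carrier_mat s s"
    using IO(1) X1 run0 unfolding intraorthogonalization_def by blast+
  obtain \<Delta> where \<Delta>: "\<Delta> \<in> carrier_mat m s" "X 1 + \<Delta> = Q 1 * Rd 1" "norm2 \<Delta> \<le> cA * u * norm2 (X 1)"
    and orth1: "norm2 (1\<^sub>m s - (Q 1)\<^sup>T * Q 1) \<le> cA' * u" using IO_A'[OF run0] by blast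
  have gam: "(1 + u) ^ (n + 2) - 1 \<le> L * u" if n: "n \<le> m \<or> n \<le> p * s" for n
  proof -
    have "p * s + 2 \<le> (1 + m + s + p)\<^sup>2" by (simp add: power2_eq_square algebra_simps) (use dims in linarith)
    moreover have "m + 2 \<le> (1 + m + s + p)\<^sup>2" by (simp add: power2_eq_square algebra_simps) (use dims in linarith)
    ultimately have "n + 2 \<le> (1 + m + s + p)\<^sup>2" using n by linarith
    then have "real (n + 2) \<le> D\<^sup>2" unfolding D_def by (metis of_nat_le_iff of_nat_power)
    then have "2 * real (n + 2) \<le> 2 * D\<^sup>2" by (rule mult_left_mono) simp
    also have "\<dots> \<le> L" using D2 DD by linarith
    finally have 1: "2 * real (n + 2) \<le> L" .
    then have 2: "2 * (real (n + 2) * u) \<le> L * u"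
      using mult_right_mono[OF 1, of u] by (simp only: nonneg mult.assoc)
    also have "L * u \<le> 1 / 2" using pow_u_small[of 1] by simp
    finally have "real (n + 2) * u \<le> 1 / 2" using u by simp
    from power_one_add_le[OF nonneg(2) this] show ?thesis using 2 by linarith
  qed
  have pD: "real p \<le> L" "2 * sqrt (real (p * s)) \<le> L"
  proof -
    have "real p \<le> D" by (simp add: D_def)
    then show "real p \<le> L" using DD D2 by linarith
    have "p * s \<le> (1 + m + s + p)\<^sup>2" by (simp add: power2_eq_square algebra_simps)
    then have "real (p * s) \<le> D\<^sup>2" unfolding D_def by (metis of_nat_le_iff of_nat_power)
    then have "sqrt (real (p * s)) \<le> D" using D by (intro real_le_lsqrt) auto
    then show "2 * sqrt (real (p * s)) \<le> L" using DD D2 by linarith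
  qed
  have init3: "norm (tr (emb (Q 1)) * emb (Q 1) - idm s) \<le> L ^ 18 * u"
  proof -
    have "norm (idm s - tr (emb (Q 1)) * emb (Q 1)) \<le> sqrt (real s) * (cA' * u)"
      using norm_emb_le[OF emb_one_minus_gram(2)[OF Q1(1)] dims(2) orth1] 
      by (simp only: emb_one_minus_gram(1)[OF Q1(1)])
    also have "\<dots> \<le> L ^ 18 * u"
    proof -
      have "0 \<le> sqrt (real s) * cA'" using nn by simp
      then have "sqrt (real s) * cA' \<le> L ^ 1 * 1" using scs by simp
      then have "(sqrt (real s) * cA') * u \<le> L ^ 18 * u"
        by (rule pow_mult[of _ _ _ _ 0 u]) (use nn in auto)
      then show ?thesis by (simp only: mult.assoc)
    qed
    finally show ?thesis by (simp only: norm_minus_commute)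
  qed
  have init4: "norm (emb (X 1) - emb (Q 1) * emb (Rd 1)) \<le> L ^ 20 * (u * norm (emb (X 1)))"
  proof -
    have e: "emb (X 1) + emb \<Delta> = emb (Q 1) * emb (Rd 1)"
      using \<Delta> Q1 emb_simps(1)[OF X1 \<Delta>(1)] by (simp add: emb_mult)
    have "emb (X 1) - emb (Q 1) * emb (Rd 1) = - emb \<Delta>" unfolding e[symmetric] by simp
    then have "norm (emb (X 1) - emb (Q 1) * emb (Rd 1)) = norm (emb \<Delta>)" by simp
    also have "\<dots> \<le> sqrt (real s) * (cA * u * norm (emb (X 1)))"
    proof (rule norm_emb_le[OF \<Delta>(1) dims(2)])
      have "cA * u * norm2 (X 1) \<le> cA * u * norm (emb (X 1))"
        using norm2_le_norm[OF X1 dims(2)] nn u by (intro mult_left_mono) auto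
      then show "norm2 \<Delta> \<le> cA * u * norm (emb (X 1))" using \<Delta>(3) by linarith
    qed
    also have "\<dots> = (sqrt (real s) * cA) * (u * norm (emb (X 1)))" by simp
    also have "\<dots> \<le> L ^ 20 * (u * norm (emb (X 1)))"
    proof (rule pow_mult[of _ 1 1 _ 0 "u * norm (emb (X 1))"])
      have "0 \<le> sqrt (real s) * cA" using nn by simp
      then show "sqrt (real s) * cA \<le> L ^ 1 * 1" using scs by simp
    qed (use nn in auto)
    finally show ?thesis .
  qed
  have IO1: "U' \<in> carrier_mat m s \<and> R' \<in> carrier_mat s s \<and>
        (\<exists>dW. emb W + dW = emb U' * emb R' \<and> norm dW \<le> L * u * norm (emb W)) \<and>
        norm (tr (emb U') * emb U' - idm s) \<le> L ^ 2 * (u * \<kappa>)"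
    if W: "W \<in> carrier_mat m s"
      and Wl: "\<And>V. idm s * V = V \<Longrightarrow> \<sigma> * (1 - L ^ 23 * (u * \<kappa>)) * norm V \<le> norm (emb W * V)"
      and Wu: "\<And>V. idm s * V = V \<Longrightarrow> norm (emb W * V) \<le> \<kappa> * \<sigma> * (1 + L ^ 19 * u) * norm V"
      and UR: "IO_B W = (U', R')" for W U' R'
  proof -
    have U': "U' \<in> carrier_mat m s" "R' \<in> carrier_mat s s"
      using IO(2) W UR unfolding intraorthogonalization_def by blast+
    define a where "a = L ^ 23 * (u * \<kappa>)"
    have a: "0 \<le> a" "a \<le> 1 / 2" using pow_small[of 23] by (simp_all add: a_def)
    have b: "L ^ 19 * u \<le> a" unfolding a_def by (rule pow_mono2[OF order_refl]) (use u_le in auto)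
    have smin: "\<sigma> * (1 - a) \<le> sigma_min W" using le_sigma_min[OF W dims(2) Wl] by (simp add: a_def)
    have smax: "sigma_max W \<le> \<kappa> * \<sigma> * (1 + a)"
    proof -
      have "sigma_max W \<le> \<kappa> * \<sigma> * (1 + L ^ 19 * u)" by (rule sigma_max_le[OF W dims(2) Wu])
      also have "\<dots> \<le> \<kappa> * \<sigma> * (1 + a)" using b by (intro mult_left_mono) auto
      finally show ?thesis .
    qed
    have "\<sigma> * (1 / 2) \<le> \<sigma> * (1 - a)" using a by (intro mult_left_mono) auto
    then have spos: "0 < \<sigma> * (1 - a)" "0 < sigma_min W" using smin \<sigma> by linarith+
    have c1: "1 \<le> cond2 W"
      unfolding cond2_def using sigma_min_le_sigma_max[OF W dims(2)] spos by simp
    have "cond2 W \<le> (\<kappa> * \<sigma> * (1 + a)) / (\<sigma> * (1 - a))"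
      unfolding cond2_def using smin smax spos a by (intro frac_le) auto
    also have "\<dots> = \<kappa> * ((1 + a) / (1 - a))" using \<sigma>0 by simp
    \<comment> \<open>Valid since a is at most 1/2. As 4 a is at most L^24 u \<kappa>, this
      determines by how much the condition number of W may exceed \<kappa>.\<close>
    also have "(1 + a) / (1 - a) \<le> 1 + 4 * a"
    proof -
      have "a * a \<le> a * (1 / 2)" using a by (intro mult_left_mono) auto
      then have "1 + a \<le> (1 + 4 * a) * (1 - a)" by (simp add: algebra_simps)
      then show ?thesis using a by (simp add: divide_le_eq)
    qed
    then have "\<kappa> * ((1 + a) / (1 - a)) \<le> \<kappa> * (1 + 4 * a)" by (intro mult_left_mono) auto
    finally have cW: "cond2 W \<le> (1 + 4 * a) * \<kappa>" by (simp only: mult.commute)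
    have a4: "4 * a \<le> L ^ 24 * (u * \<kappa>)" unfolding a_def by (rule pow_scale[OF order_refl]) auto
    then have "(1 + 4 * a) * \<kappa> \<le> (1 + L ^ 24 * (u * \<kappa>)) * \<kappa>" by (intro mult_right_mono) auto
    with cW have cW1: "cond2 W \<le> (1 + L ^ 24 * (u * \<kappa>)) * \<kappa>" by linarith
    have "4 * a \<le> 1 / 2" using a4 pow_small[of 24] by simp
    then have "(1 + 4 * a) * \<kappa> \<le> 2 * \<kappa>" by (intro mult_right_mono) auto
    with cW have cW2: "cond2 W \<le> 2 * \<kappa>" by linarith
    have "cond2 W \<le> (1 + L ^ 24 * u * cond2 (block_row m X p)) * cond2 (block_row m X p)"
      using cW1 by (simp only: \<kappa>_def mult.assoc)
    from IO_B[rule_format, OF W spos(2) this UR]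
    obtain E where E: "E \<in> carrier_mat m s" "W + E = U' * R'" "norm2 E \<le> c1 * u * norm2 W"
      and o: "norm2 (1\<^sub>m s - U'\<^sup>T * U') \<le> c1' * u * cond2 W powr \<alpha>" by blast
    \<comment> \<open>A condition number is at least 1, so the power is monotone in the exponent,
      also when \<alpha> is negative.\<close>
    have "cond2 W powr \<alpha> \<le> cond2 W powr 1" using c1 \<alpha> by (intro powr_mono) auto
    then have "cond2 W powr \<alpha> \<le> 2 * \<kappa>" using c1 cW2 by simp
    then have "c1' * u * cond2 W powr \<alpha> \<le> c1' * u * (2 * \<kappa>)" using nn by (intro mult_left_mono) auto
    with o have "norm2 (1\<^sub>m s - U'\<^sup>T * U') \<le> c1' * u * (2 * \<kappa>)" by linarith
    from norm_emb_le[OF emb_one_minus_gram(2)[OF U'(1)] dims(2) this]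
    have "norm (idm s - tr (emb U') * emb U') \<le> sqrt (real s) * (c1' * u * (2 * \<kappa>))"
      by (simp only: emb_one_minus_gram(1)[OF U'(1)])
    also have "\<dots> = (sqrt (real s) * (2 * c1')) * (u * \<kappa>)" by simp
    also have "\<dots> \<le> L ^ 2 * (u * \<kappa>)"
    proof (rule pow_mult[of _ 1 1 _ 0 "u * \<kappa>"])
      have "0 \<le> sqrt (real s) * c1'" using nn by simp
      then show "sqrt (real s) * (2 * c1') \<le> L ^ 1 * 1" using scs by simp
    qed (use nn in auto)
    finally have UU: "norm (tr (emb U') * emb U' - idm s) \<le> L ^ 2 * (u * \<kappa>)" by (simp only: norm_minus_commute)
    have "emb W + emb E = emb U' * emb R'"
      using E U' emb_simps(1)[OF W E(1)] by (simp add: emb_mult)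
    moreover have "norm (emb E) \<le> L * u * norm (emb W)"
    proof -
      have "c1 * u * norm2 W \<le> c1 * u * norm (emb W)"
        using norm2_le_norm[OF W dims(2)] nn u by (intro mult_left_mono) auto
      then have "norm2 E \<le> c1 * u * norm (emb W)" using E(3) by linarith
      then have "norm (emb E) \<le> sqrt (real s) * (c1 * u * norm (emb W))"
        by (rule norm_emb_le[OF E(1) dims(2)])
      also have "\<dots> = (sqrt (real s) * c1) * (u * norm (emb W))" by simp
      also have "\<dots> \<le> L * (u * norm (emb W))"
      proof (rule mult_right_mono)
        have "0 \<le> sqrt (real s) * c1" using nn by simp
        then show "sqrt (real s) * c1 \<le> L" using scs by linarith
      qed simp
      finally show ?thesis by (simp only: mult.assoc)
    qed
    ultimately show ?thesis using U' UU by blast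
  qed
  interpret bcgs_run L u \<kappa> \<sigma> s m p X Q Rc Rd S Sd U Y Yd \<Omega> Z P IO_B
  proof unfold_locales
    fix k assume "k \<in> {1..<p}"
    note r = run2[rule_format, OF this]
    show "2 \<le> k \<Longrightarrow> \<exists>T S'. fl_add_mult u (P k) (- (Y k)\<^sup>T) (Z (k - 1)) T \<and>
      fl_forward_subst u (Yd k)\<^sup>T T S' \<and> S (k + 1) = Z (k - 1) @\<^sub>r S'" using r by blast
    show "\<exists>W. fl_add_mult u (X (k + 1)) (- block_row m Q k) (S (k + 1)) W \<and>
      IO_B W = (U (k + 1), Sd (k + 1))" using r by blast
    show "fl_mult u (block_row m Q k)\<^sup>T (U (k + 1)) (Y (k + 1)) \<and>
      fl_mult u (U (k + 1))\<^sup>T (U (k + 1)) (\<Omega> (k + 1))" using r by blast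
    show "k < p - 1 \<Longrightarrow> fl_mult u (block_row m Q k)\<^sup>T (X (k + 2)) (Z k) \<and>
      fl_mult u (U (k + 1))\<^sup>T (X (k + 2)) (P (k + 1))" using r by blast
    show "\<exists>G. fl_add_mult u (\<Omega> (k + 1)) (- (Y (k + 1))\<^sup>T) (Y (k + 1)) G \<and>
      fl_chol u G (Yd (k + 1))" using r by blast
    show "\<exists>V. fl_add_mult u (U (k + 1)) (- block_row m Q k) (Y (k + 1)) V \<and>
      fl_forward_subst u (Yd (k + 1))\<^sup>T V\<^sup>T (Q (k + 1))\<^sup>T" using r by blast
    show "fl_add_mult u (S (k + 1)) (Y (k + 1)) (Sd (k + 1)) (Rc (k + 1)) \<and>
      fl_mult u (Yd (k + 1)) (Sd (k + 1)) (Rd (k + 1))" using r by blast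
  qed (fact gam pD Q1 init3 init4 IO1 | use run1 in blast)+
  have k1: "1 \<le> k" "k \<le> p" using k by auto
  have ks: "1 \<le> k * s" using k1 dims by simp
  have Xk: "block_row m X k \<in> carrier_mat m (k * s)" by (rule Xp[OF k1(2)])
  have Qk: "block_row m Q k \<in> carrier_mat m (k * s)"
    and Rk: "block_upper Rc Rd k \<in> carrier_mat (k * s) (k * s)"
    and orth: "norm (tr (emb (block_row m Q k)) * emb (block_row m Q k) - idm (k * s)) \<le> real k * (L ^ 18 * u)"
    and res: "norm (emb (block_row m X k) - emb (block_row m Q k) * emb (block_upper Rc Rd k))
      \<le> (\<Sum>j = 1..k. L ^ 20 * (u * norm (emb (X j))))"
    using accurate[OF k1] unfolding accurate_def by auto
  have kL: "real k \<le> L ^ 1 * 1" using k1 pD(1) by simp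
  have "norm2 (1\<^sub>m (k * s) - (block_row m Q k)\<^sup>T * block_row m Q k) \<le> L ^ 20 * u"
  proof -
    have "norm2 (1\<^sub>m (k * s) - (block_row m Q k)\<^sup>T * block_row m Q k)
        \<le> norm (idm (k * s) - tr (emb (block_row m Q k)) * emb (block_row m Q k))"
      using norm2_le_norm[OF emb_one_minus_gram(2)[OF Qk] ks] by (simp only: emb_one_minus_gram(1)[OF Qk])
    also have "\<dots> \<le> real k * (L ^ 18 * u)" using orth by (simp only: norm_minus_commute)
    also have "\<dots> \<le> L ^ 20 * u" by (rule pow_mult[OF kL order_refl]) auto
    finally show ?thesis .
  qed
  moreover have "\<exists>\<Delta> \<in> carrier_mat m (k * s). block_row m X k + \<Delta> = block_row m Q k * block_upper Rc Rd k \<and>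
            norm2 \<Delta> \<le> L ^ 22 * u * norm2 (block_row m X k)"
  proof
    let ?QR = "block_row m Q k * block_upper Rc Rd k"
    let ?\<Delta> = "?QR - block_row m X k"
    have QR: "?QR \<in> carrier_mat m (k * s)" using Qk Rk by auto
    show c: "?\<Delta> \<in> carrier_mat m (k * s)" using QR Xk by auto
    have e: "emb ?\<Delta> = - (emb (block_row m X k) - emb (block_row m Q k) * emb (block_upper Rc Rd k))"
      unfolding emb_simps(2)[OF QR Xk] using Qk Rk by (simp add: emb_mult)
    have "block_row m X k + ?\<Delta> = ?QR" by (rule add_diff_mat[OF Xk QR])
    moreover have "norm2 ?\<Delta> \<le> L ^ 22 * u * norm2 (block_row m X k)"
    proof -
      let ?N = "norm2 (block_row m X k)"
      have N: "0 \<le> ?N"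
      \<comment> \<open>\<open>norm2\<close> is a supremum, so its sign is not immediate; it is read
        off from the comparison with the Frobenius norm.\<close>
      proof (rule ccontr)
        assume "\<not> 0 \<le> ?N"
        moreover have "0 < k * s" using ks by linarith
        then have "0 < sqrt (real (k * s))" by (simp only: real_sqrt_gt_0_iff of_nat_0_less_iff)
        ultimately have "sqrt (real (k * s)) * ?N < 0" by (intro mult_pos_neg) auto
        then show False
          using norm_le_norm2[OF Xk ks] norm_ge_zero[of "emb (block_row m X k)"] by linarith
      qed
      have XN: "norm (emb (X j)) \<le> L ^ 1 * ?N" if j: "j \<in> {1..k}" for j
      proof -
        have "norm (emb (X j)) \<le> norm (emb (block_row m X k))"
        proof -
          have "i \<le> p \<Longrightarrow> \<forall>j\<in>{1..i}. norm (emb (X j)) \<le> norm (emb (block_row m X i))" for i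
          proof (induction i)
            case (Suc i)
            have ip: "i < p" using Suc by simp
            have "emb (block_row m X i) * idm (i * s) = emb (block_row m X i)" "emb (X (i + 1)) * idm s = emb (X (i + 1))"
              using emb_carrier[OF Xp[of i]] emb_carrier[of "X (i + 1)" m s] X ip by auto
            from norm_append_cols[OF this] have "(norm (emb (block_row m X (i + 1))))\<^sup>2
                = (norm (emb (block_row m X i)))\<^sup>2 + (norm (emb (X (i + 1))))\<^sup>2"
              by (simp only: emb_X_row_Suc[OF ip])
            then have *: "norm (emb (block_row m X i)) \<le> norm (emb (block_row m X (i + 1)))
                \<and> norm (emb (X (i + 1))) \<le> norm (emb (block_row m X (i + 1)))"
              by (rule sqrt_sum_ge) simp
            show ?case
            proof
              fix j assume "j \<in> {1..Suc i}"
              then consider "j \<in> {1..i}" | "j = i + 1" by fastforce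
              then show "norm (emb (X j)) \<le> norm (emb (block_row m X (Suc i)))"
                using * Suc.IH ip by cases (fastforce, simp)
            qed
          qed simp
          then show ?thesis using k1 j by blast
        qed
        also have "\<dots> \<le> sqrt (real (k * s)) * ?N" by (rule norm_le_norm2[OF Xk ks])
        also have "\<dots> \<le> L ^ 1 * ?N"
        proof (rule mult_right_mono[OF _ N])
          have "sqrt (real (k * s)) \<le> sqrt (real (p * s))" using k1 by (simp add: mult_right_mono)
          moreover have "0 \<le> sqrt (real (p * s))" by simp
          ultimately show "sqrt (real (k * s)) \<le> L ^ 1" unfolding power_one_right using pD(2) by linarith
        qed
        finally show ?thesis .
      qed
      have "norm2 ?\<Delta> \<le> norm (emb ?\<Delta>)" by (rule norm2_le_norm[OF c ks])
      also have "\<dots> \<le> (\<Sum>j = 1..k. L ^ 20 * (u * norm (emb (X j))))" using res by (simp only: e norm_minus_cancel)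
      also have "\<dots> \<le> (\<Sum>j = 1..k. L ^ 21 * (u * ?N))"
      proof (rule sum_mono)
        fix j assume "j \<in> {1..k}"
        from XN[OF this] have "u * norm (emb (X j)) \<le> L ^ 1 * (u * ?N)"
          by (intro pow_mult[of u 0 u _ 1 ?N]) (use N in auto)
        then show "L ^ 20 * (u * norm (emb (X j))) \<le> L ^ 21 * (u * ?N)"
          by (intro pow_mult[of "L ^ 20" 20 1 _ 1 "u * ?N"]) (use N in auto)
      qed
      also have "\<dots> = real k * (L ^ 21 * (u * ?N))" by simp
      also have "\<dots> \<le> L ^ 22 * (u * ?N)" by (rule pow_mult[OF kL order_refl]) (use N in auto)
      finally show ?thesis by (simp only: mult.assoc)
    qed
    ultimately show "block_row m X k + ?\<Delta> = ?QR \<and> norm2 ?\<Delta> \<le> L ^ 22 * u * norm2 (block_row m X k)" ..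
  qed
  ultimately show ?thesis by blast
qed

text \<open>The second intraorthogonalization is trusted slightly beyond the condition number of all
  columns because it is applied to a rounded projection, whose condition number can exceed that
  value by a relative O(u) \<kappa>. The constants are fixed before dimensions, data and u, so they
  depend on m, s and p only.\<close>

theorem theorem2:
  fixes cA cA' c1 c1' :: "nat \<Rightarrow> nat \<Rightarrow> nat \<Rightarrow> real"
  assumes "dim_const cA" "dim_const cA'" "dim_const c1" "dim_const c1'"
  shows "\<exists>c\<^sub>\<kappa> c\<^sub>W c\<^sub>R c\<^sub>O.
    dim_const c\<^sub>\<kappa> \<and> dim_const c\<^sub>W \<and> dim_const c\<^sub>R \<and> dim_const c\<^sub>O \<and>
    (\<forall>(m::nat) (s::nat) (p::nat) (u::real) (\<alpha>\<^sub>1::real) IO_A IO_1 X Q Rc Rd.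
      1 \<le> m \<longrightarrow> 1 \<le> s \<longrightarrow> 1 \<le> p \<longrightarrow> 0 < u \<longrightarrow>
      (\<forall>j\<in>{1..p}. X j \<in> carrier_mat m s) \<longrightarrow>
      intraorthogonalization m s IO_A \<longrightarrow> intraorthogonalization m s IO_1 \<longrightarrow>
      bcgsi_p_2s u IO_A IO_1 m p X Q Rc Rd \<longrightarrow>
      (\<forall>k\<in>{1..p}. 0 < sigma_min (block_row m X k) \<and>
         c\<^sub>\<kappa> m s p * u * cond2 (block_row m X k) \<le> 1 / 2) \<longrightarrow>
      (cond2 (X 1) \<le> cond2 (block_row m X p) \<longrightarrow>
         (\<forall>Q' R'. IO_A (X 1) = (Q', R') \<longrightarrow>
            (\<exists>\<Delta> \<in> carrier_mat m s. X 1 + \<Delta> = Q' * R' \<and>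
               norm2 \<Delta> \<le> cA m s p * u * norm2 (X 1)) \<and>
            norm2 (1\<^sub>m s - Q'\<^sup>T * Q') \<le> cA' m s p * u)) \<longrightarrow>
      \<alpha>\<^sub>1 \<le> 1 \<longrightarrow>
      (\<forall>B \<in> carrier_mat m s.
         0 < sigma_min B \<longrightarrow>
         cond2 B \<le> (1 + c\<^sub>W m s p * u * cond2 (block_row m X p)) * cond2 (block_row m X p) \<longrightarrow>
         (\<forall>Q' R'. IO_1 B = (Q', R') \<longrightarrow>
            (\<exists>\<Delta> \<in> carrier_mat m s. B + \<Delta> = Q' * R' \<and>
               norm2 \<Delta> \<le> c1 m s p * u * norm2 B) \<and>
            norm2 (1\<^sub>m s - Q'\<^sup>T * Q') \<le> c1' m s p * u * cond2 B powr \<alpha>\<^sub>1)) \<longrightarrow>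
      (\<forall>k\<in>{1..p}.
         (\<exists>\<Delta> \<in> carrier_mat m (k * s).
            block_row m X k + \<Delta> = block_row m Q k * block_upper Rc Rd k \<and>
            norm2 \<Delta> \<le> c\<^sub>R m s p * u * norm2 (block_row m X k)) \<and>
         norm2 (1\<^sub>m (k * s) - (block_row m Q k)\<^sup>T * block_row m Q k) \<le> c\<^sub>O m s p * u))"
proof -
  define L where "L = (\<lambda>m s p. 100 * real (1 + m + s + p) ^ 2 *
    (1 + cA m s p + cA' m s p + c1 m s p + c1' m s p))"
  have "dim_const (\<lambda>m s p. 1 + cA m s p + cA' m s p + c1 m s p + c1' m s p)"
    by (intro dim_const_add dim_const_const assms) simp
  then have L: "dim_const L"
    unfolding L_def by (intro dim_const_mult dim_const_const dim_const_power dim_const_dimension) simp_all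
  have nonneg: "0 \<le> cA m s p" "0 \<le> cA' m s p" "0 \<le> c1 m s p" "0 \<le> c1' m s p" for m s p
    using assms unfolding dim_const_def by blast+
  have L_eq: "L m s p = 100 * real (1 + m + s + p) ^ 2 *
    (1 + cA m s p + cA' m s p + c1 m s p + c1' m s p)" for m s p
    by (simp only: L_def)
  show ?thesis
    \<comment> \<open>60 is the exponent of the smallness condition and 24 that of the excess in the
      condition number of W. The residual exponent 22 is 20 plus one power each for the size and the
      number of blocks; the exponent 20 covers the k increments L^18 u.\<close>
    apply (rule exI[of _ "\<lambda>m s p. L m s p ^ 60"], rule exI[of _ "\<lambda>m s p. L m s p ^ 24"],
        rule exI[of _ "\<lambda>m s p. L m s p ^ 22"], rule exI[of _ "\<lambda>m s p. L m s p ^ 20"])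
    apply (intro conjI)
        apply (rule dim_const_power[OF L])+
    apply (intro allI impI ballI)
    subgoal for m s p u \<alpha> IO_A IO_1 X Q Rc Rd k
      by (rule bcgsi_p_2s_accurate[where IO_A = IO_A and IO_B = IO_1 and \<alpha> = \<alpha>, OF L_eq nonneg])
    done
qed

end
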